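(* Let $G$ be a finite group. There is an equivalence of categories $F\colon\int_{\mathcal F_{G,*}^{\mathrm{op}}}\mathcal T^G\xrightarrow{\simeq}\Omega^G$ from the Grothendieck construction of the oplax functor $\mathcal T^G$ to the category $\Omega^G$ of trees with $G$-action.
   Context: Trees. A tree is a finite (connected) graph with no cycles in which each end of an edge may or may not be attached to a vertex; an unattached end is a loose end. One loose end is chosen as the root; the other loose ends are the leaves. Trees are non-planar. The stick tree has one edge and no vertices; its edge carries both the root and the unique leaf. Leaves and root are identified with the edges carrying them. $E(T),V(T),\ell(T)$ are the sets of edges, vertices, leaves. Each vertex has one outgoing edge (towards the root) and a possibly empty set of incoming edges; a stump is a vertex with no incoming edges. A corolla is a tree with exactly one vertex. A subtree $S'$ of $S$ is a tree whose vertices and edges are subsets of those of $S$ such that if $v\in V(S')$ then all incoming edges of $v$ are in $S'$. The dendroidal category $\Omega$ has trees as objects; a morphism $f\colon T\to S$ is a function $E(T)\to E(S)$ such that for each vertex $v$ of $T$ with outgoing edge $e_0$ and incoming edges $e_1,\dots,e_n$ there is a subtree of $S$ with root $f(e_0)$ and (exactly the $n$ distinct) leaves $f(e_1),\dots,f(e_n)$. $\Omega^G=\mathrm{Fun}(BG,\Omega)$, where $BG$ is the one-object category with morphisms $G$. Labeled trees. For a finite $G$-set $A$, $\mathcal T^G(A)$ is the category whose objects are objects $T$ of $\Omega^G$ with a $G$-equivariant bijection $\chi_T\colon A\to\ell(T)$, and whose morphisms are the morphisms $f\colon T\to S$ of $\Omega^G$ that send leaves to leaves, the root to the root, and satisfy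 $f\circ\chi_T=\chi_S$. $\mathcal F_{G,*}$ is the category of finite pointed $G$-sets $A_+=A\amalg\{+\}$ ($+$ is $G$-fixed) and pointed $G$-equivariant functions. Oplax functors. For a small category $\mathcal A$, an oplax functor $(F,\tau)\colon\mathcal A^{\mathrm{op}}\to\mathrm{Cat}$ consists of categories $F(a)$; functors $F(f)\colon F(b)\to F(a)$ for $f\colon a\to b$; natural transformations $\tau_{f,g}\colon F(gf)\Rightarrow F(f)F(g)$ and $\tau_a\colon F(\mathrm{id}_a)\Rightarrow\mathrm{id}_{F(a)}$, with $(\tau_{f,g}F(h))\circ\tau_{gf,h}=(F(f)\tau_{g,h})\circ\tau_{f,hg}$ and $(\tau_aF(f))\circ\tau_{\mathrm{id}_a,f}=\mathrm{id}=(F(f)\tau_b)\circ\tau_{f,\mathrm{id}_b}$. Its Grothendieck construction $\int_{\mathcal A^{\mathrm{op}}}F$ has objects $(a,x)$, $x\in F(a)$; morphisms $(a,x)\to(b,y)$ are pairs $(f\colon b\to a\text{ in }\mathcal A,\ \alpha\colon F(f)(x)\to y\text{ in }F(b))$; composite of $(f,\alpha)$ followed by $(g,\beta)$ is $(fg,\beta\circ F(g)(\alpha)\circ(\tau_{g,f})_x)$; identities $(\mathrm{id}_a,(\tau_a)_x)$. The oplax functor $\mathcal T^G\colon\mathcal F_{G,*}^{\mathrm{op}}\to\mathrm{Cat}$. On objects $A_+\mapsto\mathcal T^G(A)$. For $\varphi\colon B_+\to A_+$ and $T\in\mathcal T^G(A)$, $\varphi^*(T)\in\mathcal T^G(B)$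 is obtained from $T$ by grafting, onto the leaf labeled $a$ for each $a\in A$, a corolla with leaves labeled by $\varphi^{-1}(a)$ (a stump if empty), and by grafting the root of $T$ onto a leaf of a further corolla whose other leaves are labeled by $\varphi^{-1}(+)\setminus\{+\}$ and whose root is the new root; the $G$-action extends that of $T$ and on leaves is that of $B$. For $f\colon T\to S$, $\varphi^*(f)$ acts as $f$ on edges of $T$, preserves the labels of the new leaves, and sends new root to new root. Structure maps: $(\tau_A)_T\colon\mathrm{id}_{A_+}^*(T)\to T$ is the identity on edges of $T$, sends the new leaf $a$ to the leaf $a$ of $T$ and the new root to the root of $T$; $(\tau_{\gamma,\varphi})_T\colon(\varphi\gamma)^*(T)\to\gamma^*\varphi^*(T)$ is the identity on edges of $T$, preserves leaf labels, and sends root to root. *)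

theory Defs
  imports "HOL-Algebra.Group_Action" "HOL-Library.Infinite_Typeclass"
begin

section \<open>Categories, functors, natural transformations\<close>

text \<open>
  Hom-sets are indexed by pairs of objects and need not be disjoint, so composition, and the action
  of functors on morphisms, take the objects involved as arguments:
  \<open>Cmp C a b c g f\<close> is the composite of \<open>f : a \<rightarrow> b\<close> followed by \<open>g : b \<rightarrow> c\<close>.
\<close>

record ('o, 'm) cat =
  Obj :: "'o set"
  Arr :: "'o \<Rightarrow> 'o \<Rightarrow> 'm set"
  Idt :: "'o \<Rightarrow> 'm"
  Cmp :: "'o \<Rightarrow> 'o \<Rightarrow> 'o \<Rightarrow> 'm \<Rightarrow> 'm \<Rightarrow> 'm"

locale category =
  fixes C :: "('o, 'm) cat"
  assumes Idt_closed: "a \<in> Obj C \<Longrightarrow> Idt C a \<in> Arr C a a"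
    and Cmp_closed: "\<lbrakk>a \<in> Obj C; b \<in> Obj C; c \<in> Obj C; f \<in> Arr C a b; g \<in> Arr C b c\<rbrakk>
      \<Longrightarrow> Cmp C a b c g f \<in> Arr C a c"
    and Idt_left: "\<lbrakk>a \<in> Obj C; b \<in> Obj C; f \<in> Arr C a b\<rbrakk> \<Longrightarrow> Cmp C a b b (Idt C b) f = f"
    and Idt_right: "\<lbrakk>a \<in> Obj C; b \<in> Obj C; f \<in> Arr C a b\<rbrakk> \<Longrightarrow> Cmp C a a b f (Idt C a) = f"
    and Cmp_assoc: "\<lbrakk>a \<in> Obj C; b \<in> Obj C; c \<in> Obj C; d \<in> Obj C;
        f \<in> Arr C a b; g \<in> Arr C b c; h \<in> Arr C c d\<rbrakk>
      \<Longrightarrow> Cmp C a c d h (Cmp C a b c g f) = Cmp C a b d (Cmp C b c d h g) f"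

record ('o, 'm, 'p, 'n) fctr =
  fob :: "'o \<Rightarrow> 'p"
  fmor :: "'o \<Rightarrow> 'o \<Rightarrow> 'm \<Rightarrow> 'n"

locale is_functor = source: category C + target: category D
  for C :: "('o, 'm) cat" and D :: "('p, 'n) cat" +
  fixes F :: "('o, 'm, 'p, 'n) fctr"
  assumes fob_closed: "a \<in> Obj C \<Longrightarrow> fob F a \<in> Obj D"
    and fmor_closed: "\<lbrakk>a \<in> Obj C; b \<in> Obj C; f \<in> Arr C a b\<rbrakk>
      \<Longrightarrow> fmor F a b f \<in> Arr D (fob F a) (fob F b)"
    and fmor_Idt: "a \<in> Obj C \<Longrightarrow> fmor F a a (Idt C a) = Idt D (fob F a)"
    and fmor_Cmp: "\<lbrakk>a \<in> Obj C; b \<in> Obj C; c \<in> Obj C; f \<in> Arr C a b; g \<in> Arr C b c\<rbrakk>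
      \<Longrightarrow> fmor F a c (Cmp C a b c g f)
        = Cmp D (fob F a) (fob F b) (fob F c) (fmor F b c g) (fmor F a b f)"

definition id_fctr :: "('o, 'm, 'o, 'm) fctr" where
  "id_fctr = \<lparr>fob = (\<lambda>a. a), fmor = (\<lambda>a b f. f)\<rparr>"

definition comp_fctr ::
  "('p, 'n, 'q, 'r) fctr \<Rightarrow> ('o, 'm, 'p, 'n) fctr \<Rightarrow> ('o, 'm, 'q, 'r) fctr" where
  "comp_fctr K F = \<lparr>fob = (\<lambda>a. fob K (fob F a)),
     fmor = (\<lambda>a b f. fmor K (fob F a) (fob F b) (fmor F a b f))\<rparr>"

definition nat_trans ::
  "('o, 'm) cat \<Rightarrow> ('p, 'n) cat \<Rightarrow> ('o, 'm, 'p, 'n) fctr \<Rightarrow> ('o, 'm, 'p, 'n) fctr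
    \<Rightarrow> ('o \<Rightarrow> 'n) \<Rightarrow> bool" where
  "nat_trans C D F K \<eta> \<longleftrightarrow>
     is_functor C D F \<and> is_functor C D K \<and>
     (\<forall>a\<in>Obj C. \<eta> a \<in> Arr D (fob F a) (fob K a)) \<and>
     (\<forall>a\<in>Obj C. \<forall>b\<in>Obj C. \<forall>f\<in>Arr C a b.
        Cmp D (fob F a) (fob F b) (fob K b) (\<eta> b) (fmor F a b f)
        = Cmp D (fob F a) (fob K a) (fob K b) (fmor K a b f) (\<eta> a))"

definition is_iso :: "('o, 'm) cat \<Rightarrow> 'o \<Rightarrow> 'o \<Rightarrow> 'm \<Rightarrow> bool" where
  "is_iso C a b f \<longleftrightarrow> f \<in> Arr C a b \<and>
     (\<exists>g\<in>Arr C b a. Cmp C a b a g f = Idt C a \<and> Cmp C b a b f g = Idt C b)"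

definition nat_isomorphic ::
  "('o, 'm) cat \<Rightarrow> ('p, 'n) cat \<Rightarrow> ('o, 'm, 'p, 'n) fctr \<Rightarrow> ('o, 'm, 'p, 'n) fctr \<Rightarrow> bool" where
  "nat_isomorphic C D F K \<longleftrightarrow>
     (\<exists>\<eta>. nat_trans C D F K \<eta> \<and> (\<forall>a\<in>Obj C. is_iso D (fob F a) (fob K a) (\<eta> a)))"

definition equivalence_of_categories ::
  "('o, 'm) cat \<Rightarrow> ('p, 'n) cat \<Rightarrow> ('o, 'm, 'p, 'n) fctr \<Rightarrow> bool" where
  "equivalence_of_categories C D F \<longleftrightarrow>
     is_functor C D F \<and>
     (\<exists>K. is_functor D C K \<and>
        nat_isomorphic C C (comp_fctr K F) id_fctr \<and>
        nat_isomorphic D D (comp_fctr F K) id_fctr)"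

text \<open>Transformations are required to be extensional here so that equality of morphisms
  is equality of components.\<close>

definition functor_category ::
  "('o, 'm) cat \<Rightarrow> ('p, 'n) cat \<Rightarrow> (('o, 'm, 'p, 'n) fctr, 'o \<Rightarrow> 'n) cat" where
  "functor_category C D =
     \<lparr>Obj = {X. is_functor C D X},
      Arr = (\<lambda>X Y. {\<eta> \<in> extensional (Obj C). nat_trans C D X Y \<eta>}),
      Idt = (\<lambda>X. \<lambda>a\<in>Obj C. Idt D (fob X a)),
      Cmp = (\<lambda>X Y Z \<theta> \<eta>. \<lambda>a\<in>Obj C. Cmp D (fob X a) (fob Y a) (fob Z a) (\<theta> a) (\<eta> a))\<rparr>"

definition delooping :: "('g, 'x) monoid_scheme \<Rightarrow> (unit, 'g) cat" where
  "delooping G =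
     \<lparr>Obj = {()},
      Arr = (\<lambda>_ _. carrier G),
      Idt = (\<lambda>_. \<one>\<^bsub>G\<^esub>),
      Cmp = (\<lambda>_ _ _ g h. g \<otimes>\<^bsub>G\<^esub> h)\<rparr>"


section \<open>Oplax functors and the Grothendieck construction\<close>

text \<open>
  Data of an oplax functor from the opposite of \<open>A\<close> to categories: for \<open>f : a \<rightarrow> b\<close> and \<open>g : b \<rightarrow> c\<close>
  in \<open>A\<close>, \<open>reindex F a b f\<close> is the functor \<open>F(f) : F(b) \<rightarrow> F(a)\<close>, \<open>opl_comp F a b c f g\<close> is the
  transformation from \<open>F(g f)\<close> to \<open>F(f) F(g)\<close>, and \<open>opl_unit F a\<close> is the one from \<open>F(id\<^sub>a)\<close> to
  the identity.
\<close>

record ('o, 'm, 'p, 'n) oplax =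
  fibre :: "'o \<Rightarrow> ('p, 'n) cat"
  reindex :: "'o \<Rightarrow> 'o \<Rightarrow> 'm \<Rightarrow> ('p, 'n, 'p, 'n) fctr"
  opl_comp :: "'o \<Rightarrow> 'o \<Rightarrow> 'o \<Rightarrow> 'm \<Rightarrow> 'm \<Rightarrow> 'p \<Rightarrow> 'n"
  opl_unit :: "'o \<Rightarrow> 'p \<Rightarrow> 'n"

locale oplax_functor = base: category A
  for A :: "('o, 'm) cat" +
  fixes F :: "('o, 'm, 'p, 'n) oplax"
  assumes fibre_category: "a \<in> Obj A \<Longrightarrow> category (fibre F a)"
    and reindex_functor: "\<lbrakk>a \<in> Obj A; b \<in> Obj A; f \<in> Arr A a b\<rbrakk>
      \<Longrightarrow> is_functor (fibre F b) (fibre F a) (reindex F a b f)"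
    and opl_comp_nat: "\<lbrakk>a \<in> Obj A; b \<in> Obj A; c \<in> Obj A; f \<in> Arr A a b; g \<in> Arr A b c\<rbrakk>
      \<Longrightarrow> nat_trans (fibre F c) (fibre F a)
            (reindex F a c (Cmp A a b c g f))
            (comp_fctr (reindex F a b f) (reindex F b c g))
            (opl_comp F a b c f g)"
    and opl_unit_nat: "a \<in> Obj A
      \<Longrightarrow> nat_trans (fibre F a) (fibre F a) (reindex F a a (Idt A a)) id_fctr (opl_unit F a)"
    and opl_assoc: "\<lbrakk>a \<in> Obj A; b \<in> Obj A; c \<in> Obj A; d \<in> Obj A;
        f \<in> Arr A a b; g \<in> Arr A b c; h \<in> Arr A c d; x \<in> Obj (fibre F d)\<rbrakk>
      \<Longrightarrow> (let gf = Cmp A a b c g f; hg = Cmp A b c d h g; hgf = Cmp A a c d h gf;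
               x0 = fob (reindex F a d hgf) x;
               h_x = fob (reindex F c d h) x;
               gh_x = fob (reindex F b c g) h_x;
               hg_x = fob (reindex F b d hg) x;
               x1 = fob (reindex F a b f) gh_x
           in Cmp (fibre F a) x0 (fob (reindex F a c gf) h_x) x1
                (opl_comp F a b c f g h_x) (opl_comp F a c d gf h x)
            = Cmp (fibre F a) x0 (fob (reindex F a b f) hg_x) x1
                (fmor (reindex F a b f) hg_x gh_x (opl_comp F b c d g h x))
                (opl_comp F a b d f hg x))"
    and opl_unit_left: "\<lbrakk>a \<in> Obj A; b \<in> Obj A; f \<in> Arr A a b; x \<in> Obj (fibre F b)\<rbrakk>
      \<Longrightarrow> (let f_x = fob (reindex F a b f) x
           in Cmp (fibre F a) f_x (fob (reindex F a a (Idt A a)) f_x) f_x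
                (opl_unit F a f_x) (opl_comp F a a b (Idt A a) f x)
            = Idt (fibre F a) f_x)"
    and opl_unit_right: "\<lbrakk>a \<in> Obj A; b \<in> Obj A; f \<in> Arr A a b; x \<in> Obj (fibre F b)\<rbrakk>
      \<Longrightarrow> (let f_x = fob (reindex F a b f) x; id_x = fob (reindex F b b (Idt A b)) x
           in Cmp (fibre F a) f_x (fob (reindex F a b f) id_x) f_x
                (fmor (reindex F a b f) id_x x (opl_unit F b x)) (opl_comp F a b b f (Idt A b) x)
            = Idt (fibre F a) f_x)"

text \<open>
  A morphism from \<open>(a, x)\<close> to \<open>(b, y)\<close> is a pair of some \<open>f : b \<rightarrow> a\<close> in \<open>A\<close> and some
  \<open>\<alpha> : F(f)(x) \<rightarrow> y\<close> in \<open>F(b)\<close>; the composite of \<open>(f, \<alpha>)\<close> followed by \<open>(g, \<beta>)\<close> is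
  \<open>(f g, \<beta> \<circ> F(g)(\<alpha>) \<circ> \<tau>)\<close>, where \<open>\<tau> : F(f g)(x) \<rightarrow> F(g)(F(f)(x))\<close>.
\<close>

definition grothendieck ::
  "('o, 'm) cat \<Rightarrow> ('o, 'm, 'p, 'n) oplax \<Rightarrow> ('o \<times> 'p, 'm \<times> 'n) cat" where
  "grothendieck A F =
     \<lparr>Obj = {(a, x). a \<in> Obj A \<and> x \<in> Obj (fibre F a)},
      Arr = (\<lambda>(a, x) (b, y).
        {(f, \<alpha>). f \<in> Arr A b a \<and> \<alpha> \<in> Arr (fibre F b) (fob (reindex F b a f) x) y}),
      Idt = (\<lambda>(a, x). (Idt A a, opl_unit F a x)),
      Cmp = (\<lambda>(a, x) (b, y) (c, z) (g, \<beta>) (f, \<alpha>).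
        let fg = Cmp A c b a f g;
            f_x = fob (reindex F b a f) x;
            fg_x = fob (reindex F c a fg) x;
            gf_x = fob (reindex F c b g) f_x;
            g_y = fob (reindex F c b g) y
        in (fg, Cmp (fibre F c) fg_x g_y z \<beta>
                  (Cmp (fibre F c) fg_x gf_x g_y
                    (fmor (reindex F c b g) f_x y \<alpha>) (opl_comp F c b a g f x))))\<rparr>"


section \<open>Trees and the dendroidal category\<close>

text \<open>
  Every edge has two ends, each attached to a vertex or loose (\<open>None\<close>). The choice of a root
  orients all edges; the lower end of an edge is the one towards the root. Thus an edge is outgoing
  at the vertex on its upper end and incoming at the vertex on its lower end. The chosen loose end
  is the lower end of the root edge; the remaining loose ends are upper ends.
\<close>

record ('e, 'v) tree =
  edge_set :: "'e set"
  vertex_set :: "'v set"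
  upper :: "'e \<Rightarrow> 'v option"
  lower :: "'e \<Rightarrow> 'v option"
  root_edge :: 'e

definition ends :: "('e, 'v) tree \<Rightarrow> 'e \<Rightarrow> 'v set" where
  "ends T e = set_option (upper T e) \<union> set_option (lower T e)"

definition incoming :: "('e, 'v) tree \<Rightarrow> 'v \<Rightarrow> 'e set" where
  "incoming T v = {e \<in> edge_set T. lower T e = Some v}"

definition outgoing :: "('e, 'v) tree \<Rightarrow> 'v \<Rightarrow> 'e set" where
  "outgoing T v = {e \<in> edge_set T. upper T e = Some v}"

definition out_edge :: "('e, 'v) tree \<Rightarrow> 'v \<Rightarrow> 'e" where
  "out_edge T v = (THE e. e \<in> outgoing T v)"

definition leaves :: "('e, 'v) tree \<Rightarrow> 'e set" where
  "leaves T = {e \<in> edge_set T. upper T e = None}"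

text \<open>Since every vertex of a tree has an edge, connectedness may be tested on edges.\<close>

definition connected_graph :: "('e, 'v) tree \<Rightarrow> bool" where
  "connected_graph T \<longleftrightarrow>
     (\<forall>d\<in>edge_set T. \<forall>e\<in>edge_set T.
        (d, e) \<in> {(x, y). x \<in> edge_set T \<and> y \<in> edge_set T \<and> ends T x \<inter> ends T y \<noteq> {}}\<^sup>*)"

text \<open>An undirected cycle; length one is a loop, length two a pair of parallel edges.\<close>

definition is_cycle :: "('e, 'v) tree \<Rightarrow> 'e list \<Rightarrow> 'v list \<Rightarrow> bool" where
  "is_cycle T es vs \<longleftrightarrow>
     es \<noteq> [] \<and> length vs = length es \<and> distinct es \<and> distinct vs \<and>
     set es \<subseteq> edge_set T \<and> set vs \<subseteq> vertex_set T \<and>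
     (\<forall>i<length es. {upper T (es ! i), lower T (es ! i)}
                     = {Some (vs ! i), Some (vs ! (Suc i mod length es))})"

definition is_tree :: "('e, 'v) tree \<Rightarrow> bool" where
  "is_tree T \<longleftrightarrow>
     finite (edge_set T) \<and> finite (vertex_set T) \<and>
     (\<forall>e\<in>edge_set T. ends T e \<subseteq> vertex_set T) \<and>
     connected_graph T \<and> (\<nexists>es vs. is_cycle T es vs) \<and>
     (\<forall>v\<in>vertex_set T. \<exists>!e. e \<in> outgoing T v) \<and>
     {e \<in> edge_set T. lower T e = None} = {root_edge T}"

definition subtree :: "('e, 'v) tree \<Rightarrow> ('e, 'v) tree \<Rightarrow> bool" where
  "subtree S' S \<longleftrightarrow>
     is_tree S' \<and> edge_set S' \<subseteq> edge_set S \<and> vertex_set S' \<subseteq> vertex_set S \<and>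
     (\<forall>e\<in>edge_set S'. \<forall>v\<in>vertex_set S'.
        (upper S' e = Some v \<longleftrightarrow> upper S e = Some v) \<and>
        (lower S' e = Some v \<longleftrightarrow> lower S e = Some v)) \<and>
     (\<forall>v\<in>vertex_set S'. incoming S v \<subseteq> edge_set S')"

definition dendroidal :: "(('e, 'v) tree, 'e \<Rightarrow> 'e) cat" where
  "dendroidal =
     \<lparr>Obj = {T. is_tree T},
      Arr = (\<lambda>T S. {f \<in> edge_set T \<rightarrow>\<^sub>E edge_set S.
        \<forall>v\<in>vertex_set T. inj_on f (incoming T v) \<and>
          (\<exists>S'. subtree S' S \<and> root_edge S' = f (out_edge T v) \<and> leaves S' = f ` incoming T v)}),
      Idt = (\<lambda>T. \<lambda>e\<in>edge_set T. e),
      Cmp = (\<lambda>T S R g f. compose (edge_set T) g f)\<rparr>"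

text \<open>
  A supply of names for edges and vertices that contains the label type and is closed under the
  disjoint unions needed for grafting. Over an infinite type \<open>'a\<close> of labels every tree is
  isomorphic to one whose edges and vertices carry such names.
\<close>

datatype 'a cell = Atom 'a | Old "'a cell" | New 'a | Base

type_synonym 'a dtree = "('a cell, 'a cell) tree"

type_synonym ('g, 'a) gtree = "(unit, 'g, 'a dtree, 'a cell \<Rightarrow> 'a cell) fctr"

type_synonym 'a gtree_arr = "unit \<Rightarrow> 'a cell \<Rightarrow> 'a cell"

definition gtree_category ::
  "('g, 'x) monoid_scheme \<Rightarrow> (('g, 'a::infinite) gtree, 'a gtree_arr) cat" where
  "gtree_category G = functor_category (delooping G) dendroidal"

abbreviation the_tree :: "('g, 'a) gtree \<Rightarrow> 'a dtree" where
  "the_tree X \<equiv> fob X ()"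

abbreviation act :: "('g, 'a) gtree \<Rightarrow> 'g \<Rightarrow> 'a cell \<Rightarrow> 'a cell" where
  "act X g \<equiv> fmor X () () g"


section \<open>Finite pointed \<open>G\<close>-sets\<close>

text \<open>
  An object \<open>(A, \<rho>)\<close> stands for the pointed \<open>G\<close>-set obtained from the finite \<open>G\<close>-set \<open>A\<close>, with
  action \<open>\<rho>\<close>, by adding the fixed point \<open>None\<close>.
\<close>

type_synonym ('g, 'a) gset = "'a set \<times> ('g \<Rightarrow> 'a \<Rightarrow> 'a)"

definition pointed :: "'a set \<Rightarrow> 'a option set" where
  "pointed A = insert None (Some ` A)"

definition pointed_gset_category ::
  "('g, 'x) monoid_scheme \<Rightarrow> (('g, 'a::infinite) gset, 'a option \<Rightarrow> 'a option) cat" where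
  "pointed_gset_category G =
     \<lparr>Obj = {(A, \<rho>). finite A \<and> group_action G A \<rho>},
      Arr = (\<lambda>(B, \<sigma>) (A, \<rho>). {\<phi> \<in> pointed B \<rightarrow>\<^sub>E pointed A.
        \<phi> None = None \<and>
        (\<forall>g\<in>carrier G. \<forall>x\<in>pointed B.
           \<phi> (map_option (\<sigma> g) x) = map_option (\<rho> g) (\<phi> x))}),
      Idt = (\<lambda>(A, \<rho>). \<lambda>x\<in>pointed A. x),
      Cmp = (\<lambda>(C, \<kappa>) (B, \<sigma>) (A, \<rho>) \<psi> \<phi>. compose (pointed C) \<psi> \<phi>)\<rparr>"


section \<open>The oplax functor of labelled trees\<close>

type_synonym ('g, 'a) ltree = "('g, 'a) gtree \<times> ('a \<Rightarrow> 'a cell)"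

definition ltree_category ::
  "('g, 'x) monoid_scheme \<Rightarrow> ('g, 'a::infinite) gset \<Rightarrow> (('g, 'a) ltree, 'a gtree_arr) cat" where
  "ltree_category G = (\<lambda>(A, \<rho>).
     \<lparr>Obj = {(X, \<chi>). X \<in> Obj (gtree_category G) \<and>
        \<chi> \<in> extensional A \<and> bij_betw \<chi> A (leaves (the_tree X)) \<and>
        (\<forall>g\<in>carrier G. \<forall>a\<in>A. \<chi> (\<rho> g a) = act X g (\<chi> a))},
      Arr = (\<lambda>(X, \<chi>) (Y, \<xi>). {f \<in> Arr (gtree_category G) X Y.
        f () ` leaves (the_tree X) \<subseteq> leaves (the_tree Y) \<and>
        f () (root_edge (the_tree X)) = root_edge (the_tree Y) \<and>
        (\<forall>a\<in>A. f () (\<chi> a) = \<xi> a)}),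
      Idt = (\<lambda>(X, \<chi>). Idt (gtree_category G) X),
      Cmp = (\<lambda>(X, \<chi>) (Y, \<xi>) (Z, \<zeta>) g f. Cmp (gtree_category G) X Y Z g f)\<rparr>)"

text \<open>
  The underlying tree of \<open>\<phi>\<^sup>*(T)\<close>, where \<open>\<chi>\<close> labels the leaves of \<open>T\<close> by \<open>A\<close> and
  \<open>\<phi> : B\<^sub>+ \<rightarrow> A\<^sub>+\<close>. Its edges are the edges \<open>Old e\<close> of \<open>T\<close>, the new leaves \<open>New b\<close> and the new root
  \<open>Base\<close>; its vertices are the vertices \<open>Old v\<close> of \<open>T\<close>, the vertex \<open>New a\<close> of the corolla grafted
  onto the leaf labelled \<open>a\<close>, and the vertex \<open>Base\<close> of the corolla at the new root.
\<close>

definition graft ::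
  "'a set \<Rightarrow> 'a set \<Rightarrow> ('a option \<Rightarrow> 'a option) \<Rightarrow> 'a dtree \<Rightarrow> ('a \<Rightarrow> 'a cell) \<Rightarrow> 'a dtree" where
  "graft B A \<phi> T \<chi> =
     \<lparr>edge_set = Old ` edge_set T \<union> New ` B \<union> {Base},
      vertex_set = Old ` vertex_set T \<union> New ` A \<union> {Base},
      upper = (\<lambda>x. case x of
          Old e \<Rightarrow> (case upper T e of Some v \<Rightarrow> Some (Old v)
                    | None \<Rightarrow> Some (New (the_inv_into A \<chi> e)))
        | New b \<Rightarrow> None
        | Base \<Rightarrow> Some Base
        | Atom _ \<Rightarrow> None),
      lower = (\<lambda>x. case x of
          Old e \<Rightarrow> (case lower T e of Some v \<Rightarrow> Some (Old v) | None \<Rightarrow> Some Base)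
        | New b \<Rightarrow> (case \<phi> (Some b) of Some a \<Rightarrow> Some (New a) | None \<Rightarrow> Some Base)
        | Base \<Rightarrow> None
        | Atom _ \<Rightarrow> None),
      root_edge = Base\<rparr>"

fun graft_map :: "('a cell \<Rightarrow> 'a cell) \<Rightarrow> ('a \<Rightarrow> 'a) \<Rightarrow> 'a cell \<Rightarrow> 'a cell" where
  "graft_map f h (Old e) = Old (f e)"
| "graft_map f h (New b) = New (h b)"
| "graft_map f h Base = Base"
| "graft_map f h (Atom c) = Atom c"

definition pullback_tree ::
  "('g, 'a) gset \<Rightarrow> ('g, 'a) gset \<Rightarrow> ('a option \<Rightarrow> 'a option) \<Rightarrow> ('g, 'a) ltree \<Rightarrow> ('g, 'a) ltree" where
  "pullback_tree = (\<lambda>(B, \<sigma>) (A, \<rho>) \<phi> (X, \<chi>).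
     let T' = graft B A \<phi> (the_tree X) \<chi>
     in (\<lparr>fob = (\<lambda>_. T'), fmor = (\<lambda>_ _ g. \<lambda>x\<in>edge_set T'. graft_map (act X g) (\<sigma> g) x)\<rparr>,
         \<lambda>b\<in>B. New b))"

definition pullback_fctr ::
  "('g, 'a) gset \<Rightarrow> ('g, 'a) gset \<Rightarrow> ('a option \<Rightarrow> 'a option)
    \<Rightarrow> (('g, 'a) ltree, 'a gtree_arr, ('g, 'a) ltree, 'a gtree_arr) fctr" where
  "pullback_fctr B A \<phi> =
     \<lparr>fob = pullback_tree B A \<phi>,
      fmor = (\<lambda>T S f. \<lambda>_.
        \<lambda>x\<in>edge_set (the_tree (fst (pullback_tree B A \<phi> T))). graft_map (f ()) (\<lambda>b. b) x)\<rparr>"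

definition pullback_unit :: "('g, 'a) gset \<Rightarrow> ('g, 'a) ltree \<Rightarrow> 'a gtree_arr" where
  "pullback_unit = (\<lambda>(A, \<rho>) (X, \<chi>). \<lambda>_.
     \<lambda>x\<in>edge_set (graft A A (\<lambda>y\<in>pointed A. y) (the_tree X) \<chi>).
       case x of Old e \<Rightarrow> e | New a \<Rightarrow> \<chi> a | Base \<Rightarrow> root_edge (the_tree X) | Atom _ \<Rightarrow> undefined)"

text \<open>For \<open>\<gamma> : C\<^sub>+ \<rightarrow> B\<^sub>+\<close> and \<open>\<phi> : B\<^sub>+ \<rightarrow> A\<^sub>+\<close>, the map from \<open>(\<phi> \<gamma>)\<^sup>*(T)\<close> to \<open>\<gamma>\<^sup>*(\<phi>\<^sup>*(T))\<close>; an edge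
  \<open>e\<close> of \<open>T\<close> is named \<open>Old e\<close> in the former and \<open>Old (Old e)\<close> in the latter.\<close>

definition pullback_comp ::
  "('g, 'a) gset \<Rightarrow> ('g, 'a) gset \<Rightarrow> ('g, 'a) gset
    \<Rightarrow> ('a option \<Rightarrow> 'a option) \<Rightarrow> ('a option \<Rightarrow> 'a option) \<Rightarrow> ('g, 'a) ltree \<Rightarrow> 'a gtree_arr" where
  "pullback_comp = (\<lambda>(C, \<kappa>) (B, \<sigma>) (A, \<rho>) \<gamma> \<phi> (X, \<chi>). \<lambda>_.
     \<lambda>x\<in>edge_set (graft C A (compose (pointed C) \<phi> \<gamma>) (the_tree X) \<chi>). graft_map Old (\<lambda>c. c) x)"

definition labelled_trees ::
  "('g, 'x) monoid_scheme
    \<Rightarrow> (('g, 'a::infinite) gset, 'a option \<Rightarrow> 'a option, ('g, 'a) ltree, 'a gtree_arr) oplax" where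
  "labelled_trees G =
     \<lparr>fibre = ltree_category G,
      reindex = pullback_fctr,
      opl_comp = pullback_comp,
      opl_unit = pullback_unit\<rparr>"

end

theory Submission
  imports Defs
begin

text \<open>
  A subtree of a tree is determined by its root and its leaves, and the possible pairs are generated
  inductively by sticks and by grafting along vertices. In this form morphisms of trees preserve
  subtrees, and the axioms of the oplax functor become identities between maps of edges.

  The equivalence forgets the labels and restricts a morphism \<open>\<alpha> : \<phi>\<^sup>*(T) \<rightarrow> S\<close> to the edges of \<open>T\<close>.
  It is surjective on objects because leaves can be named by labels. Given \<open>f : T \<rightarrow> S\<close>, the leaves
  of \<open>T\<close> go to pairwise incomparable edges of \<open>S\<close>, so that a leaf of \<open>S\<close> lies below the image of at
  most one of them. Sending it to that leaf, or to the base point if there is none, is the only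
  choice of \<open>\<phi>\<close> for which \<open>f\<close> extends to \<open>\<phi>\<^sup>*(T)\<close>, and the extension is forced on the new edges.
\<close>

section \<open>Trees and subtrees\<close>

text \<open>An edge lies below another if its path to the root passes through it, so the root is the
  largest edge, contrary to what the field name \<open>lower\<close> suggests. The leaves of a
  subtree are pairwise incomparable, and every leaf of the whole tree below the root of the subtree
  is below one of them. Incomparability makes \<open>\<phi>\<close> well defined; covering
  identifies the leaves that it sends to the base point as those not below the image of the root.

  A morphism of trees need not preserve root or leaves. The base corolla fills the gap between the
  image of the root and the root of the target, the other corollas fill the gaps between images of
  leaves and leaves of the target. Stumps allow a subtree without leaves, so there may be no leaf
  below a given edge; hence \<open>\<phi>\<close> is described starting from the leaves of the
  target.

  Composites in the Grothendieck construction involve the structure maps, which makes associativity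
  awkward. Restriction to the old edges is injective on morphisms and respects composition, so the
  category laws are pulled back along it.\<close>

definition child :: "('e, 'v) tree \<Rightarrow> ('e \<times> 'e) set" where
  "child T = {(d, e). d \<in> edge_set T \<and> e \<in> edge_set T \<and>
     (\<exists>v. lower T d = Some v \<and> upper T e = Some v)}"

lemma child_iff_incoming:
  "\<lbrakk>e \<in> edge_set T; upper T e = Some v\<rbrakk> \<Longrightarrow> (d, e) \<in> child T \<longleftrightarrow> d \<in> incoming T v"
  by (auto simp: child_def incoming_def)

lemma child_edges: "(d, e) \<in> child T \<Longrightarrow> d \<in> edge_set T \<and> e \<in> edge_set T"
  by (auto simp: child_def)

lemma child_rtrancl_edges:
  "(d, e) \<in> (child T)\<^sup>* \<Longrightarrow> e \<in> edge_set T \<Longrightarrow> d \<in> edge_set T"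
  by (induction rule: converse_rtrancl_induct) (auto dest: child_edges)

lemma finite_child: "finite (edge_set T) \<Longrightarrow> finite (child T)"
  by (rule finite_subset[of _ "edge_set T \<times> edge_set T"]) (auto simp: child_def)

lemma single_valued_child:
  assumes "\<forall>e\<in>edge_set T. ends T e \<subseteq> vertex_set T" "\<forall>v\<in>vertex_set T. \<exists>!e. e \<in> outgoing T v"
  shows "single_valued (child T)"
proof (rule single_valuedI)
  fix x y z assume "(x, y) \<in> child T" "(x, z) \<in> child T"
  then obtain v where v: "upper T y = Some v" "upper T z = Some v" "y \<in> edge_set T" "z \<in> edge_set T"
    by (auto simp: child_def)
  then have "v \<in> vertex_set T" using assms(1) by (auto simp: ends_def)
  with assms(2) v show "y = z" by (auto simp: outgoing_def)
qed

text \<open>Paths towards the root are unique, so every edge reachable from a point of a directed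
  cycle leads back to that point. The root would be such an edge, yet it has no parent.\<close>

lemma acyclic_child_of_reach:
  assumes sv: "single_valued (child T)"
    and root: "lower T (root_edge T) = None"
    and reach: "\<And>e. e \<in> edge_set T \<Longrightarrow> (e, root_edge T) \<in> (child T)\<^sup>*"
  shows "acyclic (child T)"
proof (rule acyclicI, rule allI, rule notI)
  fix x assume x: "(x, x) \<in> (child T)\<^sup>+"
  have returns: "(z, x) \<in> (child T)\<^sup>*" if "(x, z) \<in> (child T)\<^sup>*" for z
    using that
  proof (induction rule: rtrancl_induct)
    case (step y z)
    show ?case
    proof (cases "y = x")
      case True
      from x obtain w where "(x, w) \<in> child T" "(w, x) \<in> (child T)\<^sup>*" by (meson tranclD)
      with sv True step.hyps(2) show ?thesis by (metis single_valuedD)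
    next
      case False
      with step.IH obtain w where "(y, w) \<in> child T" "(w, x) \<in> (child T)\<^sup>*"
        by (meson converse_rtranclE)
      with sv step.hyps(2) show ?thesis by (metis single_valuedD)
    qed
  qed simp
  have "x \<in> edge_set T" using x by (meson child_edges tranclD)
  with reach returns have "(root_edge T, x) \<in> (child T)\<^sup>*" by blast
  then have "(root_edge T, x) \<in> (child T)\<^sup>+" using x by (rule rtrancl_trancl_trancl)
  then obtain w where "(root_edge T, w) \<in> child T" by (meson tranclD)
  with root show False by (auto simp: child_def)
qed

text \<open>The top edge of a cycle shares its upper vertex with another edge of the cycle, which must
  enter that vertex.\<close>

lemma is_treeI:
  assumes fin: "finite (edge_set T)" "finite (vertex_set T)"
    and ends: "\<And>e. e \<in> edge_set T \<Longrightarrow> ends T e \<subseteq> vertex_set T"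
    and out: "\<And>v. v \<in> vertex_set T \<Longrightarrow> \<exists>!e. e \<in> outgoing T v"
    and root: "{e \<in> edge_set T. lower T e = None} = {root_edge T}"
    and reach: "\<And>e. e \<in> edge_set T \<Longrightarrow> (e, root_edge T) \<in> (child T)\<^sup>*"
  shows "is_tree T"
proof -
  define R where "R = {(x, y). x \<in> edge_set T \<and> y \<in> edge_set T \<and> ends T x \<inter> ends T y \<noteq> {}}"
  have "child T \<subseteq> R" by (auto simp: R_def child_def ends_def)
  then have *: "(e, root_edge T) \<in> R\<^sup>*" if "e \<in> edge_set T" for e
    using reach[OF that] rtrancl_mono by blast
  have "sym (R\<^sup>*)" by (rule sym_rtrancl) (auto simp: R_def sym_def)
  then have "(d, e) \<in> R\<^sup>*" if "d \<in> edge_set T" "e \<in> edge_set T" for d e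
    using *[OF that(1)] *[OF that(2)] by (meson symE rtrancl_trans)
  then have conn: "connected_graph T"
    unfolding connected_graph_def R_def by blast
  have sv: "single_valued (child T)" by (rule single_valued_child) (intro ballI ends out, assumption)+
  have "lower T (root_edge T) = None" using root by auto
  then have "acyclic (child T)" using acyclic_child_of_reach[OF sv _ reach] by blast
  then have wf: "wf (child T)" by (intro finite_acyclic_wf finite_child fin)
  have cyc: "\<not> is_cycle T es vs" for es vs
  proof
    assume "is_cycle T es vs"
    let ?n = "length es"
    from \<open>is_cycle T es vs\<close> have n: "?n > 0" "length vs = ?n" and dist: "distinct es" "set es \<subseteq> edge_set T"
      and cyc: "\<And>i. i < ?n \<Longrightarrow> {upper T (es ! i), lower T (es ! i)}
                     = {Some (vs ! i), Some (vs ! (Suc i mod ?n))}"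
      by (auto simp: is_cycle_def)
    obtain e where e: "e \<in> set es" and min: "\<And>d. (d, e) \<in> child T \<Longrightarrow> d \<notin> set es"
      using wfE_min'[OF wf, of "set es"] n by auto
    obtain i where i: "i < ?n" "e = es ! i" using e by (auto simp: in_set_conv_nth)
    \<comment> \<open>The edge with index k meets e at the upper end of e; it is the cyclic
      predecessor or successor of e. It is e itself only when the cycle is a loop, a case that has
      to be carried along.\<close>
    have "\<exists>k<?n. upper T e \<in> {upper T (es ! k), lower T (es ! k)} \<and> (k = i \<longrightarrow> ?n = 1)
            \<and> (upper T e \<noteq> None)"
    proof -
      have cases: "upper T e = Some (vs ! i) \<or> upper T e = Some (vs ! (Suc i mod ?n))"
        using cyc[OF i(1)] i(2) by blast
      then show ?thesis
      proof
        assume u: "upper T e = Some (vs ! i)"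
        define k where "k = (if i = 0 then ?n - 1 else i - 1)"
        have k: "k < ?n" "Suc k mod ?n = i" "k = i \<longrightarrow> ?n = 1" using i n by (auto simp: k_def)
        then show ?thesis using cyc[OF k(1)] u by (intro exI[of _ k]) auto
      next
        assume u: "upper T e = Some (vs ! (Suc i mod ?n))"
        have k: "Suc i mod ?n < ?n" "Suc i mod ?n = i \<longrightarrow> ?n = 1"
          using i n by (auto simp: mod_Suc split: if_splits)
        then show ?thesis using cyc[OF k(1)] u by (intro exI[of _ "Suc i mod ?n"]) auto
      qed
    qed
    then obtain k where k: "k < ?n" "upper T e \<in> {upper T (es ! k), lower T (es ! k)}"
        "k = i \<longrightarrow> ?n = 1" "upper T e \<noteq> None" by blast
    obtain v where v: "upper T e = Some v" using k by blast
    have E: "e \<in> edge_set T" "es ! k \<in> edge_set T" using e dist k by auto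
    have "v \<in> vertex_set T" using ends[OF E(1)] v by (auto simp: ends_def)
    have "lower T (es ! k) = Some v"
    proof (rule ccontr)
      assume *: "lower T (es ! k) \<noteq> Some v"
      then have "upper T (es ! k) = Some v" using k v by auto
      then have "es ! k = e" using out[OF \<open>v \<in> vertex_set T\<close>] v E by (auto simp: outgoing_def)
      then have "k = i" using dist k i by (metis nth_eq_iff_index_eq)
      with k have "?n = 1" by blast
      with cyc[of 0] have "upper T (es ! 0) = lower T (es ! 0)" by auto
      with * v i \<open>k = i\<close> \<open>?n = 1\<close> show False by auto
    qed
    then have "(es ! k, e) \<in> child T" using E v by (auto simp: child_def)
    with min[of "es ! k"] k show False by simp
  qed
  show ?thesis
    unfolding is_tree_def
  proof (intro conjI)
    show "\<nexists>es vs. is_cycle T es vs" using cyc by blast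
  qed (rule fin conn root | intro ballI ends out, assumption)+
qed

lemma is_treeD:
  assumes "is_tree T"
  shows "finite (edge_set T)" "finite (vertex_set T)"
    "e \<in> edge_set T \<Longrightarrow> ends T e \<subseteq> vertex_set T"
    "v \<in> vertex_set T \<Longrightarrow> \<exists>!e. e \<in> outgoing T v"
    "{e \<in> edge_set T. lower T e = None} = {root_edge T}"
    "\<not> is_cycle T es vs"
proof -
  note * = assms[unfolded is_tree_def]
  show "finite (edge_set T)" using * by (elim conjE)
  show "finite (vertex_set T)" using * by (elim conjE)
  show "{e \<in> edge_set T. lower T e = None} = {root_edge T}" using * by (elim conjE)
  show "ends T e \<subseteq> vertex_set T" if "e \<in> edge_set T"
    using * that by (elim conjE) (rule bspec)
  show "\<exists>!e. e \<in> outgoing T v" if "v \<in> vertex_set T"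
    using * that by (elim conjE) (rule bspec)
  show "\<not> is_cycle T es vs" using * by (elim conjE) (metis)
qed

text \<open>A directed cycle of minimal length repeats no edge, and since a vertex has a single
  outgoing edge it repeats no vertex either. It is then an undirected cycle in the sense of
  \<open>is_cycle\<close>.\<close>

lemma acyclic_child:
  assumes "is_tree T"
  shows "acyclic (child T)"
proof (rule ccontr)
  assume "\<not> acyclic (child T)"
  then obtain x0 where "(x0, x0) \<in> (child T)\<^sup>+" by (auto simp: acyclic_def)
  then obtain n0 where n0: "0 < n0 \<and> (\<exists>x. (x, x) \<in> child T ^^ n0)" by (metis trancl_power)
  define P where "P n \<longleftrightarrow> 0 < n \<and> (\<exists>x. (x, x) \<in> child T ^^ n)" for n
  then have "P n0" using n0 by simp
  then obtain n where "P n" and min: "\<And>m. m < n \<Longrightarrow> \<not> P m" using exists_least_iff[of P] by blast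
  then obtain x where n: "0 < n" and x: "(x, x) \<in> child T ^^ n" by (auto simp: P_def)
  obtain f where f: "f 0 = f n" "\<And>i. i < n \<Longrightarrow> (f i, f (Suc i)) \<in> child T"
    using x unfolding relpow_fun_conv by metis
  have inj: "f i \<noteq> f j" if "i < j" "j < n" for i j
  proof
    assume "f i = f j"
    have "(f i, f j) \<in> child T ^^ (j - i)"
      unfolding relpow_fun_conv using that f by (intro exI[of _ "\<lambda>k. f (i + k)"]) auto
    with \<open>f i = f j\<close> min[of "j - i"] that show False unfolding P_def by fastforce
  qed
  have ed: "f i \<in> edge_set T" if "i < n" for i using f(2)[OF that] by (auto dest: child_edges)
  \<comment> \<open>The upper end of \<open>f i\<close> is \<open>w i\<close> and its lower end is
    \<open>w (Suc i)\<close>, the index n being read as 0 because \<open>f 0 = f n\<close>.\<close>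
  define w where "w i = the (upper T (f i))" for i
  have up: "upper T (f i) = Some (w i)" if "i < n" for i
  proof -
    obtain k where "k < n" "f i = f (Suc k)"
    proof (cases i)
      case 0
      with f(1) n that[of "n - 1"] show ?thesis by auto
    next
      case (Suc k)
      with that[of k] \<open>i < n\<close> show ?thesis by auto
    qed
    with f(2)[of k] show ?thesis by (auto simp: child_def w_def)
  qed
  have lo: "lower T (f i) = Some (w (Suc i mod n))" if "i < n" for i
  proof (cases "Suc i = n")
    case True
    with f(2)[OF that] f(1) show ?thesis by (auto simp: child_def w_def)
  next
    case False
    with f(2)[OF that] that show ?thesis by (auto simp: child_def w_def)
  qed
  have wV: "w i \<in> vertex_set T" if "i < n" for i
  proof -
    have "ends T (f i) \<subseteq> vertex_set T" by (rule is_treeD(3)[OF assms ed[OF that]])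
    with up[OF that] show ?thesis by (auto simp: ends_def)
  qed
  have winj: "w i \<noteq> w j" if "i < j" "j < n" for i j
  proof
    assume "w i = w j"
    then have "f i \<in> outgoing T (w j)" "f j \<in> outgoing T (w j)"
      using up[of i] up[of j] ed[of i] ed[of j] that by (auto simp: outgoing_def)
    moreover have "\<exists>!e. e \<in> outgoing T (w j)" by (rule is_treeD(4)[OF assms wV[OF that(2)]])
    ultimately show False using inj[OF that] by auto
  qed
  have "inj_on f {0..<n}" "inj_on w {0..<n}"
    by (intro linorder_inj_onI; use inj winj in force)+
  moreover have "{upper T (map f [0..<n] ! i), lower T (map f [0..<n] ! i)}
      = {Some (map w [0..<n] ! i), Some (map w [0..<n] ! (Suc i mod n))}" if "i < n" for i
    using up[OF that] lo[OF that] n that by simp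
  ultimately have "is_cycle T (map f [0..<n]) (map w [0..<n])"
    unfolding is_cycle_def using n ed wV by (simp add: distinct_map image_subset_iff)
  then show False by (rule notE[OF is_treeD(6)[OF assms]])
qed

section \<open>The rooted order on the edges of a tree\<close>

lemma tree_upper_vertex:
  assumes "is_tree T" "e \<in> edge_set T" "upper T e = Some v"
  shows "v \<in> vertex_set T"
proof -
  have "ends T e \<subseteq> vertex_set T" by (rule is_treeD(3)[OF assms(1,2)])
  with assms(3) show ?thesis by (auto simp: ends_def)
qed

lemma tree_lower_vertex:
  assumes "is_tree T" "e \<in> edge_set T" "lower T e = Some v"
  shows "v \<in> vertex_set T"
proof -
  have "ends T e \<subseteq> vertex_set T" by (rule is_treeD(3)[OF assms(1,2)])
  with assms(3) show ?thesis by (auto simp: ends_def)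
qed

lemma tree_upper_inj:
  assumes "is_tree T" "e \<in> edge_set T" "e' \<in> edge_set T" "upper T e = Some v" "upper T e' = Some v"
  shows "e = e'"
proof -
  have "v \<in> vertex_set T" using tree_upper_vertex assms by metis
  from is_treeD(4)[OF assms(1) this] have "\<exists>!e. e \<in> outgoing T v" .
  with assms show ?thesis by (auto simp: outgoing_def)
qed

lemma tree_out_edge:
  assumes "is_tree T" "v \<in> vertex_set T"
  shows "out_edge T v \<in> edge_set T" "upper T (out_edge T v) = Some v"
proof -
  have "\<exists>!e. e \<in> outgoing T v" by (rule is_treeD(4)[OF assms])
  then have "out_edge T v \<in> outgoing T v" unfolding out_edge_def by (rule theI')
  then show "out_edge T v \<in> edge_set T" "upper T (out_edge T v) = Some v"
    by (auto simp: outgoing_def)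
qed

lemma out_edge_eq: "\<lbrakk>is_tree T; e \<in> edge_set T; upper T e = Some v\<rbrakk> \<Longrightarrow> out_edge T v = e"
  using tree_out_edge tree_upper_inj tree_upper_vertex by metis

lemma tree_single_valued_child: "is_tree T \<Longrightarrow> single_valued (child T)"
  by (intro single_valued_child ballI) (simp_all only: is_treeD)

lemma tree_wf_child: "is_tree T \<Longrightarrow> wf (child T)"
  by (simp add: finite_acyclic_wf finite_child acyclic_child is_treeD(1))

lemma tree_wf_converse_child: "is_tree T \<Longrightarrow> wf ((child T)\<inverse>)"
  by (simp add: finite_acyclic_wf_converse finite_child acyclic_child is_treeD(1))

lemma tree_root:
  assumes "is_tree T"
  shows "root_edge T \<in> edge_set T" "lower T (root_edge T) = None"
    "\<And>e. \<lbrakk>e \<in> edge_set T; lower T e = None\<rbrakk> \<Longrightarrow> e = root_edge T"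
proof -
  have *: "e \<in> edge_set T \<and> lower T e = None \<longleftrightarrow> e = root_edge T" for e
    using arg_cong[OF is_treeD(5)[OF assms], of "\<lambda>A. e \<in> A"] by simp
  show "root_edge T \<in> edge_set T" "lower T (root_edge T) = None" using * by blast+
  show "e = root_edge T" if "e \<in> edge_set T" "lower T e = None" for e using * that by blast
qed

lemma tree_parent:
  assumes "is_tree T" "e \<in> edge_set T" "e \<noteq> root_edge T"
  obtains d where "(e, d) \<in> child T"
proof -
  obtain v where v: "lower T e = Some v"
    using tree_root(3)[OF assms(1,2)] assms(3) by (cases "lower T e") auto
  then have "v \<in> vertex_set T" using assms tree_lower_vertex by metis
  from tree_out_edge[OF assms(1) this] v assms(2) that show ?thesis by (auto simp: child_def)
qed

text \<open>The induction climbs from an edge to its parent; this relation is well founded because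
  it is finite and acyclic, and only the root has no parent.\<close>

lemma tree_reach_root:
  assumes "is_tree T" "e \<in> edge_set T"
  shows "(e, root_edge T) \<in> (child T)\<^sup>*"
  using tree_wf_converse_child[OF assms(1)] assms(2)
proof (induction e rule: wf_induct_rule)
  case (less e)
  show ?case
  proof (cases "e = root_edge T")
    case False
    with tree_parent[OF assms(1) less.prems] obtain d where d: "(e, d) \<in> child T" by blast
    with less.IH[of d] child_edges[OF d] show ?thesis by (auto intro: converse_rtrancl_into_rtrancl)
  qed simp
qed

lemma tree_antisym:
  assumes "is_tree T" "(x, y) \<in> (child T)\<^sup>*" "(y, x) \<in> (child T)\<^sup>*"
  shows "x = y"
  using acyclic_impl_antisym_rtrancl[OF acyclic_child[OF assms(1)]] assms(2,3) by (auto dest: antisymD)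

text \<open>The edges above a given one form its unique path to the root, hence a chain. In this way
  incomparable edges have no common descendant.\<close>

lemma tree_comparable:
  assumes "is_tree T" "(x, y) \<in> (child T)\<^sup>*" "(x, z) \<in> (child T)\<^sup>*"
  shows "(y, z) \<in> (child T)\<^sup>* \<or> (z, y) \<in> (child T)\<^sup>*"
  using single_valued_confluent tree_single_valued_child assms by metis

lemma child_rtrancl_strict:
  assumes "is_tree T" "(d, e) \<in> (child T)\<^sup>*" "d \<noteq> e" "(d, p) \<in> child T"
  shows "(p, e) \<in> (child T)\<^sup>*"
proof -
  from assms(2,3) obtain w where "(d, w) \<in> child T" "(w, e) \<in> (child T)\<^sup>*"
    by (meson converse_rtranclE)
  with tree_single_valued_child[OF assms(1)] assms(4) show ?thesis by (metis single_valuedD)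
qed

text \<open>For a tree \<open>T\<close>, \<open>is_cut T r L\<close> holds iff \<open>T\<close> has a subtree with root \<open>r\<close> and leaves \<open>L\<close>; in
  operadic terms, iff there is an operation from \<open>L\<close> to \<open>r\<close> in the free operad on \<open>T\<close>.\<close>

inductive is_cut :: "('e, 'v) tree \<Rightarrow> 'e \<Rightarrow> 'e set \<Rightarrow> bool" for T where
  cut_stick: "r \<in> edge_set T \<Longrightarrow> is_cut T r {r}"
| cut_node: "\<lbrakk>r \<in> edge_set T; upper T r = Some v; \<And>e. e \<in> incoming T v \<Longrightarrow> is_cut T e (L e)\<rbrakk>
    \<Longrightarrow> is_cut T r (\<Union>e\<in>incoming T v. L e)"

section \<open>Cuts: incomparability, covering and substitution\<close>

lemma cut_node': "\<lbrakk>r \<in> edge_set T; upper T r = Some v; \<And>e. e \<in> incoming T v \<Longrightarrow> is_cut T e (L e);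
    M = (\<Union>e\<in>incoming T v. L e)\<rbrakk> \<Longrightarrow> is_cut T r M"
  using cut_node by metis

lemma cut_root_edge: "is_cut T r L \<Longrightarrow> r \<in> edge_set T"
  by (auto elim: is_cut.cases)

lemma cut_corolla: "\<lbrakk>r \<in> edge_set T; upper T r = Some v\<rbrakk> \<Longrightarrow> is_cut T r (incoming T v)"
  by (rule cut_node'[where L = "\<lambda>e. {e}"]) (auto intro: cut_stick simp: incoming_def)

lemma cut_below: "is_cut T r L \<Longrightarrow> l \<in> L \<Longrightarrow> (l, r) \<in> (child T)\<^sup>*"
proof (induction rule: is_cut.induct)
  case (cut_node r v L)
  then obtain e where e: "e \<in> incoming T v" "l \<in> L e" by blast
  then have "(e, r) \<in> child T" using cut_node by (simp add: child_iff_incoming)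
  with cut_node.IH[OF e] show ?case by (rule rtrancl_into_rtrancl)
qed simp

lemma cut_edges: "is_cut T r L \<Longrightarrow> L \<subseteq> edge_set T"
  using cut_below cut_root_edge child_rtrancl_edges by (metis subsetI)

text \<open>A common descendant makes the siblings comparable. Were they distinct, the parent of the
  smaller one would lie below the larger one, which is itself a child of that parent: a
  cycle.\<close>

lemma siblings_disjoint:
  assumes "is_tree T" "(d, p) \<in> child T" "(e, p) \<in> child T" "(x, d) \<in> (child T)\<^sup>*" "(x, e) \<in> (child T)\<^sup>*"
  shows "d = e"
proof -
  have *: "d = e" if "(d, e) \<in> (child T)\<^sup>*" "(d, p) \<in> child T" "(e, p) \<in> child T" for d e
  proof (rule ccontr)
    assume "d \<noteq> e"
    with child_rtrancl_strict[OF assms(1)] that have "(p, e) \<in> (child T)\<^sup>*" by blast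
    with that(3) have "(e, e) \<in> (child T)\<^sup>+" by (rule rtrancl_into_trancl2)
    with acyclic_child[OF assms(1)] show False by (auto simp: acyclic_def)
  qed
  show ?thesis using tree_comparable[OF assms(1,4,5)] * assms(2,3) by metis
qed

text \<open>Edges from different branches of the cut lie below different siblings, and a comparison
  would give these siblings a common descendant.\<close>

lemma cut_antichain:
  assumes "is_tree T" "is_cut T r L" "x \<in> L" "y \<in> L" "(x, y) \<in> (child T)\<^sup>*"
  shows "x = y"
  using assms(2-)
proof (induction)
  case (cut_node r v L)
  then obtain d e where d: "d \<in> incoming T v" "x \<in> L d" and e: "e \<in> incoming T v" "y \<in> L e" by blast
  have "(d, r) \<in> child T" "(e, r) \<in> child T" using d e cut_node.hyps by (auto simp: child_iff_incoming)
  moreover have "(x, d) \<in> (child T)\<^sup>*" using cut_below cut_node.hyps d by metis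
  moreover have "(y, e) \<in> (child T)\<^sup>*" using cut_below cut_node.hyps e by metis
  ultimately have "d = e" using siblings_disjoint[OF assms(1)] cut_node.prems(3) by (meson rtrancl_trans)
  with cut_node.IH[OF d(1)] d e cut_node.prems show ?case by blast
qed simp

text \<open>Operadic composition: a subtree is grafted onto every leaf of another one.\<close>

lemma cut_subst: "is_cut T r L \<Longrightarrow> (\<And>e. e \<in> L \<Longrightarrow> is_cut T e (M e)) \<Longrightarrow> is_cut T r (\<Union>e\<in>L. M e)"
proof (induction rule: is_cut.induct)
  case (cut_node r v L)
  have "is_cut T d (\<Union>e\<in>L d. M e)" if "d \<in> incoming T v" for d
    using cut_node.IH[OF that] cut_node.prems that by blast
  from cut_node'[OF cut_node.hyps(1,2) this] show ?case by simp
qed auto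

lemma child_rtrancl_leaf:
  assumes "(d, e) \<in> (child T)\<^sup>*" "e \<in> leaves T"
  shows "d = e"
  using assms(1)
proof (cases rule: rtranclE)
  case (step y)
  with assms(2) show ?thesis by (simp add: child_def leaves_def)
qed

lemma leaf_below_node:
  assumes "l \<in> leaves T" "r \<in> edge_set T" "upper T r = Some v"
  shows "(l, r) \<in> (child T)\<^sup>* \<longleftrightarrow> (\<exists>e\<in>incoming T v. (l, e) \<in> (child T)\<^sup>*)"
proof
  assume "(l, r) \<in> (child T)\<^sup>*"
  moreover have "l \<noteq> r" using assms by (auto simp: leaves_def)
  ultimately obtain e where "(l, e) \<in> (child T)\<^sup>*" "(e, r) \<in> child T" by (meson rtranclE)
  then show "\<exists>e\<in>incoming T v. (l, e) \<in> (child T)\<^sup>*" using child_iff_incoming[OF assms(2,3)] by blast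
next
  assume "\<exists>e\<in>incoming T v. (l, e) \<in> (child T)\<^sup>*"
  then show "(l, r) \<in> (child T)\<^sup>*"
    using child_iff_incoming[OF assms(2,3)] by (blast intro: rtrancl_into_rtrancl)
qed

text \<open>A leaf below an edge that carries a vertex is below one of the inputs of that vertex, so
  it can be followed through the whole cut. For other edges this fails: one that ends in a stump
  need not lie below any member of \<open>L\<close>.\<close>

lemma cut_covers: "is_cut T r L \<Longrightarrow> l \<in> leaves T \<Longrightarrow> (l, r) \<in> (child T)\<^sup>* \<Longrightarrow> \<exists>m\<in>L. (l, m) \<in> (child T)\<^sup>*"
proof (induction rule: is_cut.induct)
  case (cut_node r v L)
  from cut_node.prems(2) obtain e where e: "e \<in> incoming T v" "(l, e) \<in> (child T)\<^sup>*"
    using leaf_below_node[OF cut_node.prems(1) cut_node.hyps(1,2)] by blast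
  from cut_node.IH[OF e(1) cut_node.prems(1) e(2)] e(1) show ?case by blast
qed simp

lemma cut_leaf: "is_cut T r L \<Longrightarrow> r \<in> leaves T \<Longrightarrow> L = {r}"
  by (auto elim: is_cut.cases simp: leaves_def)

text \<open>The largest subtree with root \<open>e\<close>. It will be the image of the corolla
  grafted onto a leaf that is sent to \<open>e\<close>.\<close>

lemma cut_leaves:
  assumes "is_tree T" "e \<in> edge_set T"
  shows "is_cut T e {l \<in> leaves T. (l, e) \<in> (child T)\<^sup>*}"
  using tree_wf_child[OF assms(1)] assms(2)
proof (induction e rule: wf_induct_rule)
  case (less e)
  show ?case
  proof (cases "upper T e")
    case None
    then have "e \<in> leaves T" using less.prems by (simp add: leaves_def)
    then have "{l \<in> leaves T. (l, e) \<in> (child T)\<^sup>*} = {e}" using child_rtrancl_leaf by fast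
    with cut_stick[OF less.prems] show ?thesis by simp
  next
    case (Some v)
    have *: "d \<in> incoming T v \<longleftrightarrow> (d, e) \<in> child T" for d
      using child_iff_incoming[OF less.prems Some] by simp
    show ?thesis
    proof (rule cut_node'[OF less.prems Some])
      show "is_cut T d {l \<in> leaves T. (l, d) \<in> (child T)\<^sup>*}" if "d \<in> incoming T v" for d
        using less.IH[of d] that child_edges unfolding * by metis
      show "{l \<in> leaves T. (l, e) \<in> (child T)\<^sup>*} = (\<Union>d\<in>incoming T v. {l \<in> leaves T. (l, d) \<in> (child T)\<^sup>*})"
        using leaf_below_node[OF _ less.prems Some] by blast
    qed
  qed
qed

lemma cut_all_leaves:
  assumes "is_tree T"
  shows "is_cut T (root_edge T) (leaves T)"
proof -
  have "{l \<in> leaves T. (l, root_edge T) \<in> (child T)\<^sup>*} = leaves T"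
    using tree_reach_root[OF assms] by (auto simp: leaves_def)
  with cut_leaves[OF assms tree_root(1)[OF assms]] show ?thesis by simp
qed

text \<open>The subtree left over when everything strictly below \<open>d\<close> is pruned. It will
  be the image of the base corolla, with \<open>d\<close> the image of the root of the
  source.\<close>

lemma cut_complement:
  assumes "is_tree T" "d \<in> edge_set T"
  shows "is_cut T (root_edge T) (insert d {l \<in> leaves T. (l, d) \<notin> (child T)\<^sup>*})"
proof -
  \<comment> \<open>The statement is proved for every edge on the path from d to the root. At each
    step the input on the path carries d along, and every other input contributes all leaves below
    it.\<close>
  have "is_cut T e (insert d {l \<in> leaves T. (l, e) \<in> (child T)\<^sup>* \<and> (l, d) \<notin> (child T)\<^sup>*})"
    if "(d, e) \<in> (child T)\<^sup>*" for e
    using that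
  proof (induction rule: rtrancl_induct)
    case base
    have "insert d {l \<in> leaves T. (l, d) \<in> (child T)\<^sup>* \<and> (l, d) \<notin> (child T)\<^sup>*} = {d}" by auto
    with cut_stick[OF assms(2)] show ?case by simp
  next
    case (step e p)
    then obtain v where v: "p \<in> edge_set T" "upper T p = Some v" by (auto simp: child_def)
    have *: "c \<in> incoming T v \<longleftrightarrow> (c, p) \<in> child T" for c using child_iff_incoming[OF v] by simp
    let ?L = "\<lambda>c. if c = e then insert d {l \<in> leaves T. (l, e) \<in> (child T)\<^sup>* \<and> (l, d) \<notin> (child T)\<^sup>*}
      else {l \<in> leaves T. (l, c) \<in> (child T)\<^sup>*}"
    show ?case
    proof (rule cut_node'[OF v, where L = ?L])
      show "is_cut T c (?L c)" if "c \<in> incoming T v" for c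
        using step.IH cut_leaves[OF assms(1)] that by (auto simp: incoming_def)
      have e: "e \<in> incoming T v" using step.hyps(2) * by blast
      \<comment> \<open>Leaves below another input are never below d: since d is below e, two
        siblings would share a descendant.\<close>
      have far: "(l, d) \<notin> (child T)\<^sup>*" if "c \<in> incoming T v" "(l, c) \<in> (child T)\<^sup>*" "c \<noteq> e" for l c
        using siblings_disjoint[OF assms(1) _ step.hyps(2) that(2)] that step.hyps(1) *
        by (meson rtrancl_trans)
      show "insert d {l \<in> leaves T. (l, p) \<in> (child T)\<^sup>* \<and> (l, d) \<notin> (child T)\<^sup>*}
          = (\<Union>c\<in>incoming T v. ?L c)" (is "?lhs = ?rhs")
      proof
        show "?lhs \<subseteq> ?rhs"
        proof
          fix l assume l: "l \<in> ?lhs"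
          show "l \<in> ?rhs"
          proof (cases "l = d")
            case True
            with e show ?thesis by (intro UN_I[of e]) simp_all
          next
            case False
            with l obtain c where "c \<in> incoming T v" "(l, c) \<in> (child T)\<^sup>*"
              using leaf_below_node[OF _ v] by blast
            with l False show ?thesis by (intro UN_I[of c]) auto
          qed
        qed
        show "?rhs \<subseteq> ?lhs"
          using far leaf_below_node[OF _ v] e by (auto split: if_splits)
      qed
    qed
  qed
  from this[OF tree_reach_root[OF assms]] show ?thesis
    using tree_reach_root[OF assms(1)] by (auto simp: leaves_def elim!: back_subst[of "is_cut T (root_edge T)"])
qed

section \<open>Cuts and subtrees\<close>

lemma subtree_imp_cut:
  assumes "subtree S' S"
  shows "is_cut S (root_edge S') (leaves S')"
proof -
  have T: "is_tree S'" and E: "edge_set S' \<subseteq> edge_set S"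
    and inc: "\<And>v. v \<in> vertex_set S' \<Longrightarrow> incoming S v \<subseteq> edge_set S'"
    and io: "\<And>e v. \<lbrakk>e \<in> edge_set S'; v \<in> vertex_set S'\<rbrakk> \<Longrightarrow>
       (upper S' e = Some v \<longleftrightarrow> upper S e = Some v) \<and> (lower S' e = Some v \<longleftrightarrow> lower S e = Some v)"
    using assms by (auto simp: subtree_def)
  have "is_cut S r L" if "is_cut S' r L" for r L
    using that
  proof (induction)
    case (cut_stick r)
    then show ?case using E by (auto intro: is_cut.cut_stick)
  next
    case (cut_node r v L)
    have v: "v \<in> vertex_set S'" using tree_upper_vertex[OF T] cut_node.hyps by blast
    \<comment> \<open>A vertex of a subtree keeps all of its incoming edges, so each node of a
      derivation in S' is a node in S with the same branches.\<close>
    then have "incoming S' v = incoming S v"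
      using inc[OF v] io E by (auto simp: incoming_def)
    moreover have "upper S r = Some v" using io v cut_node.hyps by blast
    ultimately show ?case using cut_node E by (auto intro!: is_cut.cut_node)
  qed
  with cut_all_leaves[OF T] show ?thesis by blast
qed

definition restrict_tree :: "('e, 'v) tree \<Rightarrow> 'e set \<Rightarrow> 'v set \<Rightarrow> 'e \<Rightarrow> ('e, 'v) tree" where
  "restrict_tree T E V r = \<lparr>edge_set = E, vertex_set = V,
     upper = (\<lambda>e. case upper T e of Some v \<Rightarrow> if v \<in> V then Some v else None | None \<Rightarrow> None),
     lower = (\<lambda>e. case lower T e of Some v \<Rightarrow> if v \<in> V then Some v else None | None \<Rightarrow> None),
     root_edge = r\<rparr>"

lemma restrict_tree_simps [simp]:
  "edge_set (restrict_tree T E V r) = E"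
  "vertex_set (restrict_tree T E V r) = V"
  "root_edge (restrict_tree T E V r) = r"
  "upper (restrict_tree T E V r) e = Some v \<longleftrightarrow> upper T e = Some v \<and> v \<in> V"
  "lower (restrict_tree T E V r) e = Some v \<longleftrightarrow> lower T e = Some v \<and> v \<in> V"
  "upper (restrict_tree T E V r) e = None \<longleftrightarrow> (\<forall>v\<in>V. upper T e \<noteq> Some v)"
  "lower (restrict_tree T E V r) e = None \<longleftrightarrow> (\<forall>v\<in>V. lower T e \<noteq> Some v)"
  by (auto simp: restrict_tree_def split: option.splits)

text \<open>The edges of the subtree are those below \<open>r\<close> but not strictly below \<open>L\<close>.\<close>

lemma cut_imp_subtree:
  assumes S: "is_tree S" and c: "is_cut S r L"
  obtains S' where "subtree S' S" "root_edge S' = r" "leaves S' = L"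
proof -
  let ?c = "child S"
  define E where "E = {e. (e, r) \<in> ?c\<^sup>* \<and> (\<forall>l\<in>L. (e, l) \<in> ?c\<^sup>* \<longrightarrow> e = l)}"
  define V where "V = {v. \<exists>e\<in>E - L. upper S e = Some v}"
  define S' where "S' = restrict_tree S E V r"
  have ES: "E \<subseteq> edge_set S" using child_rtrancl_edges cut_root_edge[OF c] by (auto simp: E_def)
  have LE: "L \<subseteq> E" using cut_below[OF c] cut_antichain[OF S c] by (auto simp: E_def)
  have rE: "r \<in> E" using cut_below[OF c] tree_antisym[OF S] by (auto simp: E_def)
  have VS: "V \<subseteq> vertex_set S" using tree_upper_vertex[OF S] ES by (auto simp: V_def)
  have up: "upper S e \<notin> Some ` V" if "e \<in> L" for e
    using tree_upper_inj[OF S] that LE ES unfolding V_def by blast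
  \<comment> \<open>A leaf of S that belongs to E is below some member of L and hence equal to it;
    every other edge of E therefore ends in a vertex.\<close>
  have up': "upper S e \<in> Some ` V" if "e \<in> E" "e \<notin> L" for e
  proof (cases "upper S e")
    case None
    then have "e \<in> leaves S" using that ES by (auto simp: leaves_def)
    from cut_covers[OF c this] that show ?thesis by (auto simp: E_def)
  qed (use that in \<open>auto simp: V_def\<close>)
  have lo: "lower S r \<noteq> Some v" if "v \<in> V" for v
  proof
    assume "lower S r = Some v"
    from that obtain e where e: "e \<in> E" "upper S e = Some v" by (auto simp: V_def)
    with \<open>lower S r = Some v\<close> have "(r, e) \<in> ?c" using rE ES by (auto simp: child_def)
    moreover have "(e, r) \<in> ?c\<^sup>*" using e by (auto simp: E_def)
    ultimately have "(r, r) \<in> ?c\<^sup>+" by (rule rtrancl_into_trancl2)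
    with acyclic_child[OF S] show False by (auto simp: acyclic_def)
  qed
  \<comment> \<open>If the parent p were at or below a member l of L, then so would be e. Membership
    of e in E then gives e = l, and p would be both above and below e.\<close>
  have par: "\<exists>p. p \<in> E \<and> p \<notin> L \<and> (e, p) \<in> ?c \<and> (p, r) \<in> ?c\<^sup>*" if "e \<in> E" "e \<noteq> r" for e
  proof -
    from that obtain p where p: "(e, p) \<in> ?c" "(p, r) \<in> ?c\<^sup>*" by (auto simp: E_def elim: converse_rtranclE)
    have ne: "(p, l) \<notin> ?c\<^sup>*" if "l \<in> L" for l
    proof
      assume "(p, l) \<in> ?c\<^sup>*"
      then have *: "(e, l) \<in> ?c\<^sup>*" using p by auto
      with \<open>e \<in> E\<close> that have "e = l" by (auto simp: E_def)
      with p \<open>(p, l) \<in> ?c\<^sup>*\<close> have "(e, e) \<in> ?c\<^sup>+" by auto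
      with acyclic_child[OF S] show False by (auto simp: acyclic_def)
    qed
    then have "p \<in> E" "p \<notin> L" using p by (auto simp: E_def)
    with p show ?thesis by blast
  qed
  have par': "\<exists>v\<in>V. lower S e = Some v" if "e \<in> E" "e \<noteq> r" for e
    using par[OF that] unfolding V_def child_def by blast
  have ci: "incoming S v \<subseteq> E" if "v \<in> V" for v
  proof
    fix d assume d: "d \<in> incoming S v"
    from that obtain e where e: "e \<in> E" "e \<notin> L" "upper S e = Some v" by (auto simp: V_def)
    then have de: "(d, e) \<in> ?c" using d ES child_iff_incoming by fastforce
    then have "(d, r) \<in> ?c\<^sup>*" using e by (auto simp: E_def)
    moreover have "d = l" if "l \<in> L" "(d, l) \<in> ?c\<^sup>*" for l
      using child_rtrancl_strict[OF S that(2) _ de] e that by (auto simp: E_def)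
    ultimately show "d \<in> E" by (auto simp: E_def)
  qed
  have step: "(e, p) \<in> child S'" if "e \<in> E" "p \<in> E" "p \<notin> L" "(e, p) \<in> ?c" for e p
    using that by (auto simp: S'_def child_def V_def)
  have reach: "(e, r) \<in> (child S')\<^sup>*" if "e \<in> E" for e
  proof -
    have "(e, r) \<in> ?c\<^sup>*" using that by (auto simp: E_def)
    then show ?thesis using that
    proof (induction rule: converse_rtrancl_induct)
      case (step e p)
      show ?case
      proof (cases "e = r")
        case False
        from par[OF step.prems False] obtain q where q: "q \<in> E" "q \<notin> L" "(e, q) \<in> ?c" by blast
        then have "q = p" using step.hyps(1) tree_single_valued_child[OF S] by (metis single_valuedD)
        with q step.IH \<open>\<And>p e. \<lbrakk>e \<in> E; p \<in> E; p \<notin> L; (e, p) \<in> ?c\<rbrakk> \<Longrightarrow> (e, p) \<in> child S'\<close> step.prems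
        show ?thesis by (meson converse_rtrancl_into_rtrancl)
      qed simp
    qed simp
  qed
  have "is_tree S'"
  proof (rule is_treeI)
    show "finite (edge_set S')" "finite (vertex_set S')"
      using is_treeD[OF S] ES VS by (auto simp: S'_def intro: finite_subset)
    show "ends S' e \<subseteq> vertex_set S'" for e by (auto simp: S'_def ends_def)
    show "\<exists>!e. e \<in> outgoing S' v" if "v \<in> vertex_set S'" for v
      using that tree_upper_inj[OF S] ES unfolding S'_def V_def outgoing_def by auto
    show "{e \<in> edge_set S'. lower S' e = None} = {root_edge S'}"
      using rE lo par' by (fastforce simp: S'_def)
    show "(e, root_edge S') \<in> (child S')\<^sup>*" if "e \<in> edge_set S'" for e
      using reach that by (auto simp: S'_def)
  qed
  then have "subtree S' S"
    using ES VS ci by (auto simp: subtree_def S'_def)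
  moreover have "leaves S' = L" using up up' LE by (fastforce simp: leaves_def S'_def)
  ultimately show ?thesis using that by (auto simp: S'_def)
qed

section \<open>The dendroidal category and trees with group action\<close>

lemma dendroidal_simps [simp]:
  "Obj dendroidal = {T. is_tree T}"
  "Idt dendroidal T = (\<lambda>e\<in>edge_set T. e)"
  "Cmp dendroidal T S R g f = compose (edge_set T) g f"
  by (simp_all add: dendroidal_def)

lemma incoming_subset: "incoming T v \<subseteq> edge_set T"
  by (auto simp: incoming_def)

text \<open>Vertices are traded for their unique outgoing edges, and the subtree required by the
  definition for the cut that it determines. Morphisms are then accessible to induction on
  cuts.\<close>

lemma dendroidal_Arr_iff:
  assumes T: "is_tree T" and S: "is_tree S"
  shows "f \<in> Arr dendroidal T S \<longleftrightarrow> f \<in> edge_set T \<rightarrow>\<^sub>E edge_set S \<and>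
    (\<forall>e\<in>edge_set T. \<forall>v. upper T e = Some v \<longrightarrow>
       inj_on f (incoming T v) \<and> is_cut S (f e) (f ` incoming T v))"
proof -
  have *: "(\<exists>S'. subtree S' S \<and> root_edge S' = r \<and> leaves S' = L) \<longleftrightarrow> is_cut S r L" for r L
    using subtree_imp_cut cut_imp_subtree[OF S] by metis
  have "f \<in> Arr dendroidal T S \<longleftrightarrow> f \<in> edge_set T \<rightarrow>\<^sub>E edge_set S \<and>
    (\<forall>v\<in>vertex_set T. inj_on f (incoming T v) \<and> is_cut S (f (out_edge T v)) (f ` incoming T v))"
    by (simp add: dendroidal_def *)
  moreover have "(\<forall>v\<in>vertex_set T. P v (out_edge T v)) \<longleftrightarrow>
    (\<forall>e\<in>edge_set T. \<forall>v. upper T e = Some v \<longrightarrow> P v e)" for P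
    using tree_out_edge[OF T] out_edge_eq[OF T] tree_upper_vertex[OF T] by metis
  from this[of "\<lambda>v e. inj_on f (incoming T v) \<and> is_cut S (f e) (f ` incoming T v)"]
  have "(\<forall>v\<in>vertex_set T. inj_on f (incoming T v) \<and> is_cut S (f (out_edge T v)) (f ` incoming T v)) \<longleftrightarrow>
    (\<forall>e\<in>edge_set T. \<forall>v. upper T e = Some v \<longrightarrow> inj_on f (incoming T v) \<and> is_cut S (f e) (f ` incoming T v))" .
  ultimately show ?thesis by simp
qed

lemma dendroidal_ArrI:
  assumes "is_tree T" "is_tree S" "f \<in> edge_set T \<rightarrow>\<^sub>E edge_set S"
    and "\<And>e v. \<lbrakk>e \<in> edge_set T; upper T e = Some v\<rbrakk> \<Longrightarrow> inj_on f (incoming T v)"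
    and "\<And>e v. \<lbrakk>e \<in> edge_set T; upper T e = Some v\<rbrakk> \<Longrightarrow> is_cut S (f e) (f ` incoming T v)"
  shows "f \<in> Arr dendroidal T S"
  using assms by (simp add: dendroidal_Arr_iff)

lemma dendroidal_Arr_PiE: "f \<in> Arr dendroidal T S \<Longrightarrow> f \<in> edge_set T \<rightarrow>\<^sub>E edge_set S"
  by (simp add: dendroidal_def)

lemma dendroidal_Arr_edge: "f \<in> Arr dendroidal T S \<Longrightarrow> e \<in> edge_set T \<Longrightarrow> f e \<in> edge_set S"
  using dendroidal_Arr_PiE by (metis PiE_mem)

context
  fixes T S f
  assumes T: "is_tree T" and S: "is_tree S" and f: "f \<in> Arr dendroidal T S"
begin

lemma arr_corolla:
  assumes "e \<in> edge_set T" "upper T e = Some v"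
  shows "is_cut S (f e) (f ` incoming T v)" "inj_on f (incoming T v)"
  using f assms by (auto simp: dendroidal_Arr_iff[OF T S])

lemma arr_mono:
  assumes "(x, y) \<in> (child T)\<^sup>*"
  shows "(f x, f y) \<in> (child S)\<^sup>*"
  using assms
proof (induction rule: rtrancl_induct)
  case (step y z)
  then obtain v where v: "z \<in> edge_set T" "upper T z = Some v" by (auto simp: child_def)
  then have "y \<in> incoming T v" using step.hyps(2) child_iff_incoming by metis
  then have "(f y, f z) \<in> (child S)\<^sup>*" using cut_below[OF arr_corolla(1)[OF v]] by blast
  with step.IH show ?case by (rule rtrancl_trans)
qed simp

text \<open>Distinct incoming edges of a vertex go to incomparable edges, so the parts of a cut below
  them keep disjoint images.\<close>

lemma arr_cut:
  assumes "is_cut T r L"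
  shows "is_cut S (f r) (f ` L) \<and> inj_on f L"
  using assms
proof induction
  case (cut_stick r)
  then show ?case using f by (auto intro: is_cut.cut_stick dendroidal_Arr_edge)
next
  case (cut_node r v L)
  note c = arr_corolla[OF cut_node.hyps(1,2)]
  have "is_cut S x (f ` L (the_inv_into (incoming T v) f x))" if "x \<in> f ` incoming T v" for x
    using that cut_node.IH by (auto simp: the_inv_into_f_f[OF c(2)])
  from cut_subst[OF c(1) this] have "is_cut S (f r)
    (\<Union>e\<in>incoming T v. f ` L (the_inv_into (incoming T v) f (f e)))" by simp
  also have "(\<Union>e\<in>incoming T v. f ` L (the_inv_into (incoming T v) f (f e))) = f ` (\<Union>e\<in>incoming T v. L e)"
    by (auto simp: the_inv_into_f_f[OF c(2)])
  finally have 1: "is_cut S (f r) (f ` (\<Union>e\<in>incoming T v. L e))" .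
  have "inj_on f (\<Union>e\<in>incoming T v. L e)"
  proof (rule inj_onI)
    fix x y assume "x \<in> (\<Union>e\<in>incoming T v. L e)" "y \<in> (\<Union>e\<in>incoming T v. L e)" and eq: "f x = f y"
    then obtain d e where d: "d \<in> incoming T v" "x \<in> L d" and e: "e \<in> incoming T v" "y \<in> L e" by blast
    have "(f x, f d) \<in> (child S)\<^sup>*" "(f x, f e) \<in> (child S)\<^sup>*"
      using arr_mono cut_below cut_node.hyps d e eq by metis+
    then have "(f d, f e) \<in> (child S)\<^sup>* \<or> (f e, f d) \<in> (child S)\<^sup>*"
      using tree_comparable[OF S] by blast
    then have "f d = f e" using cut_antichain[OF S c(1)] d e by (metis imageI)
    then have "d = e" using c(2) d e by (auto dest: inj_onD)
    then show "x = y" using cut_node.IH[OF d(1)] d e eq by (auto dest: inj_onD)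
  qed
  with 1 show ?case by blast
qed

end

text \<open>The substance is closure under composition. The first morphism turns a corolla into an
  arbitrary cut, so the second must send cuts to cuts and be injective on them, which is
  \<open>arr_cut\<close>.\<close>

lemma dendroidal_category: "category dendroidal"
proof
  fix T :: "('e, 'v) tree" assume T: "T \<in> Obj dendroidal"
  have im: "(\<lambda>e\<in>edge_set T. e) ` incoming T v = incoming T v" for v
    using incoming_subset by force
  have inj: "inj_on (\<lambda>e\<in>edge_set T. e) (incoming T v)" for v
    by (rule inj_onI) (simp add: incoming_def)
  show "Idt dendroidal T \<in> Arr dendroidal T T"
    unfolding dendroidal_simps
  proof (rule dendroidal_ArrI)
    show "is_cut T ((\<lambda>e\<in>edge_set T. e) e) ((\<lambda>e\<in>edge_set T. e) ` incoming T v)"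
      if "e \<in> edge_set T" "upper T e = Some v" for e v
      using cut_corolla[OF that] that(1) unfolding im by simp
  qed (use T inj in auto)
next
  fix a b c :: "('e, 'v) tree" and f g
  assume t: "a \<in> Obj dendroidal" "b \<in> Obj dendroidal" "c \<in> Obj dendroidal"
    and f: "f \<in> Arr dendroidal a b" and g: "g \<in> Arr dendroidal b c"
  have im: "compose (edge_set a) g f ` incoming a v = g ` f ` incoming a v" for v
    using incoming_subset[of a v] by (force simp: compose_def)
  have inj: "inj_on (compose (edge_set a) g f) (incoming a v)"
    if "inj_on f (incoming a v)" "inj_on g (f ` incoming a v)" for v
    using comp_inj_on[OF that] incoming_subset[of a v]
    by (subst inj_on_cong[where g = "g \<circ> f"]) (auto simp: compose_def)
  show "Cmp dendroidal a b c g f \<in> Arr dendroidal a c"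
    unfolding dendroidal_simps
  proof (rule dendroidal_ArrI)
    show "compose (edge_set a) g f \<in> edge_set a \<rightarrow>\<^sub>E edge_set c"
      using f g by (auto simp: compose_def dest: dendroidal_Arr_edge)
    fix e v assume e: "e \<in> edge_set a" "upper a e = Some v"
    have "is_cut b (f e) (f ` incoming a v)" "inj_on f (incoming a v)"
      using arr_corolla[OF _ _ f e] t by auto
    moreover from this(1) have "is_cut c (g (f e)) (g ` f ` incoming a v)" "inj_on g (f ` incoming a v)"
      using arr_cut[OF _ _ g] t by auto
    ultimately show "inj_on (compose (edge_set a) g f) (incoming a v)"
      "is_cut c (compose (edge_set a) g f e) (compose (edge_set a) g f ` incoming a v)"
      using inj e im by (auto simp: compose_eq)
  qed (use t in auto)
next
  fix a b :: "('e, 'v) tree" and f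
  assume f: "f \<in> Arr dendroidal a b"
  then have f': "f \<in> edge_set a \<rightarrow> edge_set b" "f \<in> extensional (edge_set a)"
    using dendroidal_Arr_PiE by (auto simp: PiE_def)
  show "Cmp dendroidal a b b (Idt dendroidal b) f = f" using f' by (simp add: Id_compose)
  show "Cmp dendroidal a a b f (Idt dendroidal a) = f" using f' by (simp add: compose_Id)
next
  fix a b c d :: "('e, 'v) tree" and f g h
  assume "f \<in> Arr dendroidal a b"
  then have "f \<in> edge_set a \<rightarrow> edge_set b" using dendroidal_Arr_PiE by (auto simp: PiE_def)
  then show "Cmp dendroidal a c d h (Cmp dendroidal a b c g f) = Cmp dendroidal a b d (Cmp dendroidal b c d h g) f"
    by (simp add: compose_assoc)
qed

text \<open>The only cut at a leaf is the leaf itself. A vertex on the upper end of \<open>e\<close>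
  would thus have an input with the same image as \<open>e\<close>; by injectivity this input is
  \<open>e\<close>, which would be its own child.\<close>

lemma arr_leaf_reflect:
  assumes T: "is_tree T" and S: "is_tree S" and f: "f \<in> Arr dendroidal T S"
    and "inj_on f (edge_set T)" "e \<in> edge_set T" "f e \<in> leaves S"
  shows "e \<in> leaves T"
proof (rule ccontr)
  assume "e \<notin> leaves T"
  then obtain v where v: "upper T e = Some v" using assms(5) by (auto simp: leaves_def)
  then have "f ` incoming T v = {f e}" using cut_leaf[OF arr_corolla(1)[OF T S f]] assms by blast
  then have "e \<in> incoming T v" using assms(4,5) incoming_subset[of T v] by (fastforce dest: inj_onD)
  then have "(e, e) \<in> child T" using child_iff_incoming[OF assms(5) v] by blast
  with acyclic_child[OF T] show False by (auto simp: acyclic_def)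
qed

context
  fixes T S f g
  assumes T: "is_tree T" and S: "is_tree S" and f: "f \<in> Arr dendroidal T S" and g: "g \<in> Arr dendroidal S T"
    and gf: "\<And>e. e \<in> edge_set T \<Longrightarrow> g (f e) = e" and fg: "\<And>e. e \<in> edge_set S \<Longrightarrow> f (g e) = e"
begin

text \<open>The root is the largest edge and morphisms are monotone, so the image of one root and
  the other root bound each other, once through \<open>f\<close> and once through
  \<open>g\<close>.\<close>

lemma iso_root: "f (root_edge T) = root_edge S"
proof (rule tree_antisym[OF S])
  show "(f (root_edge T), root_edge S) \<in> (child S)\<^sup>*"
    by (intro tree_reach_root S dendroidal_Arr_edge[OF f] tree_root T)
  have "(g (root_edge S), root_edge T) \<in> (child T)\<^sup>*"
    by (intro tree_reach_root T dendroidal_Arr_edge[OF g] tree_root S)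
  from arr_mono[OF T S f this] show "(root_edge S, f (root_edge T)) \<in> (child S)\<^sup>*"
    by (simp add: fg tree_root S)
qed

text \<open>Reflection of leaves, applied to the inverse.\<close>

lemma iso_leaves:
  assumes "e \<in> leaves T"
  shows "f e \<in> leaves S"
proof (rule arr_leaf_reflect[OF S T g])
  show "inj_on g (edge_set S)" using fg by (rule inj_on_inverseI)
  show "f e \<in> edge_set S" using assms dendroidal_Arr_edge[OF f] by (simp add: leaves_def)
  show "g (f e) \<in> leaves T" using assms gf by (simp add: leaves_def)
qed

end

section \<open>Trees with group action\<close>

context group
begin

lemma delooping_category: "category (delooping G)"
  by unfold_locales (auto simp: delooping_def m_assoc)

lemma gtree_Obj_iff:
  "X \<in> Obj (gtree_category G) \<longleftrightarrow> is_tree (the_tree X) \<and>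
    (\<forall>g\<in>carrier G. act X g \<in> Arr dendroidal (the_tree X) (the_tree X)) \<and>
    act X \<one> = (\<lambda>e\<in>edge_set (the_tree X). e) \<and>
    (\<forall>g\<in>carrier G. \<forall>h\<in>carrier G. act X (g \<otimes> h) = compose (edge_set (the_tree X)) (act X g) (act X h))"
  unfolding gtree_category_def functor_category_def is_functor_def is_functor_axioms_def
  using delooping_category dendroidal_category by (auto simp: delooping_def)

lemma gtree_Arr_iff:
  fixes X :: "('a, 'l::infinite) gtree"
  shows
  "f \<in> Arr (gtree_category G) X Y \<longleftrightarrow> X \<in> Obj (gtree_category G) \<and> Y \<in> Obj (gtree_category G) \<and>
    f () \<in> Arr dendroidal (the_tree X) (the_tree Y) \<and>
    (\<forall>g\<in>carrier G. \<forall>e\<in>edge_set (the_tree X). f () (act X g e) = act Y g (f () e))"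
proof -
  have "compose A p q = compose A r s \<longleftrightarrow> (\<forall>e\<in>A. p (q e) = r (s e))"
    for A and p q r s :: "'l cell \<Rightarrow> 'l cell"
    by (auto simp: compose_def fun_eq_iff restrict_def)
  then show ?thesis
    by (auto simp: gtree_category_def functor_category_def nat_trans_def delooping_def extensional_def)
qed

lemma gtree_Idt: "Idt (gtree_category G) X = (\<lambda>_. \<lambda>e\<in>edge_set (the_tree X). e)"
  by (simp add: gtree_category_def functor_category_def delooping_def fun_eq_iff)

lemma gtree_Cmp: "Cmp (gtree_category G) X Y Z g f = (\<lambda>_. compose (edge_set (the_tree X)) (g ()) (f ()))"
  by (simp add: gtree_category_def functor_category_def delooping_def fun_eq_iff)

lemma gtree_is_tree: "X \<in> Obj (gtree_category G) \<Longrightarrow> is_tree (the_tree X)"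
  by (simp add: gtree_Obj_iff)

lemma act_arr: "\<lbrakk>X \<in> Obj (gtree_category G); g \<in> carrier G\<rbrakk> \<Longrightarrow> act X g \<in> Arr dendroidal (the_tree X) (the_tree X)"
  by (simp add: gtree_Obj_iff)

lemma act_edge: "\<lbrakk>X \<in> Obj (gtree_category G); g \<in> carrier G; e \<in> edge_set (the_tree X)\<rbrakk>
    \<Longrightarrow> act X g e \<in> edge_set (the_tree X)"
  by (rule dendroidal_Arr_edge[OF act_arr])

lemma act_mult: "\<lbrakk>X \<in> Obj (gtree_category G); g \<in> carrier G; h \<in> carrier G; e \<in> edge_set (the_tree X)\<rbrakk>
    \<Longrightarrow> act X (g \<otimes> h) e = act X g (act X h e)"
  by (simp add: gtree_Obj_iff compose_eq)

lemma act_one: "\<lbrakk>X \<in> Obj (gtree_category G); e \<in> edge_set (the_tree X)\<rbrakk> \<Longrightarrow> act X \<one> e = e"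
  by (simp add: gtree_Obj_iff)

lemma act_inv:
  assumes "X \<in> Obj (gtree_category G)" "g \<in> carrier G" "e \<in> edge_set (the_tree X)"
  shows "act X (inv g) (act X g e) = e" "act X g (act X (inv g) e) = e"
  using act_mult[OF assms(1), of "inv g" g e] act_mult[OF assms(1), of g "inv g" e] assms
  by (simp_all add: act_one)

lemma act_root:
  assumes "X \<in> Obj (gtree_category G)" "g \<in> carrier G"
  shows "act X g (root_edge (the_tree X)) = root_edge (the_tree X)"
  using gtree_is_tree[OF assms(1)] gtree_is_tree[OF assms(1)] act_arr[OF assms]
    act_arr[OF assms(1) inv_closed[OF assms(2)]] act_inv[OF assms]
  by (rule iso_root)

lemma act_leaf:
  assumes "X \<in> Obj (gtree_category G)" "g \<in> carrier G" "e \<in> leaves (the_tree X)"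
  shows "act X g e \<in> leaves (the_tree X)"
  using gtree_is_tree[OF assms(1)] gtree_is_tree[OF assms(1)] act_arr[OF assms(1,2)]
    act_arr[OF assms(1) inv_closed[OF assms(2)]] act_inv[OF assms(1,2)] assms(3)
  by (rule iso_leaves)

lemma gtree_ArrD:
  assumes "f \<in> Arr (gtree_category G) X Y"
  shows "f () \<in> Arr dendroidal (the_tree X) (the_tree Y)"
    "\<And>e. e \<in> edge_set (the_tree X) \<Longrightarrow> f () e \<in> edge_set (the_tree Y)"
    "\<And>g e. \<lbrakk>g \<in> carrier G; e \<in> edge_set (the_tree X)\<rbrakk> \<Longrightarrow> f () (act X g e) = act Y g (f () e)"
    "f () \<in> extensional (edge_set (the_tree X))"
proof -
  show f: "f () \<in> Arr dendroidal (the_tree X) (the_tree Y)" using assms by (simp add: gtree_Arr_iff)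
  show "f () e \<in> edge_set (the_tree Y)" if "e \<in> edge_set (the_tree X)" for e
    by (rule dendroidal_Arr_edge[OF f that])
  show "f () (act X g e) = act Y g (f () e)" if "g \<in> carrier G" "e \<in> edge_set (the_tree X)" for g e
    using assms that by (simp add: gtree_Arr_iff)
  show "f () \<in> extensional (edge_set (the_tree X))"
    using dendroidal_Arr_PiE[OF f] by (simp add: PiE_def)
qed

lemma gtree_arr_eqI:
  assumes "f \<in> Arr (gtree_category G) X Y" "h \<in> Arr (gtree_category G) X Y"
    and "\<And>e. e \<in> edge_set (the_tree X) \<Longrightarrow> f () e = h () e"
  shows "f = h"
proof
  fix u :: unit
  show "f u = h u"
    using extensionalityI[OF gtree_ArrD(4)[OF assms(1)] gtree_ArrD(4)[OF assms(2)]] assms(3) by simp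
qed

lemma gtree_category: "category (gtree_category G :: (('a, 'l::infinite) gtree, 'l gtree_arr) cat)"
proof -
  interpret D: category "dendroidal :: ('l dtree, _) cat" by (rule dendroidal_category)
  show ?thesis
  proof
    fix X :: "('a, 'l) gtree" assume X: "X \<in> Obj (gtree_category G)"
    then show "Idt (gtree_category G) X \<in> Arr (gtree_category G) X X"
      using D.Idt_closed[of "the_tree X"] by (auto simp: gtree_Arr_iff gtree_Idt gtree_is_tree act_edge)
  next
    fix X Y Z :: "('a, 'l) gtree" and f h
    assume o: "X \<in> Obj (gtree_category G)" "Y \<in> Obj (gtree_category G)" "Z \<in> Obj (gtree_category G)"
      and f: "f \<in> Arr (gtree_category G) X Y" and h: "h \<in> Arr (gtree_category G) Y Z"
    show "Cmp (gtree_category G) X Y Z h f \<in> Arr (gtree_category G) X Z"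
      unfolding gtree_Arr_iff gtree_Cmp
      using D.Cmp_closed[of "the_tree X" "the_tree Y" "the_tree Z" "f ()" "h ()"] o gtree_ArrD[OF f] gtree_ArrD[OF h]
      by (auto simp: gtree_is_tree compose_eq act_edge)
  next
    fix X Y :: "('a, 'l) gtree" and f
    assume o: "X \<in> Obj (gtree_category G)" "Y \<in> Obj (gtree_category G)" and f: "f \<in> Arr (gtree_category G) X Y"
    show "Cmp (gtree_category G) X Y Y (Idt (gtree_category G) Y) f = f"
      "Cmp (gtree_category G) X X Y f (Idt (gtree_category G) X) = f"
      using D.Idt_left[of "the_tree X" "the_tree Y" "f ()"] D.Idt_right[of "the_tree X" "the_tree Y" "f ()"]
        o gtree_ArrD(1)[OF f] by (simp_all add: gtree_is_tree gtree_Cmp gtree_Idt fun_eq_iff)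
  next
    fix X Y Z W :: "('a, 'l) gtree" and f h k
    assume o: "X \<in> Obj (gtree_category G)" "Y \<in> Obj (gtree_category G)" "Z \<in> Obj (gtree_category G)"
        "W \<in> Obj (gtree_category G)"
      and f: "f \<in> Arr (gtree_category G) X Y" and h: "h \<in> Arr (gtree_category G) Y Z"
      and k: "k \<in> Arr (gtree_category G) Z W"
    show "Cmp (gtree_category G) X Z W k (Cmp (gtree_category G) X Y Z h f)
        = Cmp (gtree_category G) X Y W (Cmp (gtree_category G) Y Z W k h) f"
      using D.Cmp_assoc[of "the_tree X" "the_tree Y" "the_tree Z" "the_tree W" "f ()" "h ()" "k ()"]
        o gtree_ArrD(1)[OF f] gtree_ArrD(1)[OF h] gtree_ArrD(1)[OF k]
      by (simp add: gtree_is_tree gtree_Cmp)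
  qed
qed

section \<open>Trees with labelled leaves\<close>

lemma ltree_Obj_iff:
  "(X, \<chi>) \<in> Obj (ltree_category G (A, \<rho>)) \<longleftrightarrow> X \<in> Obj (gtree_category G) \<and>
     \<chi> \<in> extensional A \<and> bij_betw \<chi> A (leaves (the_tree X)) \<and>
     (\<forall>g\<in>carrier G. \<forall>a\<in>A. \<chi> (\<rho> g a) = act X g (\<chi> a))"
  by (simp add: ltree_category_def)

lemma ltree_Arr_iff:
  "f \<in> Arr (ltree_category G (A, \<rho>)) (X, \<chi>) (Y, \<xi>) \<longleftrightarrow> f \<in> Arr (gtree_category G) X Y \<and>
     f () ` leaves (the_tree X) \<subseteq> leaves (the_tree Y) \<and>
     f () (root_edge (the_tree X)) = root_edge (the_tree Y) \<and> (\<forall>a\<in>A. f () (\<chi> a) = \<xi> a)"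
  by (simp add: ltree_category_def)

lemma ltree_Idt: "Idt (ltree_category G A) X = Idt (gtree_category G) (fst X)"
  by (cases A; cases X) (simp add: ltree_category_def)

lemma ltree_Cmp: "Cmp (ltree_category G A) X Y Z g f = Cmp (gtree_category G) (fst X) (fst Y) (fst Z) g f"
  by (cases A; cases X; cases Y; cases Z) (simp add: ltree_category_def)

lemma ltree_label:
  assumes "(X, \<chi>) \<in> Obj (ltree_category G (A, \<rho>))" "a \<in> A"
  shows "\<chi> a \<in> leaves (the_tree X)" "\<chi> a \<in> edge_set (the_tree X)"
  using assms by (auto simp: ltree_Obj_iff bij_betw_def leaves_def)

text \<open>The leaves of the source are exactly the labelled edges, so compatibility with the
  labels already sends leaves to leaves.\<close>

lemma ltree_ArrI:
  assumes "(X, \<chi>) \<in> Obj (ltree_category G (A, \<rho>))" "(Y, \<xi>) \<in> Obj (ltree_category G (A, \<rho>))"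
    and "f \<in> Arr (gtree_category G) X Y" "f () (root_edge (the_tree X)) = root_edge (the_tree Y)"
    and "\<And>a. a \<in> A \<Longrightarrow> f () (\<chi> a) = \<xi> a"
  shows "f \<in> Arr (ltree_category G (A, \<rho>)) (X, \<chi>) (Y, \<xi>)"
  unfolding ltree_Arr_iff
proof (intro conjI assms ballI)
  have "leaves (the_tree X) = \<chi> ` A" using assms(1) by (simp add: ltree_Obj_iff bij_betw_def)
  then show "f () ` leaves (the_tree X) \<subseteq> leaves (the_tree Y)" using assms(5) ltree_label(1)[OF assms(2)] by auto
qed

lemma ltree_category: "category (ltree_category G (A, \<rho>) :: (('a, 'l::infinite) ltree, 'l gtree_arr) cat)"
proof -
  interpret C: category "gtree_category G :: (('a, 'l) gtree, 'l gtree_arr) cat" by (rule gtree_category)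
  show ?thesis
  proof
    fix x :: "('a, 'l) ltree" assume x: "x \<in> Obj (ltree_category G (A, \<rho>))"
    obtain X \<chi> where [simp]: "x = (X, \<chi>)" by (cases x)
    show "Idt (ltree_category G (A, \<rho>)) x \<in> Arr (ltree_category G (A, \<rho>)) x x"
      using x C.Idt_closed[of X] ltree_label(2)[of X \<chi> A \<rho>] tree_root(1)[OF gtree_is_tree, of X]
      by (auto simp: ltree_Idt ltree_Obj_iff gtree_Idt intro!: ltree_ArrI)
  next
    fix x y z :: "('a, 'l) ltree" and f h
    assume o: "x \<in> Obj (ltree_category G (A, \<rho>))" "y \<in> Obj (ltree_category G (A, \<rho>))" "z \<in> Obj (ltree_category G (A, \<rho>))"
      and f: "f \<in> Arr (ltree_category G (A, \<rho>)) x y" and h: "h \<in> Arr (ltree_category G (A, \<rho>)) y z"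
    obtain X \<chi> Y \<xi> Z \<zeta> where [simp]: "x = (X, \<chi>)" "y = (Y, \<xi>)" "z = (Z, \<zeta>)" by (cases x; cases y; cases z)
    show "Cmp (ltree_category G (A, \<rho>)) x y z h f \<in> Arr (ltree_category G (A, \<rho>)) x z"
      unfolding ltree_Cmp \<open>x = _\<close> \<open>y = _\<close> \<open>z = _\<close> fst_conv
    proof (rule ltree_ArrI)
      show "Cmp (gtree_category G) X Y Z h f \<in> Arr (gtree_category G) X Z"
        using o f h by (intro C.Cmp_closed[of X Y Z]) (auto simp: ltree_Obj_iff ltree_Arr_iff)
    qed (use o f h ltree_label(2)[of X \<chi> A \<rho>] tree_root(1)[OF gtree_is_tree, of X]
        in \<open>auto simp: ltree_Arr_iff gtree_Cmp compose_eq ltree_Obj_iff\<close>)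
  next
    fix x y :: "('a, 'l) ltree" and f
    assume o: "x \<in> Obj (ltree_category G (A, \<rho>))" "y \<in> Obj (ltree_category G (A, \<rho>))"
      and f: "f \<in> Arr (ltree_category G (A, \<rho>)) x y"
    then show "Cmp (ltree_category G (A, \<rho>)) x y y (Idt (ltree_category G (A, \<rho>)) y) f = f"
      "Cmp (ltree_category G (A, \<rho>)) x x y f (Idt (ltree_category G (A, \<rho>)) x) = f"
      using C.Idt_left[of "fst x" "fst y" f] C.Idt_right[of "fst x" "fst y" f]
      by (cases x; cases y; simp add: ltree_Obj_iff ltree_Arr_iff ltree_Cmp ltree_Idt)+
  next
    fix x y z w :: "('a, 'l) ltree" and f h k
    assume "x \<in> Obj (ltree_category G (A, \<rho>))" "y \<in> Obj (ltree_category G (A, \<rho>))" "z \<in> Obj (ltree_category G (A, \<rho>))"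
        "w \<in> Obj (ltree_category G (A, \<rho>))"
      and "f \<in> Arr (ltree_category G (A, \<rho>)) x y" "h \<in> Arr (ltree_category G (A, \<rho>)) y z"
      "k \<in> Arr (ltree_category G (A, \<rho>)) z w"
    then show "Cmp (ltree_category G (A, \<rho>)) x z w k (Cmp (ltree_category G (A, \<rho>)) x y z h f)
        = Cmp (ltree_category G (A, \<rho>)) x y w (Cmp (ltree_category G (A, \<rho>)) y z w k h) f"
      using C.Cmp_assoc[of "fst x" "fst y" "fst z" "fst w" f h k]
      by (cases x; cases y; cases z; cases w) (simp add: ltree_Obj_iff ltree_Arr_iff ltree_Cmp)
  qed
qed

end

section \<open>Grafting corollas\<close>

text \<open>The value \<open>None\<close> gives the fibre of the base point with the base point of
  the source left out, that is, the extra leaves of the base corolla. An empty fibre over a label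
  gives a stump.\<close>

definition fibre_over :: "'b set \<Rightarrow> ('b option \<Rightarrow> 'c) \<Rightarrow> 'c \<Rightarrow> 'b set" where
  "fibre_over B \<phi> y = {b \<in> B. \<phi> (Some b) = y}"

lemma fibre_over_iff [simp]: "b \<in> fibre_over B \<phi> y \<longleftrightarrow> b \<in> B \<and> \<phi> (Some b) = y"
  by (simp add: fibre_over_def)

lemma pointed_simps [simp]: "None \<in> pointed A" "Some a \<in> pointed A \<longleftrightarrow> a \<in> A"
  by (auto simp: pointed_def)

lemma graft_simps [simp]:
  "edge_set (graft B A \<phi> T \<chi>) = Old ` edge_set T \<union> New ` B \<union> {Base}"
  "vertex_set (graft B A \<phi> T \<chi>) = Old ` vertex_set T \<union> New ` A \<union> {Base}"
  "root_edge (graft B A \<phi> T \<chi>) = Base"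
  "upper (graft B A \<phi> T \<chi>) Base = Some Base"
  "upper (graft B A \<phi> T \<chi>) (New b) = None"
  "upper T e = Some v \<Longrightarrow> upper (graft B A \<phi> T \<chi>) (Old e) = Some (Old v)"
  "upper T e = None \<Longrightarrow> upper (graft B A \<phi> T \<chi>) (Old e) = Some (New (the_inv_into A \<chi> e))"
  "lower (graft B A \<phi> T \<chi>) Base = None"
  "lower T e = Some v \<Longrightarrow> lower (graft B A \<phi> T \<chi>) (Old e) = Some (Old v)"
  "lower T e = None \<Longrightarrow> lower (graft B A \<phi> T \<chi>) (Old e) = Some Base"
  "\<phi> (Some b) = Some a \<Longrightarrow> lower (graft B A \<phi> T \<chi>) (New b) = Some (New a)"
  "\<phi> (Some b) = None \<Longrightarrow> lower (graft B A \<phi> T \<chi>) (New b) = Some Base"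
  by (simp_all add: graft_def)

text \<open>The combinatorial part of the construction, kept apart from the group so that it can be
  iterated: a grafted tree, labelled by \<open>New\<close>, is again a valid
  \<open>T\<close>.\<close>

locale grafting =
  fixes B A :: "'l set" and \<phi> :: "'l option \<Rightarrow> 'l option" and T :: "'l dtree" and \<chi> :: "'l \<Rightarrow> 'l cell"
  assumes tree: "is_tree T" and fin: "finite B" and bij: "bij_betw \<chi> A (leaves T)"
    and pt: "\<And>b. b \<in> B \<Longrightarrow> \<phi> (Some b) \<in> pointed A"
begin

abbreviation S where "S \<equiv> graft B A \<phi> T \<chi>"

lemma label_leaf: "a \<in> A \<Longrightarrow> \<chi> a \<in> edge_set T \<and> upper T (\<chi> a) = None"
  using bij by (auto simp: bij_betw_def leaves_def)

lemma leaf_label: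
  assumes "e \<in> edge_set T" "upper T e = None"
  shows "the_inv_into A \<chi> e \<in> A" "\<chi> (the_inv_into A \<chi> e) = e"
proof -
  have e: "e \<in> \<chi> ` A" using assms bij by (auto simp: bij_betw_def leaves_def)
  have i: "inj_on \<chi> A" using bij by (simp add: bij_betw_def)
  show "the_inv_into A \<chi> e \<in> A" using the_inv_into_into[OF i e] by simp
  show "\<chi> (the_inv_into A \<chi> e) = e" by (rule f_the_inv_into_f[OF i e])
qed

lemma label_inv: "a \<in> A \<Longrightarrow> the_inv_into A \<chi> (\<chi> a) = a"
  using bij by (auto simp: bij_betw_def intro: the_inv_into_f_f)

lemma finite_A: "finite A"
proof -
  have "finite (leaves T)" using is_treeD(1)[OF tree] by (simp add: leaves_def)
  then show ?thesis using bij bij_betw_finite by blast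
qed

lemma upper_label: "a \<in> A \<Longrightarrow> upper S (Old (\<chi> a)) = Some (New a)"
  using label_leaf label_inv by simp

lemma edge_cases [consumes 1, case_names Old Label New Base]:
  assumes "x \<in> edge_set S"
  obtains e v where "x = Old e" "e \<in> edge_set T" "upper T e = Some v"
  | a where "x = Old (\<chi> a)" "a \<in> A"
  | b where "x = New b" "b \<in> B"
  | "x = Base"
proof -
  from assms consider e where "x = Old e" "e \<in> edge_set T" | b where "x = New b" "b \<in> B" | "x = Base"
    by auto
  then show thesis
  proof cases
    case (1 e)
    show thesis
    proof (cases "upper T e")
      case None
      with leaf_label[OF 1(2)] 1 that(2)[of "the_inv_into A \<chi> e"] show thesis by simp
    qed (use 1 that in blast)
  qed (use that in blast)+
qed

lemma incoming_Old: "incoming S (Old v) = Old ` incoming T v"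
proof -
  have "lower S (Old e) = Some (Old v) \<longleftrightarrow> lower T e = Some v" for e by (cases "lower T e") simp_all
  moreover have "lower S (New b) \<noteq> Some (Old v)" for b by (cases "\<phi> (Some b)") simp_all
  ultimately show ?thesis by (auto simp: incoming_def)
qed

lemma incoming_New: "incoming S (New a) = New ` fibre_over B \<phi> (Some a)"
proof -
  have "lower S (New b) = Some (New a) \<longleftrightarrow> \<phi> (Some b) = Some a" for b by (cases "\<phi> (Some b)") simp_all
  moreover have "lower S (Old e) \<noteq> Some (New a)" for e by (cases "lower T e") simp_all
  ultimately show ?thesis by (auto simp: incoming_def)
qed

lemma incoming_Base: "incoming S Base = insert (Old (root_edge T)) (New ` fibre_over B \<phi> None)"
proof -
  have "lower S (New b) = Some Base \<longleftrightarrow> \<phi> (Some b) = None" for b by (cases "\<phi> (Some b)") simp_all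
  moreover have "lower S (Old e) = Some Base \<longleftrightarrow> lower T e = None" for e
    by (cases "lower T e") simp_all
  ultimately have "incoming S Base = Old ` {e \<in> edge_set T. lower T e = None} \<union> New ` fibre_over B \<phi> None"
    by (auto simp: incoming_def)
  then show ?thesis unfolding is_treeD(5)[OF tree] by simp
qed

lemma graft_leaves: "leaves S = New ` B"
proof -
  have "upper S (Old e) \<noteq> None" for e by (cases "upper T e") simp_all
  then show ?thesis unfolding leaves_def by (auto simp del: not_None_eq)
qed

lemma child_Old: "(d, e) \<in> child T \<Longrightarrow> (Old d, Old e) \<in> child S"
  by (auto simp: child_def)

lemma child_rtrancl_Old: "(d, e) \<in> (child T)\<^sup>* \<Longrightarrow> (Old d, Old e) \<in> (child S)\<^sup>*"
  by (induction rule: rtrancl_induct) (auto intro: child_Old rtrancl_into_rtrancl)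

lemma graft_is_tree: "is_tree S"
proof (rule is_treeI)
  show "finite (edge_set S)" "finite (vertex_set S)" using is_treeD(1,2)[OF tree] fin finite_A by simp_all
next
  fix x assume "x \<in> edge_set S"
  then consider e where "x = Old e" "e \<in> edge_set T" | b where "x = New b" "b \<in> B" | "x = Base" by auto
  then show "ends S x \<subseteq> vertex_set S"
  proof cases
    case (1 e)
    have "upper S (Old e) \<in> Some ` vertex_set S"
    proof (cases "upper T e")
      case None
      with leaf_label(1)[OF 1(2)] show ?thesis by simp
    qed (use tree_upper_vertex[OF tree 1(2)] in simp)
    moreover have "lower S (Old e) \<in> Some ` vertex_set S"
      using tree_lower_vertex[OF tree 1(2)] by (cases "lower T e") simp_all
    ultimately show ?thesis using 1 by (auto simp: ends_def)
  next
    case (2 b)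
    with pt[of b] show ?thesis by (cases "\<phi> (Some b)") (auto simp: ends_def)
  qed (simp add: ends_def)
next
  fix w assume "w \<in> vertex_set S"
  then consider v where "w = Old v" "v \<in> vertex_set T" | a where "w = New a" "a \<in> A" | "w = Base" by auto
  then show "\<exists>!x. x \<in> outgoing S w"
  proof cases
    case (1 v)
    have "upper S (Old e) = Some (Old v) \<longleftrightarrow> upper T e = Some v" for e by (cases "upper T e") simp_all
    then have "outgoing S w = Old ` outgoing T v" using 1 by (auto simp: outgoing_def)
    with is_treeD(4)[OF tree 1(2)] show ?thesis by auto
  next
    case (2 a)
    have "upper S (Old e) = Some (New a) \<longleftrightarrow> e = \<chi> a" if "e \<in> edge_set T" for e
      using leaf_label[OF that] label_leaf[OF 2(2)] label_inv[OF 2(2)] by (cases "upper T e") auto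
    then have "outgoing S w = {Old (\<chi> a)}" using label_leaf 2 by (auto simp: outgoing_def)
    then show ?thesis by simp
  next
    case 3
    have "upper S (Old e) \<noteq> Some Base" for e by (cases "upper T e") simp_all
    then have "outgoing S w = {Base}" using 3 by (auto simp: outgoing_def)
    then show ?thesis by simp
  qed
next
  have "lower S (Old e) \<noteq> None" for e by (cases "lower T e") simp_all
  moreover have "lower S (New b) \<noteq> None" for b by (cases "\<phi> (Some b)") simp_all
  ultimately show "{e \<in> edge_set S. lower S e = None} = {root_edge S}" by (auto simp del: not_None_eq)
next
  have Old: "(Old e, Base) \<in> (child S)\<^sup>*" if "e \<in> edge_set T" for e
  proof -
    have "(Old (root_edge T), Base) \<in> child S"
      using incoming_Base child_iff_incoming[of Base S Base] by simp
    with child_rtrancl_Old[OF tree_reach_root[OF tree that]] show ?thesis by (rule rtrancl_into_rtrancl)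
  qed
  have New: "(New b, Base) \<in> (child S)\<^sup>*" if "b \<in> B" for b
  proof (cases "\<phi> (Some b)")
    case None
    then have "(New b, Base) \<in> child S"
      using incoming_Base child_iff_incoming[of Base S Base] that by simp
    then show ?thesis by blast
  next
    case (Some a)
    with pt[OF that] have a: "a \<in> A" by simp
    then have "(New b, Old (\<chi> a)) \<in> child S"
      using incoming_New child_iff_incoming[OF _ upper_label[OF a]] label_leaf[OF a] Some that by simp
    with Old label_leaf[OF a] show ?thesis by (meson converse_rtrancl_into_rtrancl)
  qed
  show "(x, root_edge S) \<in> (child S)\<^sup>*" if "x \<in> edge_set S" for x
    using that Old New by auto
qed

lemma cut_Old: "is_cut T r L \<Longrightarrow> is_cut S (Old r) (Old ` L)"
proof (induction rule: is_cut.induct)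
  case (cut_stick r)
  then show ?case using is_cut.cut_stick[of "Old r" S] by simp
next
  case (cut_node r v L)
  \<comment> \<open>The branches are now indexed by edges of the form \<open>Old e\<close>, so the
    family L has to be precomposed with the inverse of the constructor.\<close>
  have "is_cut S (Old r) (\<Union>x\<in>incoming S (Old v). Old ` L (the_inv Old x))"
    using cut_node by (intro is_cut.cut_node) (auto simp: incoming_Old the_inv_f_f inj_def)
  then show ?case by (simp add: incoming_Old the_inv_f_f inj_def image_UN)
qed

lemma cut_New: "a \<in> A \<Longrightarrow> is_cut S (Old (\<chi> a)) (New ` fibre_over B \<phi> (Some a))"
  using cut_corolla[of "Old (\<chi> a)" S "New a"] upper_label label_leaf by (simp add: incoming_New)

lemma cut_Base: "is_cut S Base (insert (Old (root_edge T)) (New ` fibre_over B \<phi> None))"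
  using cut_corolla[of Base S Base] by (simp add: incoming_Base)

text \<open>The inclusion of a tree into its grafted tree. Forgetting labels acts on morphisms by
  composition with it.\<close>

lemma Old_arr: "(\<lambda>e\<in>edge_set T. Old e) \<in> Arr dendroidal T S"
proof (rule dendroidal_ArrI[OF tree graft_is_tree])
  fix e v assume e: "e \<in> edge_set T" "upper T e = Some v"
  show "inj_on (\<lambda>e\<in>edge_set T. Old e) (incoming T v)"
    using incoming_subset[of T v] by (auto simp: inj_on_def)
  have "(\<lambda>e\<in>edge_set T. Old e) ` incoming T v = Old ` incoming T v"
    using incoming_subset[of T v] by force
  with cut_Old[OF cut_corolla[OF e]] e(1)
  show "is_cut S ((\<lambda>e\<in>edge_set T. Old e) e) ((\<lambda>e\<in>edge_set T. Old e) ` incoming T v)" by (simp only: restrict_apply if_True)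
qed auto

text \<open>One condition for each kind of vertex: vertices of \<open>T\<close> are tested on the
  restriction to \<open>T\<close>, the corolla on a leaf by \<open>label\<close>, the base corolla
  by \<open>base\<close>. The inputs of the base mix an old edge with new leaves, and
  \<open>root\<close> keeps their images apart.\<close>

lemma graft_arrI:
  assumes R: "is_tree R" and fE: "f \<in> edge_set S \<rightarrow>\<^sub>E edge_set R"
    and old: "(\<lambda>e\<in>edge_set T. f (Old e)) \<in> Arr dendroidal T R"
    and inj: "inj_on (\<lambda>b. f (New b)) B"
    and label: "\<And>a. a \<in> A \<Longrightarrow> is_cut R (f (Old (\<chi> a))) ((\<lambda>b. f (New b)) ` fibre_over B \<phi> (Some a))"
    and base: "is_cut R (f Base) (insert (f (Old (root_edge T))) ((\<lambda>b. f (New b)) ` fibre_over B \<phi> None))"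
    and root: "\<And>b. b \<in> fibre_over B \<phi> None \<Longrightarrow> f (New b) \<noteq> f (Old (root_edge T))"
  shows "f \<in> Arr dendroidal S R"
proof (rule dendroidal_ArrI[OF graft_is_tree R fE])
  fix x w assume x: "x \<in> edge_set S" "upper S x = Some w"
  have "inj_on f (incoming S w) \<and> is_cut R (f x) (f ` incoming S w)"
    using x(1)
  proof (cases rule: edge_cases)
    case (Old e v)
    have w: "w = Old v" using x(2) Old by simp
    let ?f = "\<lambda>e\<in>edge_set T. f (Old e)"
    have c: "is_cut R (?f e) (?f ` incoming T v)" "inj_on ?f (incoming T v)"
      using arr_corolla[OF tree R old Old(2,3)] by blast+
    have "?f ` incoming T v = f ` incoming S w"
      using incoming_subset[of T v] unfolding w incoming_Old by force
    moreover have "inj_on f (incoming S w)"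
      using c(2) incoming_subset[of T v] unfolding w incoming_Old inj_on_def by (auto simp: subset_iff)
    ultimately show ?thesis using c(1) Old by simp
  next
    case (Label a)
    have w: "w = New a" using x(2) Label upper_label by simp
    have "inj_on f (incoming S w)"
      using inj unfolding w incoming_New inj_on_def by auto
    with label[OF Label(2)] show ?thesis unfolding w incoming_New Label(1) by (simp add: image_image)
  next
    case New
    with x(2) show ?thesis by simp
  next
    case Base
    have w: "w = Base" using x(2) Base by simp
    have "inj_on f (New ` fibre_over B \<phi> None)" using inj unfolding inj_on_def by auto
    moreover have "f (Old (root_edge T)) \<notin> f ` New ` fibre_over B \<phi> None"
    proof
      assume "f (Old (root_edge T)) \<in> f ` New ` fibre_over B \<phi> None"
      then obtain b where "b \<in> fibre_over B \<phi> None" "f (New b) = f (Old (root_edge T))" by fastforce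
      with root show False by blast
    qed
    ultimately have "inj_on f (incoming S w)"
      unfolding w incoming_Base by (auto simp: inj_on_insert)
    with base show ?thesis unfolding w incoming_Base Base by (simp add: image_image)
  qed
  then show "inj_on f (incoming S w)" "is_cut R (f x) (f ` incoming S w)" by blast+
qed

end

text \<open>Serves twice: with \<open>k\<close> and \<open>h\<close> the actions of a group element
  on the label sets it yields the action on a grafted tree, and with identities it yields the effect
  of reindexing on morphisms.\<close>

lemma graft_map_arr:
  assumes S: "grafting B A \<phi> T \<chi>" and S': "grafting B' A' \<phi>' T' \<chi>'"
    and f: "f \<in> Arr dendroidal T T'" and root: "f (root_edge T) = root_edge T'"
    and k: "\<And>a. a \<in> A \<Longrightarrow> k a \<in> A' \<and> f (\<chi> a) = \<chi>' (k a)"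
    and h: "\<And>b. b \<in> B \<Longrightarrow> h b \<in> B'" "inj_on h B"
    and fib: "\<And>a. a \<in> A \<Longrightarrow> h ` fibre_over B \<phi> (Some a) = fibre_over B' \<phi>' (Some (k a))"
      "h ` fibre_over B \<phi> None = fibre_over B' \<phi>' None"
  shows "(\<lambda>x\<in>edge_set (graft B A \<phi> T \<chi>). graft_map f h x)
    \<in> Arr dendroidal (graft B A \<phi> T \<chi>) (graft B' A' \<phi>' T' \<chi>')"
proof -
  interpret S: grafting B A \<phi> T \<chi> by (rule S)
  interpret S': grafting B' A' \<phi>' T' \<chi>' by (rule S')
  let ?f = "\<lambda>x\<in>edge_set S.S. graft_map f h x"
  have New: "(\<lambda>b. ?f (New b)) ` fibre_over B \<phi> y = New ` h ` fibre_over B \<phi> y" for y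
    by (auto simp: image_iff)
  show ?thesis
  proof (rule S.graft_arrI[OF S'.graft_is_tree])
    show "?f \<in> edge_set S.S \<rightarrow>\<^sub>E edge_set S'.S"
      using h(1) dendroidal_Arr_edge[OF f] by auto
    have "compose (edge_set T) (\<lambda>e\<in>edge_set T'. Old e) f \<in> Arr dendroidal T S'.S"
      using category.Cmp_closed[OF dendroidal_category, of T T' S'.S f "\<lambda>e\<in>edge_set T'. Old e"]
        S.tree S'.tree S'.graft_is_tree f S'.Old_arr by simp
    moreover have "compose (edge_set T) (\<lambda>e\<in>edge_set T'. Old e) f = (\<lambda>e\<in>edge_set T. ?f (Old e))"
      using dendroidal_Arr_edge[OF f] by (auto simp: compose_def fun_eq_iff)
    ultimately show "(\<lambda>e\<in>edge_set T. ?f (Old e)) \<in> Arr dendroidal T S'.S" by simp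
    show "inj_on (\<lambda>b. ?f (New b)) B" using h(2) by (auto simp: inj_on_def)
    show "is_cut S'.S (?f (Old (\<chi> a))) ((\<lambda>b. ?f (New b)) ` fibre_over B \<phi> (Some a))" if "a \<in> A" for a
      unfolding New fib(1)[OF that] using S'.cut_New[of "k a"] k[OF that] S.label_leaf[OF that] by simp
    show "is_cut S'.S (?f Base) (insert (?f (Old (root_edge T))) ((\<lambda>b. ?f (New b)) ` fibre_over B \<phi> None))"
      unfolding New fib(2) using S'.cut_Base root tree_root(1)[OF S.tree] by simp
    show "?f (New b) \<noteq> ?f (Old (root_edge T))" if "b \<in> fibre_over B \<phi> None" for b
      using that tree_root(1)[OF S.tree] by simp
  qed
qed

section \<open>Finite pointed sets with group action\<close>

lemma gset_Obj_iff: "(A, \<rho>) \<in> Obj (pointed_gset_category G) \<longleftrightarrow> finite A \<and> group_action G A \<rho>"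
  by (simp add: pointed_gset_category_def)

lemma gset_Arr_iff: "\<phi> \<in> Arr (pointed_gset_category G) (B, \<sigma>) (A, \<rho>) \<longleftrightarrow>
   \<phi> \<in> pointed B \<rightarrow>\<^sub>E pointed A \<and> \<phi> None = None \<and>
   (\<forall>g\<in>carrier G. \<forall>b\<in>B. \<phi> (Some (\<sigma> g b)) = map_option (\<rho> g) (\<phi> (Some b)))"
  by (auto simp: pointed_gset_category_def pointed_def)

lemma gset_simps [simp]:
  "Idt (pointed_gset_category G) (A, \<rho>) = (\<lambda>x\<in>pointed A. x)"
  "Cmp (pointed_gset_category G) (C, \<kappa>) (B, \<sigma>) (A, \<rho>) \<psi> \<phi> = compose (pointed C) \<psi> \<phi>"
  by (simp_all add: pointed_gset_category_def)

lemma category_pointed_gset: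
  "category (pointed_gset_category G :: (('g, 'l::infinite) gset, 'l option \<Rightarrow> 'l option) cat)"
proof
  fix a :: "('g, 'l) gset" assume a: "a \<in> Obj (pointed_gset_category G)"
  obtain A \<rho> where [simp]: "a = (A, \<rho>)" by (cases a)
  interpret group_action G A \<rho> using a by (simp add: gset_Obj_iff)
  show "Idt (pointed_gset_category G) a \<in> Arr (pointed_gset_category G) a a"
    using element_image by (auto simp: gset_Arr_iff)
next
  fix a b c :: "('g, 'l) gset" and f g
  assume a: "a \<in> Obj (pointed_gset_category G)"
    and f: "f \<in> Arr (pointed_gset_category G) a b" and g: "g \<in> Arr (pointed_gset_category G) b c"
  obtain A \<rho> B \<sigma> C \<kappa> where [simp]: "a = (A, \<rho>)" "b = (B, \<sigma>)" "c = (C, \<kappa>)" by (cases a; cases b; cases c)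
  interpret group_action G A \<rho> using a by (simp add: gset_Obj_iff)
  have f': "f x \<in> pointed B" if "x \<in> pointed A" for x using f that by (auto simp: gset_Arr_iff)
  have g': "g x \<in> pointed C" if "x \<in> pointed B" for x using g that by (auto simp: gset_Arr_iff)
  have equiv: "g (f (Some (\<rho> k x))) = map_option (\<kappa> k) (g (f (Some x)))" if k: "k \<in> carrier G" and x: "x \<in> A" for k x
    using f g f'[of "Some x"] k x by (cases "f (Some x)") (simp_all add: gset_Arr_iff)
  have fN: "f None = None" and gN: "g None = None" using f g unfolding gset_Arr_iff \<open>a = _\<close> \<open>b = _\<close> \<open>c = _\<close> by blast+
  show "Cmp (pointed_gset_category G) a b c g f \<in> Arr (pointed_gset_category G) a c"
    unfolding \<open>a = _\<close> \<open>b = _\<close> \<open>c = _\<close> gset_simps gset_Arr_iff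
  proof (intro conjI ballI)
    show "compose (pointed A) g f \<in> pointed A \<rightarrow>\<^sub>E pointed C" using f' g' by (simp add: compose_def)
    show "compose (pointed A) g f None = None" using f g by (simp add: gset_Arr_iff compose_eq)
    fix k x assume k: "k \<in> carrier G" and x: "x \<in> A"
    have "\<rho> k x \<in> A" using element_image[OF k x] by blast
    then show "compose (pointed A) g f (Some (\<rho> k x)) = map_option (\<kappa> k) (compose (pointed A) g f (Some x))"
      using equiv[OF k x] x by (simp only: compose_eq pointed_simps)
  qed
next
  fix a b :: "('g, 'l) gset" and f
  assume f: "f \<in> Arr (pointed_gset_category G) a b"
  obtain A \<rho> B \<sigma> where ab: "a = (A, \<rho>)" "b = (B, \<sigma>)" by (cases a; cases b)
  have f': "f \<in> pointed A \<rightarrow> pointed B" "f \<in> extensional (pointed A)"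
    using f unfolding ab gset_Arr_iff PiE_def by blast+
  show "Cmp (pointed_gset_category G) a b b (Idt (pointed_gset_category G) b) f = f"
    unfolding ab gset_simps by (rule Id_compose[OF f'])
  show "Cmp (pointed_gset_category G) a a b f (Idt (pointed_gset_category G) a) = f"
    unfolding ab gset_simps by (rule compose_Id[OF f'])
next
  fix a b c d :: "('g, 'l) gset" and f g h
  assume f: "f \<in> Arr (pointed_gset_category G) a b"
  obtain A \<rho> B \<sigma> C \<kappa> D \<delta> where abc: "a = (A, \<rho>)" "b = (B, \<sigma>)" "c = (C, \<kappa>)" "d = (D, \<delta>)"
    by (cases a; cases b; cases c; cases d)
  have "f \<in> pointed A \<rightarrow> pointed B" using f unfolding abc gset_Arr_iff PiE_def by blast
  then show "Cmp (pointed_gset_category G) a c d h (Cmp (pointed_gset_category G) a b c g f)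
      = Cmp (pointed_gset_category G) a b d (Cmp (pointed_gset_category G) b c d h g) f"
    unfolding abc gset_simps by (rule compose_assoc)
qed

text \<open>One inclusion is equivariance. For the other, \<open>\<sigma> g\<close> permutes B, and
  \<open>\<rho> g\<close> can be cancelled because it is injective on A. It makes the action on the
  new leaves respect the grafted corollas.\<close>

lemma fibre_over_image:
  assumes \<phi>: "\<phi> \<in> Arr (pointed_gset_category G) (B, \<sigma>) (A, \<rho>)" and g: "g \<in> carrier G"
    and "group_action G B \<sigma>" "group_action G A \<rho>" and y: "y \<in> pointed A"
  shows "\<sigma> g ` fibre_over B \<phi> y = fibre_over B \<phi> (map_option (\<rho> g) y)"
proof -
  interpret B: group_action G B \<sigma> by fact
  interpret A: group_action G A \<rho> by fact
  have eq: "\<phi> (Some (\<sigma> g b)) = map_option (\<rho> g) (\<phi> (Some b))" if "b \<in> B" for b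
    using \<phi> g that by (simp add: gset_Arr_iff)
  show ?thesis
  proof (intro equalityI subsetI)
    fix c assume "c \<in> \<sigma> g ` fibre_over B \<phi> y"
    then show "c \<in> fibre_over B \<phi> (map_option (\<rho> g) y)"
      using eq B.element_image[OF g] by auto
  next
    fix c assume c: "c \<in> fibre_over B \<phi> (map_option (\<rho> g) y)"
    then have "c \<in> \<sigma> g ` B" using B.surj_prop[OF g] by simp
    then obtain b where b: "b \<in> B" "\<sigma> g b = c" by blast
    have "\<phi> (Some b) \<in> pointed A" using \<phi> b(1) by (auto simp: gset_Arr_iff PiE_iff)
    moreover have "map_option (\<rho> g) (\<phi> (Some b)) = map_option (\<rho> g) y" using eq[OF b(1)] b c by simp
    ultimately have "\<phi> (Some b) = y"
      using y A.inj_prop[OF g] by (cases y; cases "\<phi> (Some b)") (auto dest: inj_onD)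
    with b show "c \<in> \<sigma> g ` fibre_over B \<phi> y" by (intro image_eqI[of _ _ b]) simp_all
  qed
qed

section \<open>The group action on a grafted tree\<close>

context group
begin

lemma grafting_of_ltree:
  assumes "(X, \<chi>) \<in> Obj (ltree_category G (A, \<rho>))" "\<phi> \<in> Arr (pointed_gset_category G) (B, \<sigma>) (A, \<rho>)"
    "(B, \<sigma>) \<in> Obj (pointed_gset_category G)"
  shows "grafting B A \<phi> (the_tree X) \<chi>"
  using assms by unfold_locales (auto simp: ltree_Obj_iff gset_Obj_iff gset_Arr_iff PiE_iff gtree_is_tree)

lemma pullback_tree_simps [simp]:
  "the_tree (fst (pullback_tree (B, \<sigma>) (A, \<rho>) \<phi> (X, \<chi>))) = graft B A \<phi> (the_tree X) \<chi>"
  "act (fst (pullback_tree (B, \<sigma>) (A, \<rho>) \<phi> (X, \<chi>))) g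
    = (\<lambda>x\<in>edge_set (graft B A \<phi> (the_tree X) \<chi>). graft_map (act X g) (\<sigma> g) x)"
  "snd (pullback_tree (B, \<sigma>) (A, \<rho>) \<phi> (X, \<chi>)) = (\<lambda>b\<in>B. New b)"
  by (simp_all add: pullback_tree_def Let_def)

lemma pullback_tree_Obj:
  assumes X: "(X, \<chi>) \<in> Obj (ltree_category G (A, \<rho>))"
    and A: "(A, \<rho>) \<in> Obj (pointed_gset_category G)" and B: "(B, \<sigma>) \<in> Obj (pointed_gset_category G)"
    and \<phi>: "\<phi> \<in> Arr (pointed_gset_category G) (B, \<sigma>) (A, \<rho>)"
  shows "pullback_tree (B, \<sigma>) (A, \<rho>) \<phi> (X, \<chi>) \<in> Obj (ltree_category G (B, \<sigma>))"
proof -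
  let ?P = "pullback_tree (B, \<sigma>) (A, \<rho>) \<phi> (X, \<chi>)"
  interpret S: grafting B A \<phi> "the_tree X" \<chi> by (rule grafting_of_ltree[OF X \<phi> B])
  interpret A: group_action G A \<rho> using A by (simp add: gset_Obj_iff)
  interpret B: group_action G B \<sigma> using B by (simp add: gset_Obj_iff)
  have X': "X \<in> Obj (gtree_category G)" using X by (simp add: ltree_Obj_iff)
  have \<sigma>B: "\<sigma> g b \<in> B" if "g \<in> carrier G" "b \<in> B" for g b using B.element_image that by blast
  have "fst ?P \<in> Obj (gtree_category G)"
    unfolding gtree_Obj_iff pullback_tree_simps
  proof (intro conjI ballI)
    show "is_tree S.S" by (rule S.graft_is_tree)
  next
    fix g assume g: "g \<in> carrier G"
    show "(\<lambda>x\<in>edge_set S.S. graft_map (act X g) (\<sigma> g) x) \<in> Arr dendroidal S.S S.S"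
    proof (rule graft_map_arr[OF S.grafting_axioms S.grafting_axioms act_arr[OF X' g] act_root[OF X' g]])
      show "\<rho> g a \<in> A \<and> act X g (\<chi> a) = \<chi> (\<rho> g a)" if "a \<in> A" for a
        using X A.element_image[OF g that] g that by (simp add: ltree_Obj_iff)
      show "\<sigma> g b \<in> B" if "b \<in> B" for b using \<sigma>B g that by blast
      show "inj_on (\<sigma> g) B" by (rule B.inj_prop[OF g])
      show "\<sigma> g ` fibre_over B \<phi> (Some a) = fibre_over B \<phi> (Some (\<rho> g a))" if "a \<in> A" for a
        using fibre_over_image[OF \<phi> g B.group_action_axioms A.group_action_axioms, of "Some a"] that by simp
      show "\<sigma> g ` fibre_over B \<phi> None = fibre_over B \<phi> None"
        using fibre_over_image[OF \<phi> g B.group_action_axioms A.group_action_axioms, of None] by simp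
    qed
  next
    have "\<sigma> \<one> b = b" if "b \<in> B" for b using B.id_eq_one that by (metis restrict_apply)
    then show "(\<lambda>x\<in>edge_set S.S. graft_map (act X \<one>) (\<sigma> \<one>) x) = (\<lambda>x\<in>edge_set S.S. x)"
      using act_one[OF X'] by (intro restrict_ext) auto
  next
    fix g h assume g: "g \<in> carrier G" and h: "h \<in> carrier G"
    show "(\<lambda>x\<in>edge_set S.S. graft_map (act X (g \<otimes> h)) (\<sigma> (g \<otimes> h)) x)
      = compose (edge_set S.S) (\<lambda>x\<in>edge_set S.S. graft_map (act X g) (\<sigma> g) x) (\<lambda>x\<in>edge_set S.S. graft_map (act X h) (\<sigma> h) x)"
      unfolding compose_def
      using act_mult[OF X' g h] act_edge[OF X' h] B.composition_rule[OF _ g h] \<sigma>B[OF h]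
      by (intro restrict_ext) auto
  qed
  moreover have "bij_betw (\<lambda>b\<in>B. New b) B (leaves S.S)"
    unfolding S.graft_leaves by (auto simp: bij_betw_def inj_on_def)
  moreover have "(\<lambda>b\<in>B. New b) (\<sigma> g b) = act (fst ?P) g ((\<lambda>b\<in>B. New b) b)" if "g \<in> carrier G" "b \<in> B" for g b
    using \<sigma>B[OF that] that by simp
  ultimately have "(fst ?P, snd ?P) \<in> Obj (ltree_category G (B, \<sigma>))"
    unfolding ltree_Obj_iff by simp
  then show ?thesis by (simp only: prod.collapse)
qed

end

section \<open>The oplax functor\<close>

lemma compose_ext: "(\<And>x. x \<in> E \<Longrightarrow> f (g x) = h (k x)) \<Longrightarrow> compose E f g = compose E h k"
  by (auto simp: compose_def)

lemma compose_eq_restrict: "(\<And>x. x \<in> E \<Longrightarrow> f (g x) = h x) \<Longrightarrow> compose E f g = (\<lambda>x\<in>E. h x)"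
  by (auto simp: compose_def)

lemma comp_fctr_is_functor:
  assumes F: "is_functor C D F" and K: "is_functor D E K"
  shows "is_functor C E (comp_fctr K F)"
proof -
  interpret F: is_functor C D F by (rule F)
  interpret K: is_functor D E K by (rule K)
  show ?thesis
    by unfold_locales
      (simp_all add: comp_fctr_def F.fob_closed K.fob_closed F.fmor_closed K.fmor_closed
        F.fmor_Idt K.fmor_Idt F.fmor_Cmp K.fmor_Cmp)
qed

lemma id_fctr_is_functor: "category C \<Longrightarrow> is_functor C C id_fctr"
  by (intro is_functor.intro is_functor_axioms.intro) (simp_all add: id_fctr_def)

section \<open>Reindexing functors and their structure maps\<close>

context group
begin

lemma ltree_Obj_gtree: "x \<in> Obj (ltree_category G A) \<Longrightarrow> fst x \<in> Obj (gtree_category G)"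
  by (cases x; cases A) (simp add: ltree_Obj_iff)

lemma ltree_ArrI':
  assumes "x \<in> Obj (ltree_category G (A, \<rho>))" "y \<in> Obj (ltree_category G (A, \<rho>))"
    and "f () \<in> Arr dendroidal (the_tree (fst x)) (the_tree (fst y))"
    and "\<And>g e. \<lbrakk>g \<in> carrier G; e \<in> edge_set (the_tree (fst x))\<rbrakk> \<Longrightarrow> f () (act (fst x) g e) = act (fst y) g (f () e)"
    and "f () (root_edge (the_tree (fst x))) = root_edge (the_tree (fst y))"
    and "\<And>a. a \<in> A \<Longrightarrow> f () (snd x a) = snd y a"
  shows "f \<in> Arr (ltree_category G (A, \<rho>)) x y"
proof -
  have "f \<in> Arr (gtree_category G) (fst x) (fst y)"
    using ltree_Obj_gtree[OF assms(1)] ltree_Obj_gtree[OF assms(2)] assms(3,4) by (simp add: gtree_Arr_iff)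
  then have "f \<in> Arr (ltree_category G (A, \<rho>)) (fst x, snd x) (fst y, snd y)"
    using assms by (intro ltree_ArrI) simp_all
  then show ?thesis by simp
qed

lemma pullback_fctr_simps [simp]:
  "fob (pullback_fctr P Q \<phi>) x = pullback_tree P Q \<phi> x"
  "fmor (pullback_fctr (B, \<sigma>) (A, \<rho>) \<phi>) x y f
    = (\<lambda>_. \<lambda>e\<in>edge_set (graft B A \<phi> (the_tree (fst x)) (snd x)). graft_map (f ()) (\<lambda>b. b) e)"
  by (cases x; simp add: pullback_fctr_def)+

lemma pullback_comp_eq: "pullback_comp (C, \<kappa>) (B, \<sigma>) (A, \<rho>) \<gamma> \<phi> x
    = (\<lambda>_. \<lambda>e\<in>edge_set (graft C A (compose (pointed C) \<phi> \<gamma>) (the_tree (fst x)) (snd x)). graft_map Old (\<lambda>c. c) e)"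
  by (cases x) (simp add: pullback_comp_def)

lemma pullback_unit_eq: "pullback_unit (A, \<rho>) x
    = (\<lambda>_. \<lambda>e\<in>edge_set (graft A A (\<lambda>y\<in>pointed A. y) (the_tree (fst x)) (snd x)).
        case e of Old e \<Rightarrow> e | New a \<Rightarrow> snd x a | Base \<Rightarrow> root_edge (the_tree (fst x)) | Atom _ \<Rightarrow> undefined)"
  by (cases x; hypsubst; unfold fst_conv snd_conv; simp add: pullback_unit_def)

lemma pullback_tree_simps' [simp]:
  "the_tree (fst (pullback_tree (B, \<sigma>) (A, \<rho>) \<phi> x)) = graft B A \<phi> (the_tree (fst x)) (snd x)"
  "snd (pullback_tree (B, \<sigma>) (A, \<rho>) \<phi> x) = (\<lambda>b\<in>B. New b)"
  by (cases x, simp)+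

lemma pullback_tree_eq: "pullback_tree (B, \<sigma>) (A, \<rho>) \<phi> (X, \<chi>)
    = (fst (pullback_tree (B, \<sigma>) (A, \<rho>) \<phi> (X, \<chi>)), \<lambda>b\<in>B. New b)"
  by (metis prod.collapse pullback_tree_simps(3))

lemma pullback_fctr_functor:
  fixes A B :: "'l::infinite set"
  assumes A: "(A, \<rho>) \<in> Obj (pointed_gset_category G)" and B: "(B, \<sigma>) \<in> Obj (pointed_gset_category G)"
    and \<phi>: "\<phi> \<in> Arr (pointed_gset_category G) (B, \<sigma>) (A, \<rho>)"
  shows "is_functor (ltree_category G (A, \<rho>)) (ltree_category G (B, \<sigma>)) (pullback_fctr (B, \<sigma>) (A, \<rho>) \<phi>)"
proof (intro is_functor.intro is_functor_axioms.intro ltree_category)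
  fix x :: "('a, 'l) ltree" assume x: "x \<in> Obj (ltree_category G (A, \<rho>))"
  obtain X \<chi> where [simp]: "x = (X, \<chi>)" by (cases x)
  show "fob (pullback_fctr (B, \<sigma>) (A, \<rho>) \<phi>) x \<in> Obj (ltree_category G (B, \<sigma>))"
    using pullback_tree_Obj[OF _ A B \<phi>] x by simp
  show "fmor (pullback_fctr (B, \<sigma>) (A, \<rho>) \<phi>) x x (Idt (ltree_category G (A, \<rho>)) x)
    = Idt (ltree_category G (B, \<sigma>)) (fob (pullback_fctr (B, \<sigma>) (A, \<rho>) \<phi>) x)"
    unfolding ltree_Idt gtree_Idt by (auto simp: fun_eq_iff restrict_def)
next
  fix x y :: "('a, 'l) ltree" and f
  assume x: "x \<in> Obj (ltree_category G (A, \<rho>))" and y: "y \<in> Obj (ltree_category G (A, \<rho>))"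
    and f: "f \<in> Arr (ltree_category G (A, \<rho>)) x y"
  obtain X \<chi> Y \<xi> where xy [simp]: "x = (X, \<chi>)" "y = (Y, \<xi>)" by (cases x; cases y)
  interpret S: grafting B A \<phi> "the_tree X" \<chi> by (rule grafting_of_ltree[OF x[unfolded xy] \<phi> B])
  interpret S': grafting B A \<phi> "the_tree Y" \<xi> by (rule grafting_of_ltree[OF y[unfolded xy] \<phi> B])
  have f': "f \<in> Arr (gtree_category G) X Y" "f () (root_edge (the_tree X)) = root_edge (the_tree Y)"
    "\<And>a. a \<in> A \<Longrightarrow> f () (\<chi> a) = \<xi> a" using f by (auto simp: ltree_Arr_iff)
  have X: "X \<in> Obj (gtree_category G)" using x by (simp add: ltree_Obj_iff)
  interpret B: group_action G B \<sigma> using B by (simp add: gset_Obj_iff)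
  show "fmor (pullback_fctr (B, \<sigma>) (A, \<rho>) \<phi>) x y f
    \<in> Arr (ltree_category G (B, \<sigma>)) (fob (pullback_fctr (B, \<sigma>) (A, \<rho>) \<phi>) x) (fob (pullback_fctr (B, \<sigma>) (A, \<rho>) \<phi>) y)"
  proof (rule ltree_ArrI')
    show "fob (pullback_fctr (B, \<sigma>) (A, \<rho>) \<phi>) x \<in> Obj (ltree_category G (B, \<sigma>))"
      "fob (pullback_fctr (B, \<sigma>) (A, \<rho>) \<phi>) y \<in> Obj (ltree_category G (B, \<sigma>))"
      using pullback_tree_Obj[OF _ A B \<phi>] x y by simp_all
    show "fmor (pullback_fctr (B, \<sigma>) (A, \<rho>) \<phi>) x y f () \<in> Arr dendroidal
      (the_tree (fst (fob (pullback_fctr (B, \<sigma>) (A, \<rho>) \<phi>) x))) (the_tree (fst (fob (pullback_fctr (B, \<sigma>) (A, \<rho>) \<phi>) y)))"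
      unfolding xy pullback_fctr_simps pullback_tree_simps fst_conv snd_conv
      by (rule graft_map_arr[where k = "\<lambda>a. a", OF S.grafting_axioms S'.grafting_axioms gtree_ArrD(1)[OF f'(1)] f'(2)])
        (simp_all add: f'(3))
    fix g e assume g: "g \<in> carrier G" and e: "e \<in> edge_set (the_tree (fst (fob (pullback_fctr (B, \<sigma>) (A, \<rho>) \<phi>) x)))"
    then show "fmor (pullback_fctr (B, \<sigma>) (A, \<rho>) \<phi>) x y f () (act (fst (fob (pullback_fctr (B, \<sigma>) (A, \<rho>) \<phi>) x)) g e)
      = act (fst (fob (pullback_fctr (B, \<sigma>) (A, \<rho>) \<phi>) y)) g (fmor (pullback_fctr (B, \<sigma>) (A, \<rho>) \<phi>) x y f () e)"
      using gtree_ArrD(2,3)[OF f'(1)] act_edge[OF X g] B.element_image[OF g] by auto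
  qed simp_all
next
  fix x y z :: "('a, 'l) ltree" and f h
  assume f: "f \<in> Arr (ltree_category G (A, \<rho>)) x y"
  obtain X \<chi> Y \<xi> Z \<zeta> where xyz [simp]: "x = (X, \<chi>)" "y = (Y, \<xi>)" "z = (Z, \<zeta>)" by (cases x; cases y; cases z)
  have f': "f \<in> Arr (gtree_category G) X Y" using f by (auto simp: ltree_Arr_iff)
  show "fmor (pullback_fctr (B, \<sigma>) (A, \<rho>) \<phi>) x z (Cmp (ltree_category G (A, \<rho>)) x y z h f)
    = Cmp (ltree_category G (B, \<sigma>)) (fob (pullback_fctr (B, \<sigma>) (A, \<rho>) \<phi>) x) (fob (pullback_fctr (B, \<sigma>) (A, \<rho>) \<phi>) y)
      (fob (pullback_fctr (B, \<sigma>) (A, \<rho>) \<phi>) z) (fmor (pullback_fctr (B, \<sigma>) (A, \<rho>) \<phi>) y z h) (fmor (pullback_fctr (B, \<sigma>) (A, \<rho>) \<phi>) x y f)"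
    unfolding ltree_Cmp gtree_Cmp xyz pullback_fctr_simps pullback_tree_simps fst_conv snd_conv
    using gtree_ArrD(2)[OF f'] by (intro ext compose_eq_restrict[symmetric]) (auto simp: compose_eq)
qed

text \<open>A corolla of the one-step graft goes to the two-level subtree of the two-step graft that
  refines it, and the leaves of this subtree are computed by substituting cuts. The intermediate
  edges are not in the image, so the map is not invertible in general.\<close>

lemma pullback_comp_arr:
  fixes A B C :: "'l::infinite set"
  assumes A: "(A, \<rho>) \<in> Obj (pointed_gset_category G)" and B: "(B, \<sigma>) \<in> Obj (pointed_gset_category G)"
    and C: "(C, \<kappa>) \<in> Obj (pointed_gset_category G)"
    and \<gamma>: "\<gamma> \<in> Arr (pointed_gset_category G) (C, \<kappa>) (B, \<sigma>)"
    and \<phi>: "\<phi> \<in> Arr (pointed_gset_category G) (B, \<sigma>) (A, \<rho>)"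
    and x: "(X, \<chi>) \<in> Obj (ltree_category G (A, \<rho>))"
  shows "pullback_comp (C, \<kappa>) (B, \<sigma>) (A, \<rho>) \<gamma> \<phi> (X, \<chi>) \<in> Arr (ltree_category G (C, \<kappa>))
    (pullback_tree (C, \<kappa>) (A, \<rho>) (compose (pointed C) \<phi> \<gamma>) (X, \<chi>))
    (pullback_tree (C, \<kappa>) (B, \<sigma>) \<gamma> (pullback_tree (B, \<sigma>) (A, \<rho>) \<phi> (X, \<chi>)))"
    (is "?\<tau> \<in> Arr _ ?P ?Q")
proof -
  let ?\<psi> = "compose (pointed C) \<phi> \<gamma>"
  have \<psi>: "?\<psi> \<in> Arr (pointed_gset_category G) (C, \<kappa>) (A, \<rho>)"
    using category.Cmp_closed[OF category_pointed_gset C B A \<gamma> \<phi>] by simp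
  define Z where "Z = fst (pullback_tree (B, \<sigma>) (A, \<rho>) \<phi> (X, \<chi>))"
  have Z: "pullback_tree (B, \<sigma>) (A, \<rho>) \<phi> (X, \<chi>) = (Z, \<lambda>b\<in>B. New b)"
    by (simp add: Z_def pullback_tree_eq[symmetric])
  have Z_tree [simp]: "the_tree Z = graft B A \<phi> (the_tree X) \<chi>"
    and Z_act [simp]: "act Z g = (\<lambda>x\<in>edge_set (graft B A \<phi> (the_tree X) \<chi>). graft_map (act X g) (\<sigma> g) x)" for g
    by (simp_all add: Z_def)
  have z: "(Z, \<lambda>b\<in>B. New b) \<in> Obj (ltree_category G (B, \<sigma>))"
    using pullback_tree_Obj[OF x A B \<phi>] by (simp add: Z)
  interpret S1: grafting C A ?\<psi> "the_tree X" \<chi> using grafting_of_ltree[OF x \<psi> C] .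
  interpret S2: grafting B A \<phi> "the_tree X" \<chi> using grafting_of_ltree[OF x \<phi> B] .
  interpret S3: grafting C B \<gamma> S2.S "\<lambda>b\<in>B. New b" using grafting_of_ltree[OF z \<gamma> C] by simp
  interpret C: group_action G C \<kappa> using C by (simp add: gset_Obj_iff)
  have \<tau>: "?\<tau> = (\<lambda>_. \<lambda>x\<in>edge_set S1.S. graft_map Old (\<lambda>c. c) x)" by (simp add: pullback_comp_def)
  have X: "X \<in> Obj (gtree_category G)" using x by (simp add: ltree_Obj_iff)
  let ?t = "\<lambda>x\<in>edge_set S1.S. graft_map Old (\<lambda>c. c) x"
  \<comment> \<open>Substituting M pushes a cut past the outermost corollas: every intermediate leaf
    \<open>Old (New b)\<close> gives way to the final leaves over b, all other edges stay.\<close>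
  define M where "M x = (case x of Old y \<Rightarrow> (case y of New b \<Rightarrow> New ` fibre_over C \<gamma> (Some b) | _ \<Rightarrow> {x}) | _ \<Rightarrow> {x})" for x
  have cutM: "is_cut S3.S x (M x)" if "x \<in> edge_set S3.S" for x
    using that is_cut.cut_stick[OF that] S3.cut_New by (auto simp: M_def)
  have substM: "is_cut S3.S r (\<Union>x\<in>L. M x)" if "is_cut S3.S r L" for r L
    using cut_subst[OF that] cutM cut_edges[OF that] by blast
  have New: "(\<lambda>c. ?t (New c)) ` fibre_over C \<psi> y = New ` fibre_over C \<psi> y" for \<psi> and y :: "'l option"
    by (auto simp: image_iff)
  have \<phi>N: "\<phi> None = None" and \<gamma>B: "\<And>c. c \<in> C \<Longrightarrow> \<gamma> (Some c) \<in> pointed B"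
    using \<phi> \<gamma> by (auto simp: gset_Arr_iff PiE_iff)
  have fib: "(\<Union>b\<in>fibre_over B \<phi> (Some a). New ` fibre_over C \<gamma> (Some b)) = New ` fibre_over C ?\<psi> (Some a)" for a
  proof -
    have "\<exists>b\<in>B. \<phi> (Some b) = Some a \<and> \<gamma> (Some c) = Some b" if "c \<in> C" "\<phi> (\<gamma> (Some c)) = Some a" for c
      using that \<gamma>B[OF that(1)] \<phi>N by (cases "\<gamma> (Some c)") auto
    then show ?thesis by (fastforce simp: compose_eq)
  qed
  \<comment> \<open>The composite reaches the base point in one of two ways: already under \<gamma>,
    or at some b which \<phi> sends to the base point.\<close>
  have fibN: "New ` fibre_over C \<gamma> None \<union> (\<Union>b\<in>fibre_over B \<phi> None. New ` fibre_over C \<gamma> (Some b))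
      = New ` fibre_over C ?\<psi> None"
  proof -
    have "\<gamma> (Some c) = None \<or> (\<exists>b\<in>B. \<phi> (Some b) = None \<and> \<gamma> (Some c) = Some b)"
      if "c \<in> C" "\<phi> (\<gamma> (Some c)) = None" for c
      using that \<gamma>B[OF that(1)] by (cases "\<gamma> (Some c)") auto
    then show ?thesis using \<phi>N by (fastforce simp: compose_eq)
  qed
  have arr: "?t \<in> Arr dendroidal S1.S S3.S"
  proof (rule S1.graft_arrI[OF S3.graft_is_tree])
    show "?t \<in> edge_set S1.S \<rightarrow>\<^sub>E edge_set S3.S" by auto
    have "(\<lambda>e\<in>edge_set (the_tree X). ?t (Old e))
        = compose (edge_set (the_tree X)) (\<lambda>e\<in>edge_set S2.S. Old e) (\<lambda>e\<in>edge_set (the_tree X). Old e)"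
      by (rule compose_eq_restrict[symmetric]) simp
    then show "(\<lambda>e\<in>edge_set (the_tree X). ?t (Old e)) \<in> Arr dendroidal (the_tree X) S3.S"
      using category.Cmp_closed[OF dendroidal_category _ _ _ S2.Old_arr S3.Old_arr]
        S1.tree S2.graft_is_tree S3.graft_is_tree by simp
    show "inj_on (\<lambda>b. ?t (New b)) C" by (auto simp: inj_on_def)
    show "is_cut S3.S (?t (Old (\<chi> a))) ((\<lambda>b. ?t (New b)) ` fibre_over C ?\<psi> (Some a))" if a: "a \<in> A" for a
    proof -
      from substM[OF S3.cut_Old[OF S2.cut_New[OF a]]]
      have "is_cut S3.S (Old (Old (\<chi> a))) (\<Union>b\<in>fibre_over B \<phi> (Some a). New ` fibre_over C \<gamma> (Some b))"
        by (simp add: M_def)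
      then show ?thesis unfolding New fib using S1.label_leaf[OF a] by simp
    qed
    show "is_cut S3.S (?t Base) (insert (?t (Old (root_edge (the_tree X)))) ((\<lambda>b. ?t (New b)) ` fibre_over C ?\<psi> None))"
    proof -
      \<comment> \<open>The two-step graft has two base corollas, joined by the edge
        \<open>Old Base\<close>. N expands this edge into the inputs of the inner one; M afterwards
        expands the intermediate leaves among these inputs.\<close>
      let ?N = "\<lambda>x. if x = Old Base then insert (Old (Old (root_edge (the_tree X)))) (Old ` New ` fibre_over B \<phi> None) else {x}"
      have N: "is_cut S3.S x (?N x)" if "x \<in> edge_set S3.S" for x
      proof (cases "x = Old Base")
        case True
        then show ?thesis using S3.cut_Old[OF S2.cut_Base] by (simp only: image_insert if_True simp_thms)
      next
        case False
        then show ?thesis using is_cut.cut_stick[OF that] by (simp only: if_False)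
      qed
      have "is_cut S3.S Base (\<Union>x\<in>insert (Old (root_edge S2.S)) (New ` fibre_over C \<gamma> None). ?N x)"
        by (rule cut_subst[OF S3.cut_Base N]) (rule subsetD[OF cut_edges[OF S3.cut_Base]])
      moreover have "(\<Union>x\<in>New ` fibre_over C \<gamma> None. ?N x) = New ` fibre_over C \<gamma> None" by auto
      ultimately have "is_cut S3.S Base (insert (Old (Old (root_edge (the_tree X))))
          (Old ` New ` fibre_over B \<phi> None) \<union> New ` fibre_over C \<gamma> None)"
        by (simp only: UN_insert graft_simps(3) if_True simp_thms)
      from substM[OF this] have "is_cut S3.S Base (insert (Old (Old (root_edge (the_tree X))))
          ((\<Union>b\<in>fibre_over B \<phi> None. New ` fibre_over C \<gamma> (Some b)) \<union> New ` fibre_over C \<gamma> None))"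
        by (simp add: M_def UN_Un image_image UNION_singleton_eq_range)
      then have "is_cut S3.S Base (insert (Old (Old (root_edge (the_tree X))))
          (New ` fibre_over C \<gamma> None \<union> (\<Union>b\<in>fibre_over B \<phi> None. New ` fibre_over C \<gamma> (Some b))))"
        by (simp only: Un_commute)
      then show ?thesis unfolding New fibN using tree_root(1)[OF S1.tree] by simp
    qed
    show "?t (New b) \<noteq> ?t (Old (root_edge (the_tree X)))" if "b \<in> fibre_over C ?\<psi> None" for b
      using that tree_root(1)[OF S1.tree] by simp
  qed
  have \<kappa>C: "\<kappa> g c \<in> C" if "g \<in> carrier G" "c \<in> C" for g c using C.element_image[OF that] by blast
  have equiv: "?t (act (fst ?P) g e) = act (fst ?Q) g (?t e)" if g: "g \<in> carrier G" and e: "e \<in> edge_set S1.S" for g e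
  proof -
    from e consider d where "e = Old d" "d \<in> edge_set (the_tree X)" | c where "e = New c" "c \<in> C" | "e = Base"
      by auto
    then show ?thesis by cases (simp_all add: Z act_edge[OF X g] \<kappa>C[OF g])
  qed
  show ?thesis
  proof (rule ltree_ArrI')
    show "?P \<in> Obj (ltree_category G (C, \<kappa>))" by (rule pullback_tree_Obj[OF x A C \<psi>])
    show "?Q \<in> Obj (ltree_category G (C, \<kappa>))" unfolding Z by (rule pullback_tree_Obj[OF z B C \<gamma>])
    show "?\<tau> () \<in> Arr dendroidal (the_tree (fst ?P)) (the_tree (fst ?Q))"
      unfolding \<tau> Z pullback_tree_simps Z_tree by (rule arr)
    show "?\<tau> () (act (fst ?P) g e) = act (fst ?Q) g (?\<tau> () e)"
      if "g \<in> carrier G" "e \<in> edge_set (the_tree (fst ?P))" for g e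
      using equiv that unfolding \<tau> pullback_tree_simps(1) by blast
  qed (simp_all add: \<tau> Z)
qed

text \<open>For the identity, the fibre over a label is a singleton and the fibre over the base
  point is empty. All grafted corollas are then unary, and a unary corolla may be collapsed to a
  stick.\<close>

lemma pullback_unit_arr:
  fixes A :: "'l::infinite set"
  assumes A: "(A, \<rho>) \<in> Obj (pointed_gset_category G)" and x: "(X, \<chi>) \<in> Obj (ltree_category G (A, \<rho>))"
  shows "pullback_unit (A, \<rho>) (X, \<chi>) \<in> Arr (ltree_category G (A, \<rho>))
    (pullback_tree (A, \<rho>) (A, \<rho>) (\<lambda>y\<in>pointed A. y) (X, \<chi>)) (X, \<chi>)"
proof -
  let ?i = "\<lambda>y\<in>pointed A. y"
  have i: "?i \<in> Arr (pointed_gset_category G) (A, \<rho>) (A, \<rho>)"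
    using category.Idt_closed[OF category_pointed_gset A] by simp
  interpret S: grafting A A ?i "the_tree X" \<chi> using grafting_of_ltree[OF x i A] .
  interpret A: group_action G A \<rho> using A by (simp add: gset_Obj_iff)
  have X: "X \<in> Obj (gtree_category G)" and \<chi>: "\<And>g a. g \<in> carrier G \<Longrightarrow> a \<in> A \<Longrightarrow> \<chi> (\<rho> g a) = act X g (\<chi> a)"
    using x by (simp_all add: ltree_Obj_iff)
  let ?t = "pullback_unit (A, \<rho>) (X, \<chi>) ()"
  have t: "?t (Old e) = e" "?t (New a) = \<chi> a" "?t Base = root_edge (the_tree X)"
    if "e \<in> edge_set (the_tree X)" "a \<in> A" for e a using that by (simp_all add: pullback_unit_def)
  have tB: "?t Base = root_edge (the_tree X)" by (simp add: pullback_unit_def)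
  have "?t \<in> Arr dendroidal S.S (the_tree X)"
  proof (rule S.graft_arrI[OF S.tree])
    show "?t \<in> edge_set S.S \<rightarrow>\<^sub>E edge_set (the_tree X)"
      using S.label_leaf tree_root(1)[OF S.tree] by (auto simp: pullback_unit_def)
    have "(\<lambda>e\<in>edge_set (the_tree X). ?t (Old e)) = (\<lambda>e\<in>edge_set (the_tree X). e)"
      by (rule restrict_ext) (simp add: pullback_unit_def)
    then show "(\<lambda>e\<in>edge_set (the_tree X). ?t (Old e)) \<in> Arr dendroidal (the_tree X) (the_tree X)"
      using category.Idt_closed[OF dendroidal_category, of "the_tree X"] S.tree by simp
    have "inj_on \<chi> A" using S.bij by (simp add: bij_betw_def)
    then show "inj_on (\<lambda>a. ?t (New a)) A" by (auto simp: inj_on_def pullback_unit_def)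
    show "is_cut (the_tree X) (?t (Old (\<chi> a))) ((\<lambda>b. ?t (New b)) ` fibre_over A ?i (Some a))" if a: "a \<in> A" for a
    proof -
      have "fibre_over A ?i (Some a) = {a}" using a by auto
      then show ?thesis using S.label_leaf[OF a] a is_cut.cut_stick[of "\<chi> a" "the_tree X"] by (simp add: pullback_unit_def)
    qed
    have N: "fibre_over A ?i None = {}" by auto
    show "is_cut (the_tree X) (?t Base) (insert (?t (Old (root_edge (the_tree X)))) ((\<lambda>b. ?t (New b)) ` fibre_over A ?i None))"
      unfolding N using tree_root(1)[OF S.tree] is_cut.cut_stick[of "root_edge (the_tree X)" "the_tree X"]
      by (simp add: pullback_unit_def)
    show "?t (New b) \<noteq> ?t (Old (root_edge (the_tree X)))" if "b \<in> fibre_over A ?i None" for b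
      using that N by blast
  qed
  moreover have "?t (act (fst (pullback_tree (A, \<rho>) (A, \<rho>) ?i (X, \<chi>))) g e) = act X g (?t e)"
    if g: "g \<in> carrier G" and "e \<in> edge_set S.S" for g e
    using that act_edge[OF X g] A.element_image[OF g] \<chi>[OF g] act_root[OF X g] by (auto simp: pullback_unit_def)
  moreover have "?t (New a) = \<chi> a" if "a \<in> A" for a using that by (simp add: pullback_unit_def)
  ultimately show ?thesis
    using pullback_tree_Obj[OF x A A i] x tB by (intro ltree_ArrI') simp_all
qed

lemma labelled_trees_simps [simp]:
  "fibre (labelled_trees G) = ltree_category G"
  "reindex (labelled_trees G) = pullback_fctr"
  "opl_comp (labelled_trees G) = pullback_comp"
  "opl_unit (labelled_trees G) = pullback_unit"
  by (simp_all add: labelled_trees_def)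

lemma pullback_comp_nat:
  fixes A B C :: "'l::infinite set"
  assumes A: "(A, \<rho>) \<in> Obj (pointed_gset_category G)" and B: "(B, \<sigma>) \<in> Obj (pointed_gset_category G)"
    and C: "(C, \<kappa>) \<in> Obj (pointed_gset_category G)"
    and \<gamma>: "\<gamma> \<in> Arr (pointed_gset_category G) (C, \<kappa>) (B, \<sigma>)"
    and \<phi>: "\<phi> \<in> Arr (pointed_gset_category G) (B, \<sigma>) (A, \<rho>)"
  shows "nat_trans (ltree_category G (A, \<rho>)) (ltree_category G (C, \<kappa>))
    (pullback_fctr (C, \<kappa>) (A, \<rho>) (compose (pointed C) \<phi> \<gamma>))
    (comp_fctr (pullback_fctr (C, \<kappa>) (B, \<sigma>) \<gamma>) (pullback_fctr (B, \<sigma>) (A, \<rho>) \<phi>))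
    (pullback_comp (C, \<kappa>) (B, \<sigma>) (A, \<rho>) \<gamma> \<phi>)"
  unfolding nat_trans_def
proof (intro conjI ballI)
  have \<psi>: "compose (pointed C) \<phi> \<gamma> \<in> Arr (pointed_gset_category G) (C, \<kappa>) (A, \<rho>)"
    using category.Cmp_closed[OF category_pointed_gset C B A \<gamma> \<phi>] by simp
  show "is_functor (ltree_category G (A, \<rho>)) (ltree_category G (C, \<kappa>))
     (pullback_fctr (C, \<kappa>) (A, \<rho>) (compose (pointed C) \<phi> \<gamma>))"
    by (rule pullback_fctr_functor[OF A C \<psi>])
  show "is_functor (ltree_category G (A, \<rho>)) (ltree_category G (C, \<kappa>))
     (comp_fctr (pullback_fctr (C, \<kappa>) (B, \<sigma>) \<gamma>) (pullback_fctr (B, \<sigma>) (A, \<rho>) \<phi>))"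
    by (rule comp_fctr_is_functor[OF pullback_fctr_functor[OF A B \<phi>] pullback_fctr_functor[OF B C \<gamma>]])
next
  fix x :: "('a, 'l) ltree" assume "x \<in> Obj (ltree_category G (A, \<rho>))"
  then show "pullback_comp (C, \<kappa>) (B, \<sigma>) (A, \<rho>) \<gamma> \<phi> x \<in> Arr (ltree_category G (C, \<kappa>))
     (fob (pullback_fctr (C, \<kappa>) (A, \<rho>) (compose (pointed C) \<phi> \<gamma>)) x)
     (fob (comp_fctr (pullback_fctr (C, \<kappa>) (B, \<sigma>) \<gamma>) (pullback_fctr (B, \<sigma>) (A, \<rho>) \<phi>)) x)"
    using pullback_comp_arr[OF assms] by (cases x) (simp add: comp_fctr_def)
next
  fix x y :: "('a, 'l) ltree" and f
  assume f: "f \<in> Arr (ltree_category G (A, \<rho>)) x y"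
  obtain X \<chi> Y \<xi> where xy: "x = (X, \<chi>)" "y = (Y, \<xi>)" by (cases x; cases y)
  have f': "f \<in> Arr (gtree_category G) X Y" using f xy by (auto simp: ltree_Arr_iff)
  show "Cmp (ltree_category G (C, \<kappa>)) (fob (pullback_fctr (C, \<kappa>) (A, \<rho>) (compose (pointed C) \<phi> \<gamma>)) x)
      (fob (pullback_fctr (C, \<kappa>) (A, \<rho>) (compose (pointed C) \<phi> \<gamma>)) y)
      (fob (comp_fctr (pullback_fctr (C, \<kappa>) (B, \<sigma>) \<gamma>) (pullback_fctr (B, \<sigma>) (A, \<rho>) \<phi>)) y)
      (pullback_comp (C, \<kappa>) (B, \<sigma>) (A, \<rho>) \<gamma> \<phi> y)
      (fmor (pullback_fctr (C, \<kappa>) (A, \<rho>) (compose (pointed C) \<phi> \<gamma>)) x y f)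
    = Cmp (ltree_category G (C, \<kappa>)) (fob (pullback_fctr (C, \<kappa>) (A, \<rho>) (compose (pointed C) \<phi> \<gamma>)) x)
      (fob (comp_fctr (pullback_fctr (C, \<kappa>) (B, \<sigma>) \<gamma>) (pullback_fctr (B, \<sigma>) (A, \<rho>) \<phi>)) x)
      (fob (comp_fctr (pullback_fctr (C, \<kappa>) (B, \<sigma>) \<gamma>) (pullback_fctr (B, \<sigma>) (A, \<rho>) \<phi>)) y)
      (fmor (comp_fctr (pullback_fctr (C, \<kappa>) (B, \<sigma>) \<gamma>) (pullback_fctr (B, \<sigma>) (A, \<rho>) \<phi>)) x y f)
      (pullback_comp (C, \<kappa>) (B, \<sigma>) (A, \<rho>) \<gamma> \<phi> x)"
    unfolding ltree_Cmp gtree_Cmp xy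
    using gtree_ArrD(2)[OF f'] by (auto simp: comp_fctr_def pullback_comp_eq intro!: compose_ext)
qed

lemma pullback_unit_nat:
  fixes A :: "'l::infinite set"
  assumes A: "(A, \<rho>) \<in> Obj (pointed_gset_category G)"
  shows "nat_trans (ltree_category G (A, \<rho>)) (ltree_category G (A, \<rho>))
    (pullback_fctr (A, \<rho>) (A, \<rho>) (\<lambda>y\<in>pointed A. y)) id_fctr (pullback_unit (A, \<rho>))"
  unfolding nat_trans_def
proof (intro conjI ballI)
  have i: "(\<lambda>y\<in>pointed A. y) \<in> Arr (pointed_gset_category G) (A, \<rho>) (A, \<rho>)"
    using category.Idt_closed[OF category_pointed_gset A] by simp
  show "is_functor (ltree_category G (A, \<rho>)) (ltree_category G (A, \<rho>)) (pullback_fctr (A, \<rho>) (A, \<rho>) (\<lambda>y\<in>pointed A. y))"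
    by (rule pullback_fctr_functor[OF A A i])
  show "is_functor (ltree_category G (A, \<rho>)) (ltree_category G (A, \<rho>)) id_fctr"
    by (rule id_fctr_is_functor[OF ltree_category])
next
  fix x :: "('a, 'l) ltree" assume "x \<in> Obj (ltree_category G (A, \<rho>))"
  then show "pullback_unit (A, \<rho>) x \<in> Arr (ltree_category G (A, \<rho>))
     (fob (pullback_fctr (A, \<rho>) (A, \<rho>) (\<lambda>y\<in>pointed A. y)) x) (fob id_fctr x)"
    using pullback_unit_arr[OF A] by (cases x) (simp add: id_fctr_def)
next
  fix x y :: "('a, 'l) ltree" and f
  assume x: "x \<in> Obj (ltree_category G (A, \<rho>))" and f: "f \<in> Arr (ltree_category G (A, \<rho>)) x y"
  obtain X \<chi> Y \<xi> where xy: "x = (X, \<chi>)" "y = (Y, \<xi>)" by (cases x; cases y)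
  have f': "f \<in> Arr (gtree_category G) X Y" "f () (root_edge (the_tree X)) = root_edge (the_tree Y)"
    "\<And>a. a \<in> A \<Longrightarrow> f () (\<chi> a) = \<xi> a" using f xy by (auto simp: ltree_Arr_iff)
  show "Cmp (ltree_category G (A, \<rho>)) (fob (pullback_fctr (A, \<rho>) (A, \<rho>) (\<lambda>y\<in>pointed A. y)) x)
      (fob (pullback_fctr (A, \<rho>) (A, \<rho>) (\<lambda>y\<in>pointed A. y)) y) (fob id_fctr y) (pullback_unit (A, \<rho>) y)
      (fmor (pullback_fctr (A, \<rho>) (A, \<rho>) (\<lambda>y\<in>pointed A. y)) x y f)
    = Cmp (ltree_category G (A, \<rho>)) (fob (pullback_fctr (A, \<rho>) (A, \<rho>) (\<lambda>y\<in>pointed A. y)) x) (fob id_fctr x)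
      (fob id_fctr y) (fmor id_fctr x y f) (pullback_unit (A, \<rho>) x)"
    unfolding ltree_Cmp gtree_Cmp xy
    using gtree_ArrD(2)[OF f'(1)] f'(2,3)
    by (auto simp: id_fctr_def pullback_unit_eq intro!: compose_ext)
qed

text \<open>On an old edge both sides of a coherence law add or remove the same layers of
  \<open>Old\<close>. New leaves and the base agree as well, since the leaf of a grafted tree
  labelled \<open>b\<close> is \<open>New b\<close> and its root is \<open>Base\<close>.\<close>

theorem labelled_trees_oplax:
  "oplax_functor (pointed_gset_category G :: (('a, 'l::infinite) gset, 'l option \<Rightarrow> 'l option) cat) (labelled_trees G)"
proof (intro oplax_functor.intro oplax_functor_axioms.intro category_pointed_gset)
  fix a :: "('a, 'l) gset" assume a: "a \<in> Obj (pointed_gset_category G)"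
  obtain A \<rho> where A: "a = (A, \<rho>)" by (cases a)
  show "category (fibre (labelled_trees G) a)" unfolding A labelled_trees_simps by (rule ltree_category)
  show "nat_trans (fibre (labelled_trees G) a) (fibre (labelled_trees G) a)
      (reindex (labelled_trees G) a a (Idt (pointed_gset_category G) a)) id_fctr (opl_unit (labelled_trees G) a)"
    using pullback_unit_nat a unfolding A labelled_trees_simps gset_simps by blast
next
  fix a b :: "('a, 'l) gset" and f
  assume "a \<in> Obj (pointed_gset_category G)" "b \<in> Obj (pointed_gset_category G)" "f \<in> Arr (pointed_gset_category G) a b"
  then show "is_functor (fibre (labelled_trees G) b) (fibre (labelled_trees G) a) (reindex (labelled_trees G) a b f)"
    using pullback_fctr_functor by (cases a; cases b) simp
next
  fix a b c :: "('a, 'l) gset" and f g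
  assume "a \<in> Obj (pointed_gset_category G)" "b \<in> Obj (pointed_gset_category G)" "c \<in> Obj (pointed_gset_category G)"
    "f \<in> Arr (pointed_gset_category G) a b" "g \<in> Arr (pointed_gset_category G) b c"
  then show "nat_trans (fibre (labelled_trees G) c) (fibre (labelled_trees G) a)
      (reindex (labelled_trees G) a c (Cmp (pointed_gset_category G) a b c g f))
      (comp_fctr (reindex (labelled_trees G) a b f) (reindex (labelled_trees G) b c g))
      (opl_comp (labelled_trees G) a b c f g)"
    using pullback_comp_nat by (cases a; cases b; cases c) simp
next
  fix a b c d :: "('a, 'l) gset" and f g h and x :: "('a, 'l) ltree"
  obtain A \<rho> B \<sigma> C \<kappa> D \<delta> X \<chi> where abc [simp]: "a = (A, \<rho>)" "b = (B, \<sigma>)" "c = (C, \<kappa>)" "d = (D, \<delta>)" "x = (X, \<chi>)"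
    by (cases a; cases b; cases c; cases d; cases x)
  show "let gf = Cmp (pointed_gset_category G) a b c g f; hg = Cmp (pointed_gset_category G) b c d h g;
          hgf = Cmp (pointed_gset_category G) a c d h gf;
          x0 = fob (reindex (labelled_trees G) a d hgf) x; h_x = fob (reindex (labelled_trees G) c d h) x;
          gh_x = fob (reindex (labelled_trees G) b c g) h_x; hg_x = fob (reindex (labelled_trees G) b d hg) x;
          x1 = fob (reindex (labelled_trees G) a b f) gh_x
        in Cmp (fibre (labelled_trees G) a) x0 (fob (reindex (labelled_trees G) a c gf) h_x) x1
            (opl_comp (labelled_trees G) a b c f g h_x) (opl_comp (labelled_trees G) a c d gf h x)
          = Cmp (fibre (labelled_trees G) a) x0 (fob (reindex (labelled_trees G) a b f) hg_x) x1
            (fmor (reindex (labelled_trees G) a b f) hg_x gh_x (opl_comp (labelled_trees G) b c d g h x))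
            (opl_comp (labelled_trees G) a b d f hg x)"
    by (auto simp: Let_def ltree_Cmp gtree_Cmp pullback_comp_eq intro!: compose_ext)
next
  fix a b :: "('a, 'l) gset" and f and x :: "('a, 'l) ltree"
  obtain A \<rho> B \<sigma> X \<chi> where abc [simp]: "a = (A, \<rho>)" "b = (B, \<sigma>)" "x = (X, \<chi>)"
    by (cases a; cases b; cases x)
  show "let f_x = fob (reindex (labelled_trees G) a b f) x
        in Cmp (fibre (labelled_trees G) a) f_x
            (fob (reindex (labelled_trees G) a a (Idt (pointed_gset_category G) a)) f_x) f_x
            (opl_unit (labelled_trees G) a f_x) (opl_comp (labelled_trees G) a a b (Idt (pointed_gset_category G) a) f x)
          = Idt (fibre (labelled_trees G) a) f_x"
    by (auto simp: Let_def ltree_Cmp gtree_Cmp ltree_Idt gtree_Idt pullback_comp_eq pullback_unit_eq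
      intro!: compose_eq_restrict)
  show "let f_x = fob (reindex (labelled_trees G) a b f) x;
            id_x = fob (reindex (labelled_trees G) b b (Idt (pointed_gset_category G) b)) x
        in Cmp (fibre (labelled_trees G) a) f_x (fob (reindex (labelled_trees G) a b f) id_x) f_x
            (fmor (reindex (labelled_trees G) a b f) id_x x (opl_unit (labelled_trees G) b x))
            (opl_comp (labelled_trees G) a b b f (Idt (pointed_gset_category G) b) x)
          = Idt (fibre (labelled_trees G) a) f_x"
    by (auto simp: Let_def ltree_Cmp gtree_Cmp ltree_Idt gtree_Idt pullback_comp_eq pullback_unit_eq
      intro!: compose_eq_restrict)
qed

end

section \<open>The equivalence\<close>

text \<open>Equations between parallel morphisms of C can be tested in D, so C inherits the unit
  laws and associativity. For the Grothendieck construction this replaces a calculation with the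
  oplax coherence laws.\<close>

lemma is_functor_of_faithful:
  assumes D: "category D"
    and Idt: "\<And>a. a \<in> Obj C \<Longrightarrow> Idt C a \<in> Arr C a a"
    and Cmp: "\<And>a b c f g. \<lbrakk>a \<in> Obj C; b \<in> Obj C; c \<in> Obj C; f \<in> Arr C a b; g \<in> Arr C b c\<rbrakk>
      \<Longrightarrow> Cmp C a b c g f \<in> Arr C a c"
    and ob: "\<And>a. a \<in> Obj C \<Longrightarrow> fob F a \<in> Obj D"
    and mor: "\<And>a b f. \<lbrakk>a \<in> Obj C; b \<in> Obj C; f \<in> Arr C a b\<rbrakk> \<Longrightarrow> fmor F a b f \<in> Arr D (fob F a) (fob F b)"
    and F_Idt: "\<And>a. a \<in> Obj C \<Longrightarrow> fmor F a a (Idt C a) = Idt D (fob F a)"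
    and F_Cmp: "\<And>a b c f g. \<lbrakk>a \<in> Obj C; b \<in> Obj C; c \<in> Obj C; f \<in> Arr C a b; g \<in> Arr C b c\<rbrakk>
      \<Longrightarrow> fmor F a c (Cmp C a b c g f)
        = Cmp D (fob F a) (fob F b) (fob F c) (fmor F b c g) (fmor F a b f)"
    and inj: "\<And>a b. \<lbrakk>a \<in> Obj C; b \<in> Obj C\<rbrakk> \<Longrightarrow> inj_on (fmor F a b) (Arr C a b)"
  shows "is_functor C D F"
proof -
  interpret D: category D by (rule D)
  have "category C"
  proof (rule category.intro[OF Idt Cmp])
    fix a b f assume o: "a \<in> Obj C" "b \<in> Obj C" "f \<in> Arr C a b"
    show "Cmp C a b b (Idt C b) f = f"
      by (rule inj_onD[OF inj[of a b]]) (simp_all add: o Cmp Idt F_Cmp F_Idt D.Idt_left ob mor)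
    show "Cmp C a a b f (Idt C a) = f"
      by (rule inj_onD[OF inj[of a b]]) (simp_all add: o Cmp Idt F_Cmp F_Idt D.Idt_right ob mor)
  next
    fix a b c d f g h
    assume o: "a \<in> Obj C" "b \<in> Obj C" "c \<in> Obj C" "d \<in> Obj C" "f \<in> Arr C a b" "g \<in> Arr C b c" "h \<in> Arr C c d"
    have gf: "Cmp C a b c g f \<in> Arr C a c" and hg: "Cmp C b c d h g \<in> Arr C b d" using o by (simp_all add: Cmp)
    show "Cmp C a c d h (Cmp C a b c g f) = Cmp C a b d (Cmp C b c d h g) f"
    proof (rule inj_onD[OF inj[of a d]])
      show "fmor F a d (Cmp C a c d h (Cmp C a b c g f)) = fmor F a d (Cmp C a b d (Cmp C b c d h g) f)"
        unfolding F_Cmp[OF o(1,3,4) gf o(7)] F_Cmp[OF o(1,2,4,5) hg] F_Cmp[OF o(1-3) o(5,6)] F_Cmp[OF o(2-4) o(6,7)]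
        using o by (intro D.Cmp_assoc ob mor)
    qed (use o gf hg in \<open>auto intro: Cmp\<close>)
  qed assumption+
  then show ?thesis
    using ob mor F_Idt F_Cmp by (intro is_functor.intro is_functor_axioms.intro D) assumption+
qed

text \<open>The inverse is built from a chosen section \<open>k\<close> of the object map. Since
  \<open>k (fob F a)\<close> has exactly the same image as \<open>a\<close>, the identity of that
  image lifts to morphisms in both directions between them; they are natural and mutually inverse
  because both can be checked after applying F.\<close>

lemma equivalence_of_fully_faithful:
  assumes F: "is_functor C D F"
    and ff: "\<And>a b. \<lbrakk>a \<in> Obj C; b \<in> Obj C\<rbrakk> \<Longrightarrow> bij_betw (fmor F a b) (Arr C a b) (Arr D (fob F a) (fob F b))"
    and surj: "\<And>d. d \<in> Obj D \<Longrightarrow> \<exists>c\<in>Obj C. fob F c = d"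
  shows "equivalence_of_categories C D F"
proof -
  interpret F: is_functor C D F by (rule F)
  obtain k where k: "\<And>d. d \<in> Obj D \<Longrightarrow> k d \<in> Obj C" "\<And>d. d \<in> Obj D \<Longrightarrow> fob F (k d) = d"
    using surj by metis
  define L where "L a b = the_inv_into (Arr C a b) (fmor F a b)" for a b
  have L: "L a b h \<in> Arr C a b" "fmor F a b (L a b h) = h"
    if "a \<in> Obj C" "b \<in> Obj C" "h \<in> Arr D (fob F a) (fob F b)" for a b h
    using bij_betw_the_inv_into[OF ff[OF that(1,2)]] f_the_inv_into_f_bij_betw[OF ff[OF that(1,2)]] that(3)
    by (auto simp: L_def bij_betw_def)
  have eqI: "f = g" if "a \<in> Obj C" "b \<in> Obj C" "f \<in> Arr C a b" "g \<in> Arr C a b" "fmor F a b f = fmor F a b g" for a b f g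
    using ff[OF that(1,2)] that(3-) by (auto simp: bij_betw_def dest: inj_onD)
  define K where "K = \<lparr>fob = k, fmor = (\<lambda>d e h. L (k d) (k e) h)\<rparr>"
  have LK: "L (k d) (k e) h \<in> Arr C (k d) (k e)" "fmor F (k d) (k e) (L (k d) (k e) h) = h"
    if "d \<in> Obj D" "e \<in> Obj D" "h \<in> Arr D d e" for d e h
    using L[of "k d" "k e" h] that by (simp_all add: k)
  have K: "is_functor D C K"
  proof (intro is_functor.intro is_functor_axioms.intro F.source.category_axioms F.target.category_axioms)
    fix d assume d: "d \<in> Obj D"
    show "fob K d \<in> Obj C" using d by (simp add: K_def k)
    show "fmor K d d (Idt D d) = Idt C (fob K d)"
      using d by (intro eqI[of "k d" "k d"]) (simp_all add: K_def k LK F.target.Idt_closed F.source.Idt_closed F.fmor_Idt)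
  next
    fix d e h assume "d \<in> Obj D" "e \<in> Obj D" "h \<in> Arr D d e"
    then show "fmor K d e h \<in> Arr C (fob K d) (fob K e)" by (simp add: K_def LK)
  next
    fix d e c h i assume o: "d \<in> Obj D" "e \<in> Obj D" "c \<in> Obj D" "h \<in> Arr D d e" "i \<in> Arr D e c"
    have ih: "Cmp D d e c i h \<in> Arr D d c" using o by (rule F.target.Cmp_closed)
    show "fmor K d c (Cmp D d e c i h) = Cmp C (fob K d) (fob K e) (fob K c) (fmor K e c i) (fmor K d e h)"
    proof (rule eqI[of "k d" "k c"])
      show "fmor F (k d) (k c) (fmor K d c (Cmp D d e c i h))
          = fmor F (k d) (k c) (Cmp C (fob K d) (fob K e) (fob K c) (fmor K e c i) (fmor K d e h))"
        using o ih by (simp add: K_def LK k F.fmor_Cmp)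
    qed (use o ih in \<open>simp_all add: K_def k LK F.source.Cmp_closed\<close>)
  qed
  let ?\<eta> = "\<lambda>a. L (k (fob F a)) a (Idt D (fob F a))"
  let ?\<theta> = "\<lambda>a. L a (k (fob F a)) (Idt D (fob F a))"
  have \<eta>: "?\<eta> a \<in> Arr C (k (fob F a)) a" "fmor F (k (fob F a)) a (?\<eta> a) = Idt D (fob F a)"
    "?\<theta> a \<in> Arr C a (k (fob F a))" "fmor F a (k (fob F a)) (?\<theta> a) = Idt D (fob F a)" if "a \<in> Obj C" for a
    using that L[of "k (fob F a)" a "Idt D (fob F a)"] L[of a "k (fob F a)" "Idt D (fob F a)"]
    by (simp_all add: k F.fob_closed F.target.Idt_closed)
  have "nat_trans C C (comp_fctr K F) id_fctr ?\<eta>"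
    unfolding nat_trans_def
  proof (intro conjI ballI)
    show "is_functor C C (comp_fctr K F)" by (rule comp_fctr_is_functor[OF F K])
    show "is_functor C C id_fctr" by (rule id_fctr_is_functor[OF F.source.category_axioms])
    show "?\<eta> a \<in> Arr C (fob (comp_fctr K F) a) (fob id_fctr a)" if "a \<in> Obj C" for a
      using \<eta>[OF that] by (simp add: comp_fctr_def id_fctr_def K_def)
    fix a b f assume o: "a \<in> Obj C" "b \<in> Obj C" "f \<in> Arr C a b"
    note o' = F.fob_closed[OF o(1)] F.fob_closed[OF o(2)] F.fmor_closed[OF o]
    note Kf = LK[OF o'] and ko = k(1)[OF o'(1)] k(1)[OF o'(2)] and \<eta>a = \<eta>[OF o(1)] and \<eta>b = \<eta>[OF o(2)]
    show "Cmp C (fob (comp_fctr K F) a) (fob (comp_fctr K F) b) (fob id_fctr b) (?\<eta> b) (fmor (comp_fctr K F) a b f)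
        = Cmp C (fob (comp_fctr K F) a) (fob id_fctr a) (fob id_fctr b) (fmor id_fctr a b f) (?\<eta> a)"
      unfolding comp_fctr_def id_fctr_def K_def fctr.simps
    proof (rule eqI[OF ko(1) o(2)])
      show "Cmp C (k (fob F a)) (k (fob F b)) b (?\<eta> b) (L (k (fob F a)) (k (fob F b)) (fmor F a b f)) \<in> Arr C (k (fob F a)) b"
        by (rule F.source.Cmp_closed[OF ko o(2) Kf(1) \<eta>b(1)])
      show "Cmp C (k (fob F a)) a b f (?\<eta> a) \<in> Arr C (k (fob F a)) b"
        by (rule F.source.Cmp_closed[OF ko(1) o(1,2) \<eta>a(1) o(3)])
      show "fmor F (k (fob F a)) b (Cmp C (k (fob F a)) (k (fob F b)) b (?\<eta> b) (L (k (fob F a)) (k (fob F b)) (fmor F a b f)))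
          = fmor F (k (fob F a)) b (Cmp C (k (fob F a)) a b f (?\<eta> a))"
        unfolding F.fmor_Cmp[OF ko o(2) Kf(1) \<eta>b(1)] F.fmor_Cmp[OF ko(1) o(1,2) \<eta>a(1) o(3)]
        using o o' by (simp add: k Kf \<eta>a \<eta>b F.target.Idt_left F.target.Idt_right)
    qed
  qed
  moreover have "is_iso C (fob (comp_fctr K F) a) (fob id_fctr a) (?\<eta> a)" if a: "a \<in> Obj C" for a
  proof -
    note a' = F.fob_closed[OF a] and \<eta>a = \<eta>[OF a]
    note ka = k(1)[OF a']
    have "Cmp C (k (fob F a)) a (k (fob F a)) (?\<theta> a) (?\<eta> a) = Idt C (k (fob F a))"
    proof (rule eqI[OF ka ka])
      show "Cmp C (k (fob F a)) a (k (fob F a)) (?\<theta> a) (?\<eta> a) \<in> Arr C (k (fob F a)) (k (fob F a))"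
        by (rule F.source.Cmp_closed[OF ka a ka \<eta>a(1,3)])
    qed (use F.fmor_Cmp[OF ka a ka \<eta>a(1,3)] a' ka in
        \<open>simp_all add: \<eta>a(2,4) k F.fmor_Idt F.source.Idt_closed F.target.Idt_left F.target.Idt_closed\<close>)
    moreover have "Cmp C a (k (fob F a)) a (?\<eta> a) (?\<theta> a) = Idt C a"
    proof (rule eqI[OF a a])
      show "Cmp C a (k (fob F a)) a (?\<eta> a) (?\<theta> a) \<in> Arr C a a"
        by (rule F.source.Cmp_closed[OF a ka a \<eta>a(3,1)])
    qed (use F.fmor_Cmp[OF a ka a \<eta>a(3,1)] a a' in
        \<open>simp_all add: \<eta>a(2,4) k F.fmor_Idt F.source.Idt_closed F.target.Idt_left F.target.Idt_closed\<close>)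
    ultimately show ?thesis
      using \<eta>a unfolding is_iso_def comp_fctr_def id_fctr_def K_def fctr.simps by blast
  qed
  ultimately have 1: "nat_isomorphic C C (comp_fctr K F) id_fctr"
    unfolding nat_isomorphic_def by blast
  \<comment> \<open>The section makes F K the identity on objects and morphisms of D, so identity
    components suffice.\<close>
  have "nat_trans D D (comp_fctr F K) id_fctr (Idt D)"
    unfolding nat_trans_def
  proof (intro conjI ballI)
    show "is_functor D D (comp_fctr F K)" by (rule comp_fctr_is_functor[OF K F])
    show "is_functor D D id_fctr" by (rule id_fctr_is_functor[OF F.target.category_axioms])
  qed (simp_all add: comp_fctr_def id_fctr_def K_def k LK F.target.Idt_closed F.target.Idt_left F.target.Idt_right)
  moreover have "is_iso D (fob (comp_fctr F K) d) (fob id_fctr d) (Idt D d)" if "d \<in> Obj D" for d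
    unfolding is_iso_def comp_fctr_def id_fctr_def K_def fctr.simps k(2)[OF that]
    using that F.target.Idt_closed F.target.Idt_left by blast
  ultimately have 2: "nat_isomorphic D D (comp_fctr F K) id_fctr"
    unfolding nat_isomorphic_def by blast
  show ?thesis unfolding equivalence_of_categories_def using F K 1 2 by blast
qed

section \<open>The Grothendieck construction: closure under identities and composition\<close>

context oplax_functor
begin

lemma grothendieck_Idt_closed:
  assumes "p \<in> Obj (grothendieck A F)"
  shows "Idt (grothendieck A F) p \<in> Arr (grothendieck A F) p p"
  using assms opl_unit_nat base.Idt_closed
  by (auto simp: grothendieck_def nat_trans_def id_fctr_def)

lemma grothendieck_Cmp_closed:
  assumes "p \<in> Obj (grothendieck A F)" "q \<in> Obj (grothendieck A F)" "r \<in> Obj (grothendieck A F)"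
    and "s \<in> Arr (grothendieck A F) p q" "t \<in> Arr (grothendieck A F) q r"
  shows "Cmp (grothendieck A F) p q r t s \<in> Arr (grothendieck A F) p r"
proof -
  obtain a x b y c z f \<alpha> g \<beta> where eq: "p = (a, x)" "q = (b, y)" "r = (c, z)" "s = (f, \<alpha>)" "t = (g, \<beta>)"
    by (cases p; cases q; cases r; cases s; cases t)
  have o: "a \<in> Obj A" "b \<in> Obj A" "c \<in> Obj A" and
    x: "x \<in> Obj (fibre F a)" and y: "y \<in> Obj (fibre F b)" and z: "z \<in> Obj (fibre F c)"
    and f: "f \<in> Arr A b a" and \<alpha>: "\<alpha> \<in> Arr (fibre F b) (fob (reindex F b a f) x) y"
    and g: "g \<in> Arr A c b" and \<beta>: "\<beta> \<in> Arr (fibre F c) (fob (reindex F c b g) y) z"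
    using assms by (simp_all add: eq grothendieck_def)
  interpret C: category "fibre F c" by (rule fibre_category[OF o(3)])
  interpret f: is_functor "fibre F a" "fibre F b" "reindex F b a f" by (rule reindex_functor[OF o(2,1) f])
  interpret g: is_functor "fibre F b" "fibre F c" "reindex F c b g" by (rule reindex_functor[OF o(3,2) g])
  have fg: "Cmp A c b a f g \<in> Arr A c a" by (rule base.Cmp_closed[OF o(3,2,1) g f])
  interpret fg: is_functor "fibre F a" "fibre F c" "reindex F c a (Cmp A c b a f g)" by (rule reindex_functor[OF o(3,1) fg])
  have "opl_comp F c b a g f x \<in> Arr (fibre F c) (fob (reindex F c a (Cmp A c b a f g)) x)
      (fob (reindex F c b g) (fob (reindex F b a f) x))"
    using opl_comp_nat[OF o(3,2,1) g f] x by (simp add: nat_trans_def comp_fctr_def)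
  moreover have "fmor (reindex F c b g) (fob (reindex F b a f) x) y \<alpha>
      \<in> Arr (fibre F c) (fob (reindex F c b g) (fob (reindex F b a f) x)) (fob (reindex F c b g) y)"
    by (rule g.fmor_closed[OF f.fob_closed[OF x] y \<alpha>])
  ultimately have "Cmp (fibre F c) (fob (reindex F c a (Cmp A c b a f g)) x) (fob (reindex F c b g) y) z \<beta>
      (Cmp (fibre F c) (fob (reindex F c a (Cmp A c b a f g)) x) (fob (reindex F c b g) (fob (reindex F b a f) x)) (fob (reindex F c b g) y)
        (fmor (reindex F c b g) (fob (reindex F b a f) x) y \<alpha>) (opl_comp F c b a g f x))
    \<in> Arr (fibre F c) (fob (reindex F c a (Cmp A c b a f g)) x) z"
    by (intro C.Cmp_closed[OF fg.fob_closed[OF x] g.fob_closed[OF y] z _ \<beta>]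
        C.Cmp_closed[OF fg.fob_closed[OF x] g.fob_closed[OF f.fob_closed[OF x]] g.fob_closed[OF y]])
  then show ?thesis using fg by (simp add: eq grothendieck_def Let_def)
qed

end

section \<open>Restriction to the old edges is fully faithful\<close>

definition forget_labels ::
  "(('g, 'a) gset \<times> ('g, 'a) ltree, ('a option \<Rightarrow> 'a option) \<times> 'a gtree_arr, ('g, 'a) gtree, 'a gtree_arr) fctr" where
  "forget_labels = \<lparr>fob = (\<lambda>p. fst (snd p)),
     fmor = (\<lambda>p q h. \<lambda>_. \<lambda>e\<in>edge_set (the_tree (fst (snd p))). snd h () (Old e))\<rparr>"

lemma forget_labels_simps [simp]:
  "fob forget_labels (a, (X, \<chi>)) = X"
  "fmor forget_labels (a, (X, \<chi>)) q (\<phi>, \<alpha>) = (\<lambda>_. \<lambda>e\<in>edge_set (the_tree X). \<alpha> () (Old e))"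
  by (simp_all add: forget_labels_def)

lemma (in grafting) Old_below_root: "e \<in> edge_set T \<Longrightarrow> (Old e, Old (root_edge T)) \<in> (child S)\<^sup>*"
  by (intro child_rtrancl_Old tree_reach_root tree)

text \<open>A leaf \<open>b\<close> of the target lies below the image of at most one leaf \<open>a\<close> of the source; \<open>\<phi>\<close> has
  to send \<open>b\<close> to this \<open>a\<close>, and to the base point if there is none.\<close>

lemma (in grafting) label_iff:
  assumes R: "is_tree R" and \<alpha>: "\<alpha> \<in> Arr dendroidal S R" and a: "a \<in> A" and b: "b \<in> B"
  shows "\<phi> (Some b) = Some a \<longleftrightarrow> (\<alpha> (New b), \<alpha> (Old (\<chi> a))) \<in> (child R)\<^sup>*"
proof -
  have below: "(\<alpha> (New b), \<alpha> (Old (\<chi> c))) \<in> (child R)\<^sup>*" if "\<phi> (Some b) = Some c" "c \<in> A" for c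
  proof -
    have "New b \<in> New ` fibre_over B \<phi> (Some c)" using b that by simp
    from arr_mono[OF graft_is_tree R \<alpha> cut_below[OF cut_New[OF that(2)] this]] show ?thesis .
  qed
  show ?thesis
  proof
    show "(\<alpha> (New b), \<alpha> (Old (\<chi> a))) \<in> (child R)\<^sup>*" if "\<phi> (Some b) = Some a" using below[OF that a] .
    assume le: "(\<alpha> (New b), \<alpha> (Old (\<chi> a))) \<in> (child R)\<^sup>*"
    show "\<phi> (Some b) = Some a"
    proof (cases "\<phi> (Some b)")
      case None
      \<comment> \<open>\<open>New b\<close> and the old root are distinct inputs of the base
        corolla, so their images are distinct and incomparable, whereas \<open>le\<close> places the
        first below the second.\<close>
      note c = arr_cut[OF graft_is_tree R \<alpha> cut_Base]
      have "(\<alpha> (Old (\<chi> a)), \<alpha> (Old (root_edge T))) \<in> (child R)\<^sup>*"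
        using arr_mono[OF graft_is_tree R \<alpha>] Old_below_root label_leaf[OF a] by blast
      with le have le': "(\<alpha> (New b), \<alpha> (Old (root_edge T))) \<in> (child R)\<^sup>*" by (rule rtrancl_trans)
      have i: "New b \<in> insert (Old (root_edge T)) (New ` fibre_over B \<phi> None)"
        "Old (root_edge T) \<in> insert (Old (root_edge T)) (New ` fibre_over B \<phi> None)" using None b by auto
      have "\<alpha> (New b) = \<alpha> (Old (root_edge T))"
        by (rule cut_antichain[OF R conjunct1[OF c] imageI[OF i(1)] imageI[OF i(2)] le'])
      from inj_onD[OF conjunct2[OF c] this i] show ?thesis by simp
    next
      case (Some a')
      then have a': "a' \<in> A" using pt[OF b] by simp
      \<comment> \<open>The images of both leaves lie above that of \<open>New b\<close> and are
        thus comparable. As the leaves of T form one cut, on which \<alpha> is injective, they must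
        agree.\<close>
      note c = arr_cut[OF graft_is_tree R \<alpha> cut_Old[OF cut_all_leaves[OF tree]]]
      have l: "Old (\<chi> d) \<in> Old ` leaves T" if "d \<in> A" for d
        using label_leaf[OF that] by (simp add: leaves_def)
      have "(\<alpha> (Old (\<chi> a)), \<alpha> (Old (\<chi> a'))) \<in> (child R)\<^sup>* \<or> (\<alpha> (Old (\<chi> a')), \<alpha> (Old (\<chi> a))) \<in> (child R)\<^sup>*"
        by (rule tree_comparable[OF R le below[OF Some a']])
      then have "\<alpha> (Old (\<chi> a)) = \<alpha> (Old (\<chi> a'))"
        using cut_antichain[OF R conjunct1[OF c] imageI[OF l[OF a]] imageI[OF l[OF a']]]
          cut_antichain[OF R conjunct1[OF c] imageI[OF l[OF a']] imageI[OF l[OF a]]] by fastforce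
      from inj_onD[OF conjunct2[OF c] this l[OF a] l[OF a']] have "\<chi> a = \<chi> a'" by simp
      with Some a a' show ?thesis using bij by (auto simp: bij_betw_def dest: inj_onD)
    qed
  qed
qed

context group
begin

lemma ltree_ArrD:
  assumes "f \<in> Arr (ltree_category G (A, \<rho>)) x y"
  shows "f \<in> Arr (gtree_category G) (fst x) (fst y)"
    "f () (root_edge (the_tree (fst x))) = root_edge (the_tree (fst y))"
    "a \<in> A \<Longrightarrow> f () (snd x a) = snd y a"
  using assms by (cases x; cases y; simp add: ltree_Arr_iff)+

lemma forget_labels_arr:
  assumes x: "(X, \<chi>) \<in> Obj (ltree_category G (A, \<rho>))" and y: "(Y, \<xi>) \<in> Obj (ltree_category G (B, \<sigma>))"
    and B: "(B, \<sigma>) \<in> Obj (pointed_gset_category G)"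
    and \<phi>: "\<phi> \<in> Arr (pointed_gset_category G) (B, \<sigma>) (A, \<rho>)"
    and \<alpha>: "\<alpha> \<in> Arr (ltree_category G (B, \<sigma>)) (pullback_tree (B, \<sigma>) (A, \<rho>) \<phi> (X, \<chi>)) (Y, \<xi>)"
  shows "(\<lambda>_. \<lambda>e\<in>edge_set (the_tree X). \<alpha> () (Old e)) \<in> Arr (gtree_category G) X Y"
proof -
  interpret S: grafting B A \<phi> "the_tree X" \<chi> by (rule grafting_of_ltree[OF x \<phi> B])
  have X: "X \<in> Obj (gtree_category G)" and Y: "Y \<in> Obj (gtree_category G)" using x y by (simp_all add: ltree_Obj_iff)
  have \<alpha>': "\<alpha> \<in> Arr (gtree_category G) (fst (pullback_tree (B, \<sigma>) (A, \<rho>) \<phi> (X, \<chi>))) Y"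
    using ltree_ArrD(1)[OF \<alpha>] by simp
  note \<alpha>D = gtree_ArrD[OF \<alpha>', unfolded pullback_tree_simps]
  have "compose (edge_set (the_tree X)) (\<alpha> ()) (\<lambda>e\<in>edge_set (the_tree X). Old e) \<in> Arr dendroidal (the_tree X) (the_tree Y)"
    using category.Cmp_closed[OF dendroidal_category _ _ _ S.Old_arr \<alpha>D(1)] S.tree S.graft_is_tree gtree_is_tree[OF Y] by simp
  moreover have "compose (edge_set (the_tree X)) (\<alpha> ()) (\<lambda>e\<in>edge_set (the_tree X). Old e)
      = (\<lambda>e\<in>edge_set (the_tree X). \<alpha> () (Old e))"
    by (rule compose_eq_restrict) simp
  moreover have "\<alpha> () (Old (act X g e)) = act Y g (\<alpha> () (Old e))" if "g \<in> carrier G" "e \<in> edge_set (the_tree X)" for g e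
    using \<alpha>D(3)[OF that(1), of "Old e"] that(2) by simp
  ultimately show ?thesis using X Y by (simp add: gtree_Arr_iff act_edge)
qed

text \<open>On new leaves and on the base the values are prescribed by the labels and the root of
  \<open>Y\<close>, so only \<open>\<phi>\<close> remains to be recovered. By
  \<open>label_iff\<close> it depends only on these labels and on the values at old edges.\<close>

lemma forget_labels_inj:
  assumes A: "(A, \<rho>) \<in> Obj (pointed_gset_category G)" and B: "(B, \<sigma>) \<in> Obj (pointed_gset_category G)"
    and x: "(X, \<chi>) \<in> Obj (ltree_category G (A, \<rho>))" and y: "(Y, \<xi>) \<in> Obj (ltree_category G (B, \<sigma>))"
    and \<phi>: "\<phi> \<in> Arr (pointed_gset_category G) (B, \<sigma>) (A, \<rho>)"
    and \<alpha>: "\<alpha> \<in> Arr (ltree_category G (B, \<sigma>)) (pullback_tree (B, \<sigma>) (A, \<rho>) \<phi> (X, \<chi>)) (Y, \<xi>)"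
    and \<psi>: "\<psi> \<in> Arr (pointed_gset_category G) (B, \<sigma>) (A, \<rho>)"
    and \<beta>: "\<beta> \<in> Arr (ltree_category G (B, \<sigma>)) (pullback_tree (B, \<sigma>) (A, \<rho>) \<psi> (X, \<chi>)) (Y, \<xi>)"
    and eq: "\<And>e. e \<in> edge_set (the_tree X) \<Longrightarrow> \<alpha> () (Old e) = \<beta> () (Old e)"
  shows "\<phi> = \<psi> \<and> \<alpha> = \<beta>"
proof -
  have "Y \<in> Obj (gtree_category G)" using y by (simp add: ltree_Obj_iff)
  note Y = gtree_is_tree[OF this]
  have facts: "\<alpha> \<in> Arr (gtree_category G) (fst (pullback_tree (B, \<sigma>) (A, \<rho>) \<phi> (X, \<chi>))) Y"
    "\<alpha> () Base = root_edge (the_tree Y)" "\<And>b. b \<in> B \<Longrightarrow> \<alpha> () (New b) = \<xi> b"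
    "\<alpha> () \<in> Arr dendroidal (graft B A \<phi> (the_tree X) \<chi>) (the_tree Y)"
    if "\<alpha> \<in> Arr (ltree_category G (B, \<sigma>)) (pullback_tree (B, \<sigma>) (A, \<rho>) \<phi> (X, \<chi>)) (Y, \<xi>)" for \<phi> \<alpha>
  proof -
    note \<alpha>' = that
    show *: "\<alpha> \<in> Arr (gtree_category G) (fst (pullback_tree (B, \<sigma>) (A, \<rho>) \<phi> (X, \<chi>))) Y"
      using ltree_ArrD(1)[OF that] by simp
    from gtree_ArrD(1)[OF *] show "\<alpha> () \<in> Arr dendroidal (graft B A \<phi> (the_tree X) \<chi>) (the_tree Y)" by simp
    show "\<alpha> () Base = root_edge (the_tree Y)" using ltree_ArrD(2)[OF that] by simp
    show "\<alpha> () (New b) = \<xi> b" if "b \<in> B" for b using ltree_ArrD(3)[OF \<alpha>' that] that by simp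
  qed
  note fa = facts[OF \<alpha>] and fb = facts[OF \<beta>]
  interpret S: grafting B A \<phi> "the_tree X" \<chi> by (rule grafting_of_ltree[OF x \<phi> B])
  interpret S': grafting B A \<psi> "the_tree X" \<chi> by (rule grafting_of_ltree[OF x \<psi> B])
  have same: "\<phi> (Some b) = Some a \<longleftrightarrow> \<psi> (Some b) = Some a" if "a \<in> A" "b \<in> B" for a b
    using S.label_iff[OF Y fa(4) that] S'.label_iff[OF Y fb(4) that] fa(3) fb(3) that eq S.label_leaf by simp
  have Some: "\<phi> (Some b) = \<psi> (Some b)" if "b \<in> B" for b
  proof (cases "\<phi> (Some b)")
    case None
    show ?thesis
    proof (cases "\<psi> (Some b)")
      case (Some a)
      then have "a \<in> A" using S'.pt[OF that] by simp
      from same[OF this that] Some None show ?thesis by simp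
    qed (simp add: None)
  next
    case (Some a)
    then have "a \<in> A" using S.pt[OF that] by simp
    from same[OF this that] Some show ?thesis by simp
  qed
  have "\<phi> = \<psi>"
  proof (rule extensionalityI)
    show "\<phi> \<in> extensional (pointed B)" "\<psi> \<in> extensional (pointed B)"
      using \<phi> \<psi> unfolding gset_Arr_iff PiE_def by blast+
    fix u assume "u \<in> pointed B"
    moreover have "\<phi> None = None" "\<psi> None = None" using \<phi> \<psi> unfolding gset_Arr_iff by blast+
    ultimately show "\<phi> u = \<psi> u" using Some by (cases u) simp_all
  qed
  moreover have "\<alpha> = \<beta>"
    by (rule gtree_arr_eqI[OF fa(1) fb(1)[folded \<open>\<phi> = \<psi>\<close>]]) (use eq fa(2,3) fb(2,3) in auto)
  ultimately show ?thesis by blast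
qed

text \<open>The extension is a morphism because two cuts are available in the target: all leaves
  below the image of a leaf, and the image of the root together with all leaves not below it.
  Equivariance of \<open>\<phi>\<close> follows since the group acts by monotone maps.\<close>

lemma forget_labels_surj:
  assumes A: "(A, \<rho>) \<in> Obj (pointed_gset_category G)" and B: "(B, \<sigma>) \<in> Obj (pointed_gset_category G)"
    and x: "(X, \<chi>) \<in> Obj (ltree_category G (A, \<rho>))" and y: "(Y, \<xi>) \<in> Obj (ltree_category G (B, \<sigma>))"
    and f: "f \<in> Arr (gtree_category G) X Y"
  obtains \<phi> \<alpha> where "\<phi> \<in> Arr (pointed_gset_category G) (B, \<sigma>) (A, \<rho>)"
    "\<alpha> \<in> Arr (ltree_category G (B, \<sigma>)) (pullback_tree (B, \<sigma>) (A, \<rho>) \<phi> (X, \<chi>)) (Y, \<xi>)"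
    "\<And>e. e \<in> edge_set (the_tree X) \<Longrightarrow> \<alpha> () (Old e) = f () e"
proof -
  have XO: "X \<in> Obj (gtree_category G)" and YO: "Y \<in> Obj (gtree_category G)"
    and \<chi>: "bij_betw \<chi> A (leaves (the_tree X))" "\<And>g a. g \<in> carrier G \<Longrightarrow> a \<in> A \<Longrightarrow> \<chi> (\<rho> g a) = act X g (\<chi> a)"
    and \<xi>: "bij_betw \<xi> B (leaves (the_tree Y))" "\<And>g b. g \<in> carrier G \<Longrightarrow> b \<in> B \<Longrightarrow> \<xi> (\<sigma> g b) = act Y g (\<xi> b)"
    using x y by (simp_all add: ltree_Obj_iff)
  note X = gtree_is_tree[OF XO] and Y = gtree_is_tree[OF YO] and fD = gtree_ArrD[OF f]
  interpret A: group_action G A \<rho> using A by (simp add: gset_Obj_iff)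
  interpret B: group_action G B \<sigma> using B by (simp add: gset_Obj_iff)
  have \<rho>A: "\<rho> g a \<in> A" if "g \<in> carrier G" "a \<in> A" for g a using A.element_image[OF that] by blast
  have \<sigma>B: "\<sigma> g b \<in> B" if "g \<in> carrier G" "b \<in> B" for g b using B.element_image[OF that] by blast
  have \<sigma>inv: "\<sigma> (inv g) (\<sigma> g b) = b" if "g \<in> carrier G" "b \<in> B" for g b using B.orbit_sym_aux[OF that] by blast
  note \<chi>e = ltree_label[OF x] and \<xi>e = ltree_label[OF y]
  let ?le = "\<lambda>d e. (d, e) \<in> (child (the_tree Y))\<^sup>*"
  let ?r = "root_edge (the_tree X)"
  note c = arr_cut[OF X Y fD(1) cut_all_leaves[OF X]]
  have uniq: "a = a'" if "a \<in> A" "a' \<in> A" "?le (\<xi> b) (f () (\<chi> a))" "?le (\<xi> b) (f () (\<chi> a'))" for a a' b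
  proof -
    note l = imageI[OF \<chi>e(1)[OF that(1)], of "f ()"] and l' = imageI[OF \<chi>e(1)[OF that(2)], of "f ()"]
    have "f () (\<chi> a) = f () (\<chi> a')"
      using tree_comparable[OF Y that(3,4)] cut_antichain[OF Y conjunct1[OF c] l l'] cut_antichain[OF Y conjunct1[OF c] l' l]
      by fastforce
    from inj_onD[OF conjunct2[OF c] this \<chi>e(1)[OF that(1)] \<chi>e(1)[OF that(2)]]
    show ?thesis using \<chi>(1) that(1,2) by (auto simp: bij_betw_def dest: inj_onD)
  qed
  \<comment> \<open>The images of the leaves of X form a cut at the image of the root, and a cut
    covers all leaves below its root.\<close>
  have cover: "(\<exists>a\<in>A. ?le (\<xi> b) (f () (\<chi> a))) \<longleftrightarrow> ?le (\<xi> b) (f () ?r)" if b: "b \<in> B" for b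
  proof
    assume "\<exists>a\<in>A. ?le (\<xi> b) (f () (\<chi> a))"
    then obtain a where "a \<in> A" "?le (\<xi> b) (f () (\<chi> a))" by blast
    moreover have "?le (f () (\<chi> a)) (f () ?r)"
      using arr_mono[OF X Y fD(1) tree_reach_root[OF X \<chi>e(2)]] \<open>a \<in> A\<close> by blast
    ultimately show "?le (\<xi> b) (f () ?r)" by (meson rtrancl_trans)
  next
    assume "?le (\<xi> b) (f () ?r)"
    then obtain m where "m \<in> leaves (the_tree X)" "?le (\<xi> b) (f () m)"
      using cut_covers[OF conjunct1[OF c] \<xi>e(1)[OF b]] by blast
    moreover from this(1) obtain a where "a \<in> A" "m = \<chi> a" using \<chi>(1) by (auto simp: bij_betw_def)
    ultimately show "\<exists>a\<in>A. ?le (\<xi> b) (f () (\<chi> a))" by blast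
  qed
  \<comment> \<open>By uniq the choice is made from a set with one element; only the
    characterisations \<open>\<phi>_Some\<close> and \<open>\<phi>_None\<close> are used to handle
    the values on B.\<close>
  define \<phi> where "\<phi> = (\<lambda>u\<in>pointed B. case u of None \<Rightarrow> None | Some b \<Rightarrow>
    if \<exists>a\<in>A. ?le (\<xi> b) (f () (\<chi> a)) then Some (SOME a. a \<in> A \<and> ?le (\<xi> b) (f () (\<chi> a))) else None)"
  have \<phi>_Some: "\<phi> (Some b) = Some a \<longleftrightarrow> a \<in> A \<and> ?le (\<xi> b) (f () (\<chi> a))" if b: "b \<in> B" for a b
  proof (cases "\<exists>a\<in>A. ?le (\<xi> b) (f () (\<chi> a))")
    case True
    define d where "d = (SOME a. a \<in> A \<and> ?le (\<xi> b) (f () (\<chi> a)))"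
    have "\<exists>a. a \<in> A \<and> ?le (\<xi> b) (f () (\<chi> a))" using True by blast
    then have d: "d \<in> A \<and> ?le (\<xi> b) (f () (\<chi> d))" unfolding d_def by (rule someI_ex)
    have "\<phi> (Some b) = Some d"
      unfolding \<phi>_def d_def using b True by (simp only: restrict_apply pointed_simps option.case if_True)
    then have "\<phi> (Some b) = Some a \<longleftrightarrow> a = d" by auto
    also have "\<dots> \<longleftrightarrow> a \<in> A \<and> ?le (\<xi> b) (f () (\<chi> a))"
    proof
      show "a \<in> A \<and> ?le (\<xi> b) (f () (\<chi> a))" if "a = d" using d unfolding that .
      show "a = d" if "a \<in> A \<and> ?le (\<xi> b) (f () (\<chi> a))"
        by (rule uniq[OF conjunct1[OF that] conjunct1[OF d] conjunct2[OF that] conjunct2[OF d]])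
    qed
    finally show ?thesis .
  next
    case False
    then have "\<phi> (Some b) = None" using b by (simp add: \<phi>_def)
    with False show ?thesis by auto
  qed
  have \<phi>_None: "\<phi> (Some b) = None \<longleftrightarrow> \<not> ?le (\<xi> b) (f () ?r)" if "b \<in> B" for b
    using \<phi>_Some[OF that] cover[OF that] by (cases "\<phi> (Some b)") auto
  have le_act: "?le (\<xi> (\<sigma> g b)) (f () (\<chi> (\<rho> g a)))" if "g \<in> carrier G" "b \<in> B" "a \<in> A" "?le (\<xi> b) (f () (\<chi> a))" for g a b
    using arr_mono[OF Y Y act_arr[OF YO that(1)] that(4)]
    by (simp add: \<xi>(2)[OF that(1,2)] \<chi>(2)[OF that(1,3)] fD(3)[OF that(1) \<chi>e(2)[OF that(3)]])
  have \<phi>: "\<phi> \<in> Arr (pointed_gset_category G) (B, \<sigma>) (A, \<rho>)"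
    unfolding gset_Arr_iff
  proof (intro conjI ballI)
    show "\<phi> \<in> pointed B \<rightarrow>\<^sub>E pointed A"
    proof (rule PiE_I)
      fix u assume u: "u \<in> pointed B"
      show "\<phi> u \<in> pointed A"
      proof (cases u)
        case None
        then show ?thesis by (simp add: \<phi>_def)
      next
        case (Some b)
        then have b: "b \<in> B" using u by simp
        show ?thesis
        proof (cases "\<phi> u")
          case (Some a)
          then have "a \<in> A" using \<phi>_Some[OF b] \<open>u = Some b\<close> by blast
          with Some show ?thesis by simp
        qed simp
      qed
    qed (simp add: \<phi>_def)
    show "\<phi> None = None" by (simp add: \<phi>_def)
    fix g b assume g: "g \<in> carrier G" and b: "b \<in> B"
    show "\<phi> (Some (\<sigma> g b)) = map_option (\<rho> g) (\<phi> (Some b))"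
    proof (cases "\<phi> (Some b)")
      case None
      \<comment> \<open>A label assigned to the translate of b would be carried back by the inverse
        of g to a label assigned to b.\<close>
      have "\<phi> (Some (\<sigma> g b)) = None"
      proof (cases "\<phi> (Some (\<sigma> g b))")
        case (Some a)
        then have "a \<in> A" "?le (\<xi> (\<sigma> g b)) (f () (\<chi> a))" using \<phi>_Some[OF \<sigma>B[OF g b]] by auto
        from le_act[OF inv_closed[OF g] \<sigma>B[OF g b] this] have "\<phi> (Some b) = Some (\<rho> (inv g) a)"
          using \<phi>_Some[OF b] \<rho>A[OF inv_closed[OF g] \<open>a \<in> A\<close>] by (simp add: \<sigma>inv[OF g b])
        with None show ?thesis by simp
      qed
      with None show ?thesis by simp
    next
      case (Some a)
      then have "a \<in> A" "?le (\<xi> b) (f () (\<chi> a))" using \<phi>_Some[OF b] by auto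
      from le_act[OF g b this] have "\<phi> (Some (\<sigma> g b)) = Some (\<rho> g a)"
        using \<phi>_Some[OF \<sigma>B[OF g b]] \<rho>A[OF g \<open>a \<in> A\<close>] by blast
      with Some show ?thesis by simp
    qed
  qed
  interpret S: grafting B A \<phi> "the_tree X" \<chi> by (rule grafting_of_ltree[OF x \<phi> B])
  let ?\<alpha> = "\<lambda>e\<in>edge_set S.S. case e of Old d \<Rightarrow> f () d | New b \<Rightarrow> \<xi> b | Base \<Rightarrow> root_edge (the_tree Y) | Atom _ \<Rightarrow> undefined"
  have New: "(\<lambda>b. ?\<alpha> (New b)) ` fibre_over B \<phi> y = \<xi> ` fibre_over B \<phi> y" for y by (rule image_cong) simp_all
  have leaves: "leaves (the_tree Y) = \<xi> ` B" using \<xi>(1) by (simp add: bij_betw_def)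
  have "?\<alpha> \<in> Arr dendroidal S.S (the_tree Y)"
  proof (rule S.graft_arrI[OF Y])
    show "?\<alpha> \<in> edge_set S.S \<rightarrow>\<^sub>E edge_set (the_tree Y)" using fD(2) \<xi>e(2) tree_root(1)[OF Y] by auto
    have "(\<lambda>e\<in>edge_set (the_tree X). ?\<alpha> (Old e)) = f ()"
      by (rule extensionalityI[OF _ fD(4)]) simp_all
    then show "(\<lambda>e\<in>edge_set (the_tree X). ?\<alpha> (Old e)) \<in> Arr dendroidal (the_tree X) (the_tree Y)"
      using fD(1) by simp
    show "inj_on (\<lambda>b. ?\<alpha> (New b)) B" using \<xi>(1) by (simp add: bij_betw_def inj_on_def)
    show "is_cut (the_tree Y) (?\<alpha> (Old (\<chi> a))) ((\<lambda>b. ?\<alpha> (New b)) ` fibre_over B \<phi> (Some a))" if a: "a \<in> A" for a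
    proof -
      have "{l \<in> leaves (the_tree Y). ?le l (f () (\<chi> a))} = \<xi> ` fibre_over B \<phi> (Some a)"
        unfolding leaves using \<phi>_Some a by auto
      with cut_leaves[OF Y fD(2)[OF \<chi>e(2)[OF a]]] show ?thesis unfolding New using \<chi>e(2)[OF a] by simp
    qed
    have r: "?r \<in> edge_set (the_tree X)" by (rule tree_root(1)[OF X])
    \<comment> \<open>These are exactly the leaves in the complementary cut at the image of the
      root, so \<open>cut_complement\<close> provides the image of the base corolla.\<close>
    have "{l \<in> leaves (the_tree Y). \<not> ?le l (f () ?r)} = \<xi> ` fibre_over B \<phi> None"
      unfolding leaves using \<phi>_None by auto
    with cut_complement[OF Y fD(2)[OF r]]
    show "is_cut (the_tree Y) (?\<alpha> Base) (insert (?\<alpha> (Old ?r)) ((\<lambda>b. ?\<alpha> (New b)) ` fibre_over B \<phi> None))"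
      unfolding New using r by simp
    show "?\<alpha> (New b) \<noteq> ?\<alpha> (Old ?r)" if "b \<in> fibre_over B \<phi> None" for b
      using that \<phi>_None[of b] r by auto
  qed
  moreover have "?\<alpha> (act (fst (pullback_tree (B, \<sigma>) (A, \<rho>) \<phi> (X, \<chi>))) g e) = act Y g (?\<alpha> e)"
    if g: "g \<in> carrier G" and e: "e \<in> edge_set S.S" for g e
  proof -
    from e consider d where "e = Old d" "d \<in> edge_set (the_tree X)" | b where "e = New b" "b \<in> B" | "e = Base"
      by auto
    then show ?thesis
      by cases (simp_all add: act_edge[OF XO g] fD(3)[OF g] \<sigma>B[OF g] \<xi>(2)[OF g] act_root[OF YO g])
  qed
  ultimately have "(\<lambda>_. ?\<alpha>) \<in> Arr (ltree_category G (B, \<sigma>)) (pullback_tree (B, \<sigma>) (A, \<rho>) \<phi> (X, \<chi>)) (Y, \<xi>)"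
    by (intro ltree_ArrI' pullback_tree_Obj[OF x A B \<phi>] y) simp_all
  from that[OF \<phi> this] show thesis by simp
qed

text \<open>An infinite type has finite subsets of every size, so the leaves, whatever names they
  carry, can be put in bijection with a set of labels. The action on labels is transported from the
  leaves, which the group permutes.\<close>

lemma exists_labelling:
  assumes X: "X \<in> Obj (gtree_category G :: (('a, 'l::infinite) gtree, 'l gtree_arr) cat)"
  obtains A :: "'l::infinite set" and \<rho> \<chi> where "(A, \<rho>) \<in> Obj (pointed_gset_category G)"
    "(X, \<chi>) \<in> Obj (ltree_category G (A, \<rho>))"
proof -
  let ?L = "leaves (the_tree X)"
  have LE: "?L \<subseteq> edge_set (the_tree X)" by (auto simp: leaves_def)
  then have fin: "finite ?L" using is_treeD(1)[OF gtree_is_tree[OF X]] finite_subset by blast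
  obtain A :: "'l set" where A: "finite A" "card A = card ?L"
    using infinite_arbitrarily_large[OF infinite_UNIV] by blast
  obtain h where "bij_betw h A ?L" using finite_same_card_bij[OF A(1) fin A(2)] by blast
  define \<chi> where "\<chi> = restrict h A"
  have \<chi>: "bij_betw \<chi> A ?L" unfolding \<chi>_def using \<open>bij_betw h A ?L\<close> by (simp cong: bij_betw_cong)
  \<comment> \<open>Restricting to A makes the map extensional, as membership in
    \<open>Bij A\<close> demands.\<close>
  define \<rho> where "\<rho> g = (\<lambda>a\<in>A. the_inv_into A \<chi> (act X g (\<chi> a)))" for g
  have \<chi>L: "\<chi> a \<in> ?L" if "a \<in> A" for a using \<chi> that by (auto simp: bij_betw_def)
  have \<rho>A: "\<rho> g a \<in> A" and \<chi>\<rho>: "\<chi> (\<rho> g a) = act X g (\<chi> a)" if "g \<in> carrier G" "a \<in> A" for g a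
    using bij_betw_apply[OF bij_betw_the_inv_into[OF \<chi>] act_leaf[OF X that(1) \<chi>L[OF that(2)]]]
      f_the_inv_into_f_bij_betw[OF \<chi>] act_leaf[OF X that(1) \<chi>L[OF that(2)]] that(2)
    by (simp_all add: \<rho>_def)
  have \<chi>_eq: "a = b" if "a \<in> A" "b \<in> A" "\<chi> a = \<chi> b" for a b
    using \<chi> that by (auto simp: bij_betw_def dest: inj_onD)
  have \<rho>inv: "\<rho> (inv g) (\<rho> g a) = a" "\<rho> g (\<rho> (inv g) a) = a" if "g \<in> carrier G" "a \<in> A" for g a
    using that LE \<chi>L[OF that(2)] act_inv[OF X that(1)]
    by (intro \<chi>_eq; simp add: \<rho>A \<chi>\<rho> subset_iff)+
  have Bij: "\<rho> g \<in> Bij A" if g: "g \<in> carrier G" for g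
  proof -
    have "bij_betw (\<rho> g) A A"
      by (rule bij_betw_byWitness[where f' = "\<rho> (inv g)"]) (use \<rho>inv[OF g] \<rho>A[OF g] \<rho>A[OF inv_closed[OF g]] in auto)
    then show ?thesis by (simp add: Bij_def \<rho>_def)
  qed
  have mult: "\<rho> (g \<otimes> h) = compose A (\<rho> g) (\<rho> h)" if g: "g \<in> carrier G" and h: "h \<in> carrier G" for g h
  proof (rule extensionalityI)
    show "\<rho> (g \<otimes> h) \<in> extensional A" by (simp add: \<rho>_def)
    show "compose A (\<rho> g) (\<rho> h) \<in> extensional A" by (rule compose_extensional)
    fix a assume a: "a \<in> A"
    show "\<rho> (g \<otimes> h) a = compose A (\<rho> g) (\<rho> h) a"
      using a g h LE \<chi>L[OF a] by (intro \<chi>_eq) (simp_all add: compose_eq \<rho>A \<chi>\<rho> act_mult[OF X] subset_iff)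
  qed
  have "group_action G A \<rho>"
    unfolding group_action_def group_hom_def group_hom_axioms_def
    using group_BijGroup Bij mult is_group by (auto simp: hom_def BijGroup_def)
  then have "(A, \<rho>) \<in> Obj (pointed_gset_category G)" using A(1) by (simp add: gset_Obj_iff)
  moreover have "(X, \<chi>) \<in> Obj (ltree_category G (A, \<rho>))"
    unfolding ltree_Obj_iff using X \<chi> \<chi>\<rho> by (simp add: \<chi>_def)
  ultimately show thesis by (rule that)
qed

end

lemma grothendieck_Obj_iff:
  "(a, x) \<in> Obj (grothendieck C F) \<longleftrightarrow> a \<in> Obj C \<and> x \<in> Obj (fibre F a)"
  by (simp add: grothendieck_def)

lemma grothendieck_Arr_iff:
  "(f, \<alpha>) \<in> Arr (grothendieck C F) (a, x) (b, y) \<longleftrightarrow>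
     f \<in> Arr C b a \<and> \<alpha> \<in> Arr (fibre F b) (fob (reindex F b a f) x) y"
  by (simp add: grothendieck_def)

theorem (in group) forget_labels_equivalence:
  "equivalence_of_categories (grothendieck (pointed_gset_category G) (labelled_trees G))
     (gtree_category G) (forget_labels :: (('a, 'l::infinite) gset \<times> ('a, 'l) ltree, _, _, _) fctr)"
proof -
  let ?I = "grothendieck (pointed_gset_category G) (labelled_trees G)
    :: (('a, 'l) gset \<times> ('a, 'l) ltree, ('l option \<Rightarrow> 'l option) \<times> 'l gtree_arr) cat"
  interpret O: oplax_functor "pointed_gset_category G :: (('a, 'l) gset, _) cat" "labelled_trees G"
    by (rule labelled_trees_oplax)
  \<comment> \<open>Faithfulness comes before functoriality, because the category laws of the source
    are deduced from it.\<close>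
  have inj: "inj_on (fmor forget_labels p q) (Arr ?I p q)" if p: "p \<in> Obj ?I" and q: "q \<in> Obj ?I" for p q
  proof (rule inj_onI)
    fix s t assume st: "s \<in> Arr ?I p q" "t \<in> Arr ?I p q" and eq: "fmor forget_labels p q s = fmor forget_labels p q t"
    obtain A \<rho> X \<chi> B \<sigma> Y \<xi> \<phi> \<alpha> \<psi> \<beta> where e: "p = ((A, \<rho>), (X, \<chi>))" "q = ((B, \<sigma>), (Y, \<xi>))" "s = (\<phi>, \<alpha>)" "t = (\<psi>, \<beta>)"
      by (metis surj_pair)
    have "\<alpha> () (Old d) = \<beta> () (Old d)" if "d \<in> edge_set (the_tree X)" for d
      using fun_cong[OF fun_cong[OF eq, of "()"], of d] that by (simp add: e)
    then have "\<phi> = \<psi> \<and> \<alpha> = \<beta>"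
      using p q st by (intro forget_labels_inj[of A \<rho> B \<sigma> X \<chi> Y \<xi> \<phi> \<alpha> \<psi> \<beta>])
        (simp_all add: e grothendieck_Obj_iff grothendieck_Arr_iff)
    then show "s = t" by (simp add: e)
  qed
  have F: "is_functor ?I (gtree_category G) forget_labels"
  proof (rule is_functor_of_faithful[OF gtree_category O.grothendieck_Idt_closed O.grothendieck_Cmp_closed _ _ _ _ inj])
    fix p assume p: "p \<in> Obj ?I"
    obtain A \<rho> X \<chi> where e: "p = ((A, \<rho>), (X, \<chi>))" by (metis surj_pair)
    show "fob forget_labels p \<in> Obj (gtree_category G)"
      using p by (simp add: e grothendieck_Obj_iff ltree_Obj_iff)
    show "fmor forget_labels p p (Idt ?I p) = Idt (gtree_category G) (fob forget_labels p)"
      unfolding e by (auto simp: grothendieck_def gtree_Idt pullback_unit_eq intro!: restrict_ext)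
  next
    fix p q s assume p: "p \<in> Obj ?I" and q: "q \<in> Obj ?I" and s: "s \<in> Arr ?I p q"
    obtain A \<rho> X \<chi> B \<sigma> Y \<xi> \<phi> \<alpha> where e: "p = ((A, \<rho>), (X, \<chi>))" "q = ((B, \<sigma>), (Y, \<xi>))" "s = (\<phi>, \<alpha>)"
      by (metis surj_pair)
    show "fmor forget_labels p q s \<in> Arr (gtree_category G) (fob forget_labels p) (fob forget_labels q)"
      using forget_labels_arr[of X \<chi> A \<rho> Y \<xi> B \<sigma> \<phi> \<alpha>] p q s
      by (simp add: e grothendieck_Obj_iff grothendieck_Arr_iff)
  next
    fix p q r s t assume p: "p \<in> Obj ?I" and q: "q \<in> Obj ?I" and r: "r \<in> Obj ?I"
      and s: "s \<in> Arr ?I p q" and t: "t \<in> Arr ?I q r"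
    obtain A \<rho> X \<chi> B \<sigma> Y \<xi> C \<kappa> Z \<zeta> \<phi> \<alpha> \<psi> \<beta> where
      e: "p = ((A, \<rho>), (X, \<chi>))" "q = ((B, \<sigma>), (Y, \<xi>))" "r = ((C, \<kappa>), (Z, \<zeta>))" "s = (\<phi>, \<alpha>)" "t = (\<psi>, \<beta>)"
      by (metis surj_pair)
    have "(\<lambda>_. \<lambda>e\<in>edge_set (the_tree X). \<alpha> () (Old e)) \<in> Arr (gtree_category G) X Y"
      using forget_labels_arr[of X \<chi> A \<rho> Y \<xi> B \<sigma> \<phi> \<alpha>] p q s
      by (simp add: e grothendieck_Obj_iff grothendieck_Arr_iff)
    from gtree_ArrD(2)[OF this] have "\<alpha> () (Old d) \<in> edge_set (the_tree Y)" if "d \<in> edge_set (the_tree X)" for d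
      using that by simp
    then show "fmor forget_labels p r (Cmp ?I p q r t s)
      = Cmp (gtree_category G) (fob forget_labels p) (fob forget_labels q) (fob forget_labels r)
          (fmor forget_labels q r t) (fmor forget_labels p q s)"
      unfolding e by (auto simp: grothendieck_def Let_def gtree_Cmp ltree_Cmp pullback_comp_eq compose_eq
          intro!: compose_eq_restrict[symmetric])
  qed assumption+
  show ?thesis
  proof (rule equivalence_of_fully_faithful[OF F])
    fix p q assume p: "p \<in> Obj ?I" and q: "q \<in> Obj ?I"
    obtain A \<rho> X \<chi> B \<sigma> Y \<xi> where e: "p = ((A, \<rho>), (X, \<chi>))" "q = ((B, \<sigma>), (Y, \<xi>))" by (metis surj_pair)
    have o: "(A, \<rho>) \<in> Obj (pointed_gset_category G)" "(B, \<sigma>) \<in> Obj (pointed_gset_category G)"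
      "(X, \<chi>) \<in> Obj (ltree_category G (A, \<rho>))" "(Y, \<xi>) \<in> Obj (ltree_category G (B, \<sigma>))"
      using p q by (simp_all add: e grothendieck_Obj_iff)
    have "\<exists>s\<in>Arr ?I p q. fmor forget_labels p q s = f" if f: "f \<in> Arr (gtree_category G) X Y" for f
    proof -
      obtain \<phi> \<alpha> where h: "\<phi> \<in> Arr (pointed_gset_category G) (B, \<sigma>) (A, \<rho>)"
        "\<alpha> \<in> Arr (ltree_category G (B, \<sigma>)) (pullback_tree (B, \<sigma>) (A, \<rho>) \<phi> (X, \<chi>)) (Y, \<xi>)"
        "\<And>e. e \<in> edge_set (the_tree X) \<Longrightarrow> \<alpha> () (Old e) = f () e"
        using forget_labels_surj[OF o f] by blast
      have "fmor forget_labels p q (\<phi>, \<alpha>) = f"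
        by (rule gtree_arr_eqI[OF _ f]) (use forget_labels_arr[OF o(3,4,2) h(1,2)] h(3) in \<open>simp_all add: e\<close>)
      moreover have "(\<phi>, \<alpha>) \<in> Arr ?I p q" using h by (simp add: e grothendieck_Arr_iff)
      ultimately show ?thesis by blast
    qed
    then have "Arr (gtree_category G) X Y \<subseteq> fmor forget_labels p q ` Arr ?I p q" by blast
    moreover have "fmor forget_labels p q ` Arr ?I p q \<subseteq> Arr (gtree_category G) X Y"
      using is_functor.fmor_closed[OF F p q] by (auto simp: e)
    ultimately show "bij_betw (fmor forget_labels p q) (Arr ?I p q) (Arr (gtree_category G) (fob forget_labels p) (fob forget_labels q))"
      using inj[OF p q] by (auto simp: bij_betw_def e)
  next
    fix X :: "('a, 'l) gtree" assume "X \<in> Obj (gtree_category G)"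
    then obtain A :: "'l set" and \<rho> \<chi> where "(A, \<rho>) \<in> Obj (pointed_gset_category G)"
      "(X, \<chi>) \<in> Obj (ltree_category G (A, \<rho>))" by (rule exists_labelling)
    then show "\<exists>p\<in>Obj ?I. fob forget_labels p = X"
      by (intro bexI[of _ "((A, \<rho>), (X, \<chi>))"]) (simp_all add: grothendieck_Obj_iff)
  qed
qed

theorem theorem3p15:
  fixes G :: "('g, 'x) monoid_scheme"
  assumes "group G" and "finite (carrier G)"
  shows "oplax_functor
           (pointed_gset_category G :: (('g, 'a::infinite) gset, 'a option \<Rightarrow> 'a option) cat)
           (labelled_trees G)
       \<and> (\<exists>F :: (('g, 'a) gset \<times> ('g, 'a) ltree, ('a option \<Rightarrow> 'a option) \<times> 'a gtree_arr,
                  ('g, 'a) gtree, 'a gtree_arr) fctr.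
            equivalence_of_categories
              (grothendieck (pointed_gset_category G) (labelled_trees G)) (gtree_category G) F)"
proof (intro conjI exI)
  interpret group G by (rule assms(1))
  show "oplax_functor (pointed_gset_category G :: (('g, 'a) gset, _) cat) (labelled_trees G)"
    by (rule labelled_trees_oplax)
  show "equivalence_of_categories (grothendieck (pointed_gset_category G) (labelled_trees G)) (gtree_category G)
      (forget_labels :: (('g, 'a) gset \<times> ('g, 'a) ltree, _, _, _) fctr)"
    by (rule forget_labels_equivalence)
qed

end
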